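(* Let $d\ge1$ and let $W$ be the dihedral group of order $2(2d+1)$ acting on its two-dimensional reflection representation $\mathfrak{h}$. Then $$U(\mathbb{C})=\left(-\infty,\tfrac{1}{2d+1}\right],\qquad U(\mathbb{C}_-)=\left[-\tfrac1{2d+1},+\infty\right),$$ and $U(\tau_l)=\left[-\frac{l}{2d+1},\frac{l}{2d+1}\right]$ for all $1\le l\le d$.
   Context: $W$ has a single conjugacy class of reflections, so the parameter is a real number $c$. Its irreducible representations are the trivial representation $\mathbb{C}$, the sign representation $\mathbb{C}_-$, and two-dimensional representations $\tau_l$, $1\le l\le d$, in which the counterclockwise rotation by $2\pi/(2d+1)$ acts with eigenvalues $\zeta^l,\bar\zeta^l$, $\zeta=e^{2\pi i/(2d+1)}$; $\mathfrak{h}=\tau_1$. $\mathfrak{h}$ is the complexification of the Euclidean plane $\mathfrak{h}_{\mathbb R}$ with the induced positive definite Hermitian product. Let $S$ be the set of reflections; for $s\in S$ let $\alpha_s\in\mathfrak{h}^*$ generate $\mathrm{Im}(s-1)|_{\mathfrak{h}^*}$ and $\alpha_s^\vee\in\mathfrak{h}$ generate $\mathrm{Im}(s-1)|_{\mathfrak{h}}$, with $(\alpha_s,\alpha_s^\vee)=2$. $H_c(W,\mathfrak{h})$ is the quotient of $\mathbb{C}W\ltimes T(\mathfrak{h}\oplus\mathfrak{h}^* )$ by $[x,x']=0$, $[y,y']=0$, $[y,x]=(y,x)-c\sum_{s\in S}(y,\alpha_s)(x,\alpha_s^\vee)s$ for $x,x'\in\mathfrak{h}^*$, $y,y'\in\mathfrak{h}$.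 For an irreducible representation $\tau$ of $W$, $M_c(\tau)=H_c(W,\mathfrak{h})\otimes_{\mathbb{C}W\ltimes S\mathfrak{h}}\tau$ (with $\mathfrak{h}$ acting on $\tau$ by $0$), and $L_c(\tau)$ is its unique irreducible quotient. Let $T:\mathfrak{h}\to\mathfrak{h}^*$ be the antilinear isomorphism $(Ty_1)(y_2)=(y_2,y_1)$. Fix a $W$-invariant positive definite Hermitian form on $\tau$; it extends uniquely to a $W$-invariant Hermitian form on $M_c(\tau)$ with $(yv,v')=(v,Ty\cdot v')$, whose kernel is the maximal proper submodule. $L_c(\tau)$ is unitary if the induced form is positive definite, and $U(\tau)$ is the set of real $c$ for which $L_c(\tau)$ is unitary. *)

theory Defs
  imports "HOL-Analysis.Analysis" "HOL-Algebra.Algebra"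
begin

section \<open>Free associative algebras over the complex numbers\<close>

text \<open>
  Noncommutative polynomials are finitely supported complex functions on words. Words are wrapped
  in a type of their own so that concatenation can serve as the monoid operation that the
  convolution product of \<^type>\<open>poly_mapping\<close> is built on.
\<close>

datatype 'g word = Word (letters: "'g list")

instantiation word :: (type) monoid_add
begin
definition zero_word :: "'g word" where "zero_word = Word []"
definition plus_word :: "'g word \<Rightarrow> 'g word \<Rightarrow> 'g word"
  where "plus_word u v = Word (letters u @ letters v)"
instance
  by standard (auto simp: zero_word_def plus_word_def)
end

type_synonym 'g falg = "'g word \<Rightarrow>\<^sub>0 complex"

definition free_alg :: "'g set \<Rightarrow> 'g falg ring"
  where "free_alg A =
    \<lparr>carrier = {p. \<forall>u\<in>Poly_Mapping.keys p. set (letters u) \<subseteq> A},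
     monoid.mult = (*), one = 1, ring.zero = 0, ring.add = (+)\<rparr>"

definition gen :: "'g \<Rightarrow> 'g falg"
  where "gen g = Poly_Mapping.single (Word [g]) 1"

definition const :: "complex \<Rightarrow> 'g falg"
  where "const a = Poly_Mapping.single 0 a"

section \<open>The rational Cherednik algebra\<close>

text \<open>
  Throughout, \<open>W\<close> is a finite group of real orthogonal matrices, \<open>\<hh> = complex ^ 'n\<close> is the
  complexified Euclidean space, and \<open>\<hh>\<^sup>*\<close> is the set of linear functionals on it; the pairing of
  \<open>y \<in> \<hh>\<close> with \<open>x \<in> \<hh>\<^sup>*\<close> is \<open>x y\<close>.
\<close>

type_synonym 'n functional = "complex ^ 'n \<Rightarrow> complex"

definition dual_space :: "('n::finite) functional set"
  where "dual_space = {x. Vector_Spaces.linear (*s) (*) x}"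

definition act_h :: "real ^ 'n ^ 'n \<Rightarrow> complex ^ 'n \<Rightarrow> complex ^ ('n::finite)"
  where "act_h w y = (\<chi> i j. complex_of_real (w $ i $ j)) *v y"

definition act_dual :: "real ^ 'n ^ 'n \<Rightarrow> 'n functional \<Rightarrow> ('n::finite) functional"
  where "act_dual w x = (\<lambda>y. x (act_h (matrix_inv w) y))"

definition herm :: "complex ^ 'n \<Rightarrow> complex ^ ('n::finite) \<Rightarrow> complex"
  where "herm y y' = (\<Sum>i\<in>UNIV. y $ i * cnj (y' $ i))"

text \<open>The antilinear isomorphism \<open>T\<close> from \<open>\<hh>\<close> to \<open>\<hh>\<^sup>*\<close>.\<close>

definition T_map :: "complex ^ 'n \<Rightarrow> ('n::finite) functional"
  where "T_map y1 = (\<lambda>y2. herm y2 y1)"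

definition reflections :: "(real ^ 'n ^ 'n) set \<Rightarrow> (real ^ 'n ^ ('n::finite)) set"
  where "reflections W = {s \<in> W. rank (s - mat 1) = 1}"

definition is_root_pair ::
    "real ^ 'n ^ 'n \<Rightarrow> 'n functional \<Rightarrow> complex ^ ('n::finite) \<Rightarrow> bool"
  where "is_root_pair s \<alpha> \<alpha>v \<longleftrightarrow>
    \<alpha> \<in> dual_space \<and>
    {(\<lambda>y. act_dual s x y - x y) | x. x \<in> dual_space} = {(\<lambda>y. k * \<alpha> y) | k. True} \<and>
    {act_h s y - y | y. True} = {k *s \<alpha>v | k. True} \<and>
    \<alpha> \<alpha>v = 2"

text \<open>
  For a reflection such a pair exists and is unique up to \<open>(\<alpha>, \<alpha>v) \<mapsto> (k \<alpha>, k\<^sup>-\<^sup>1 \<alpha>v)\<close>; the defining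
  relations below only involve the product of the two pairings, which does not change.
\<close>

definition root_pair :: "real ^ 'n ^ 'n \<Rightarrow> 'n functional \<times> (complex ^ ('n::finite))"
  where "root_pair s = (SOME p. is_root_pair s (fst p) (snd p))"

datatype 'n letter = Grp "real ^ 'n ^ 'n" | Vec "complex ^ 'n" | Cov "'n functional"

definition all_letters :: "(real ^ 'n ^ 'n) set \<Rightarrow> ('n::finite) letter set"
  where "all_letters W = Grp ` W \<union> range Vec \<union> Cov ` dual_space"

text \<open>Relations presenting \<open>\<complex>W \<ltimes> T(\<hh> \<oplus> \<hh>\<^sup>*)\<close> on the letters \<open>W\<close>, \<open>\<hh>\<close>, \<open>\<hh>\<^sup>*\<close>.\<close>

definition smash_rels :: "(real ^ 'n ^ 'n) set \<Rightarrow> ('n::finite) letter falg set"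
  where "smash_rels W =
      {gen (Grp (mat 1)) - 1}
    \<union> {gen (Grp w) * gen (Grp w') - gen (Grp (w ** w')) | w w'. w \<in> W \<and> w' \<in> W}
    \<union> {gen (Vec (y + y')) - gen (Vec y) - gen (Vec y') | y y'. True}
    \<union> {gen (Vec (a *s y)) - const a * gen (Vec y) | a y. True}
    \<union> {gen (Cov (\<lambda>y. x y + x' y)) - gen (Cov x) - gen (Cov x')
         | x x'. x \<in> dual_space \<and> x' \<in> dual_space}
    \<union> {gen (Cov (\<lambda>y. a * x y)) - const a * gen (Cov x) | a x. x \<in> dual_space}
    \<union> {gen (Grp w) * gen (Vec y) - gen (Vec (act_h w y)) * gen (Grp w) | w y. w \<in> W}
    \<union> {gen (Grp w) * gen (Cov x) - gen (Cov (act_dual w x)) * gen (Grp w)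
         | w x. w \<in> W \<and> x \<in> dual_space}"

definition cherednik_rels ::
    "(real ^ 'n ^ 'n) set \<Rightarrow> real \<Rightarrow> ('n::finite) letter falg set"
  where "cherednik_rels W c =
      {gen (Cov x) * gen (Cov x') - gen (Cov x') * gen (Cov x)
         | x x'. x \<in> dual_space \<and> x' \<in> dual_space}
    \<union> {gen (Vec y) * gen (Vec y') - gen (Vec y') * gen (Vec y) | y y'. True}
    \<union> {gen (Vec y) * gen (Cov x) - gen (Cov x) * gen (Vec y)
         - (const (x y) - const (complex_of_real c) *
              (\<Sum>s\<in>reflections W.
                 const (fst (root_pair s) y * x (snd (root_pair s))) * gen (Grp s)))
         | x y. x \<in> dual_space}"

definition cherednik_ideal ::
    "(real ^ 'n ^ 'n) set \<Rightarrow> real \<Rightarrow> ('n::finite) letter falg set"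
  where "cherednik_ideal W c =
    Idl\<^bsub>free_alg (all_letters W)\<^esub> (smash_rels W \<union> cherednik_rels W c)"

definition cherednik_alg ::
    "(real ^ 'n ^ 'n) set \<Rightarrow> real \<Rightarrow> ('n::finite) letter falg set ring"
  where "cherednik_alg W c = free_alg (all_letters W) Quot cherednik_ideal W c"

definition cls ::
    "(real ^ 'n ^ 'n) set \<Rightarrow> real \<Rightarrow> 'n letter falg \<Rightarrow> ('n::finite) letter falg set"
  where "cls W c p = cherednik_ideal W c +>\<^bsub>free_alg (all_letters W)\<^esub> p"

section \<open>Representations of the group\<close>

type_synonym ('n, 'k) grp_rep = "real ^ 'n ^ 'n \<Rightarrow> complex ^ 'k ^ 'k"

definition is_rep :: "(real ^ 'n ^ 'n) set \<Rightarrow> ('n::finite, 'k::finite) grp_rep \<Rightarrow> bool"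
  where "is_rep W \<tau> \<longleftrightarrow>
    \<tau> (mat 1) = mat 1 \<and> (\<forall>w\<in>W. \<forall>w'\<in>W. \<tau> (w ** w') = \<tau> w ** \<tau> w')"

definition irreducible_rep ::
    "(real ^ 'n ^ 'n) set \<Rightarrow> ('n::finite, 'k::finite) grp_rep \<Rightarrow> bool"
  where "irreducible_rep W \<tau> \<longleftrightarrow> is_rep W \<tau> \<and>
    (\<forall>U. vec.subspace U \<and> (\<forall>w\<in>W. \<forall>v\<in>U. \<tau> w *v v \<in> U) \<longrightarrow> U = {0} \<or> U = UNIV)"

section \<open>Standard modules and their irreducible quotients\<close>

text \<open>
  The action of \<open>\<complex>W \<ltimes> S\<hh>\<close> on \<open>\<tau>\<close>, with \<open>\<hh>\<close> acting by zero, as an action of the free algebra on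
  the letters \<open>W\<close>, \<open>\<hh>\<close>. The value on the letters from \<open>\<hh>\<^sup>*\<close> is irrelevant.
\<close>

fun letter_act :: "('n::finite, 'k::finite) grp_rep \<Rightarrow> 'n letter \<Rightarrow> complex ^ 'k \<Rightarrow> complex ^ 'k"
  where
    "letter_act \<tau> (Grp w) v = \<tau> w *v v"
  | "letter_act \<tau> (Vec y) v = 0"
  | "letter_act \<tau> (Cov x) v = 0"

definition rep_act ::
    "('n::finite, 'k::finite) grp_rep \<Rightarrow> 'n letter falg \<Rightarrow> complex ^ 'k \<Rightarrow> complex ^ 'k"
  where "rep_act \<tau> p v =
    (\<Sum>u\<in>Poly_Mapping.keys p. Poly_Mapping.lookup p u *s foldr (letter_act \<tau>) (letters u) v)"

definition sub_letters :: "(real ^ 'n ^ 'n) set \<Rightarrow> ('n::finite) letter set"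
  where "sub_letters W = Grp ` W \<union> range Vec"

text \<open>
  The tensor product over \<open>B = \<complex>W \<ltimes> S\<hh>\<close> is the free abelian group on pairs modulo biadditivity and
  \<open>B\<close>-balancedness. The balancing relation is imposed for all elements of the free algebra on the
  letters \<open>W\<close>, \<open>\<hh>\<close>: this algebra maps onto \<open>B\<close>, and both its right action on the Cherednik algebra and
  its left action on \<open>\<tau>\<close> are the ones through \<open>B\<close>. The scalars are among the elements of \<open>B\<close>.
\<close>

type_synonym ('n, 'k) pre_tensor = "('n letter falg set \<times> (complex ^ 'k)) \<Rightarrow>\<^sub>0 int"

definition pre_tensor_group ::
    "(real ^ 'n ^ 'n) set \<Rightarrow> real \<Rightarrow> ('n::finite, 'k::finite) grp_rep
      \<Rightarrow> ('n, 'k) pre_tensor monoid"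
  where "pre_tensor_group W c \<tau> = free_Abelian_group (carrier (cherednik_alg W c) \<times> UNIV)"

definition tensor_rels ::
    "(real ^ 'n ^ 'n) set \<Rightarrow> real \<Rightarrow> ('n::finite, 'k::finite) grp_rep
      \<Rightarrow> ('n, 'k) pre_tensor set"
  where "tensor_rels W c \<tau> = (let H = cherednik_alg W c in
      {frag_of (a \<oplus>\<^bsub>H\<^esub> b, v) - frag_of (a, v) - frag_of (b, v)
         | a b v. a \<in> carrier H \<and> b \<in> carrier H}
    \<union> {frag_of (a, v + v') - frag_of (a, v) - frag_of (a, v') | a v v'. a \<in> carrier H}
    \<union> {frag_of (a \<otimes>\<^bsub>H\<^esub> cls W c p, v) - frag_of (a, rep_act \<tau> p v)
         | a p v. a \<in> carrier H \<and> p \<in> carrier (free_alg (sub_letters W))})"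

definition tensor_kernel ::
    "(real ^ 'n ^ 'n) set \<Rightarrow> real \<Rightarrow> ('n::finite, 'k::finite) grp_rep
      \<Rightarrow> ('n, 'k) pre_tensor set"
  where "tensor_kernel W c \<tau> = generate (pre_tensor_group W c \<tau>) (tensor_rels W c \<tau>)"

text \<open>\<open>M_c(\<tau>)\<close> as an abelian group, written multiplicatively as usual for \<open>Mod\<close>.\<close>

definition std_module ::
    "(real ^ 'n ^ 'n) set \<Rightarrow> real \<Rightarrow> ('n::finite, 'k::finite) grp_rep
      \<Rightarrow> ('n, 'k) pre_tensor set monoid"
  where "std_module W c \<tau> = pre_tensor_group W c \<tau> Mod tensor_kernel W c \<tau>"

definition tens ::
    "(real ^ 'n ^ 'n) set \<Rightarrow> real \<Rightarrow> ('n::finite, 'k::finite) grp_rep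
      \<Rightarrow> 'n letter falg set \<Rightarrow> complex ^ 'k \<Rightarrow> ('n, 'k) pre_tensor set"
  where "tens W c \<tau> a v = tensor_kernel W c \<tau> #>\<^bsub>pre_tensor_group W c \<tau>\<^esub> frag_of (a, v)"

text \<open>
  The left action \<open>h \<cdot> (a \<otimes> v) = h a \<otimes> v\<close>. The image of a coset lies in a single coset, which is
  recovered by adding the subgroup.
\<close>

definition std_act ::
    "(real ^ 'n ^ 'n) set \<Rightarrow> real \<Rightarrow> ('n::finite, 'k::finite) grp_rep
      \<Rightarrow> 'n letter falg set \<Rightarrow> ('n, 'k) pre_tensor set \<Rightarrow> ('n, 'k) pre_tensor set"
  where "std_act W c \<tau> h m =
    tensor_kernel W c \<tau> <#>\<^bsub>pre_tensor_group W c \<tau>\<^esub>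
      (frag_extend (\<lambda>(a, v). frag_of (h \<otimes>\<^bsub>cherednik_alg W c\<^esub> a, v)) ` m)"

definition submodule_std ::
    "(real ^ 'n ^ 'n) set \<Rightarrow> real \<Rightarrow> ('n::finite, 'k::finite) grp_rep
      \<Rightarrow> ('n, 'k) pre_tensor set set \<Rightarrow> bool"
  where "submodule_std W c \<tau> J \<longleftrightarrow>
    subgroup J (std_module W c \<tau>) \<and>
    (\<forall>h\<in>carrier (cherednik_alg W c). \<forall>m\<in>J. std_act W c \<tau> h m \<in> J)"

definition maximal_submodule_std ::
    "(real ^ 'n ^ 'n) set \<Rightarrow> real \<Rightarrow> ('n::finite, 'k::finite) grp_rep
      \<Rightarrow> ('n, 'k) pre_tensor set set \<Rightarrow> bool"
  where "maximal_submodule_std W c \<tau> J \<longleftrightarrow>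
    submodule_std W c \<tau> J \<and> J \<noteq> carrier (std_module W c \<tau>) \<and>
    (\<forall>K. submodule_std W c \<tau> K \<and> K \<noteq> carrier (std_module W c \<tau>) \<and> J \<subseteq> K \<longrightarrow> K = J)"

definition max_submodule ::
    "(real ^ 'n ^ 'n) set \<Rightarrow> real \<Rightarrow> ('n::finite, 'k::finite) grp_rep
      \<Rightarrow> ('n, 'k) pre_tensor set set"
  where "max_submodule W c \<tau> = (THE J. maximal_submodule_std W c \<tau> J)"

text \<open>\<open>L_c(\<tau>)\<close> as an abelian group; the action of the algebra is the one induced by \<^const>\<open>std_act\<close>.\<close>

definition irr_module ::
    "(real ^ 'n ^ 'n) set \<Rightarrow> real \<Rightarrow> ('n::finite, 'k::finite) grp_rep
      \<Rightarrow> ('n, 'k) pre_tensor set set monoid"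
  where "irr_module W c \<tau> = std_module W c \<tau> Mod max_submodule W c \<tau>"

section \<open>Hermitian forms and unitarity\<close>

text \<open>Forms are linear in the first and antilinear in the second argument.\<close>

definition hermitian_form ::
    "'a monoid \<Rightarrow> (complex \<Rightarrow> 'a \<Rightarrow> 'a) \<Rightarrow> ('a \<Rightarrow> 'a \<Rightarrow> complex) \<Rightarrow> bool"
  where "hermitian_form G sc \<beta> \<longleftrightarrow>
    (\<forall>u\<in>carrier G. \<forall>u'\<in>carrier G. \<forall>v\<in>carrier G. \<beta> (u \<otimes>\<^bsub>G\<^esub> u') v = \<beta> u v + \<beta> u' v) \<and>
    (\<forall>a. \<forall>u\<in>carrier G. \<forall>v\<in>carrier G. \<beta> (sc a u) v = a * \<beta> u v) \<and>
    (\<forall>u\<in>carrier G. \<forall>v\<in>carrier G. \<beta> v u = cnj (\<beta> u v))"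

definition positive_definite :: "'a monoid \<Rightarrow> ('a \<Rightarrow> 'a \<Rightarrow> complex) \<Rightarrow> bool"
  where "positive_definite G \<beta> \<longleftrightarrow>
    (\<forall>u\<in>carrier G. u \<noteq> \<one>\<^bsub>G\<^esub> \<longrightarrow> \<beta> u u \<in> \<real> \<and> Re (\<beta> u u) > 0)"

definition vec_group :: "(complex ^ 'k) monoid"
  where "vec_group = \<lparr>carrier = UNIV, monoid.mult = (+), one = 0\<rparr>"

definition invariant_inner_product ::
    "(real ^ 'n ^ 'n) set \<Rightarrow> ('n::finite, 'k::finite) grp_rep
      \<Rightarrow> (complex ^ 'k \<Rightarrow> complex ^ 'k \<Rightarrow> complex) \<Rightarrow> bool"
  where "invariant_inner_product W \<tau> \<beta>0 \<longleftrightarrow>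
    hermitian_form vec_group (*s) \<beta>0 \<and> positive_definite vec_group \<beta>0 \<and>
    (\<forall>w\<in>W. \<forall>v v'. \<beta>0 (\<tau> w *v v) (\<tau> w *v v') = \<beta>0 v v')"

definition contravariant_form ::
    "(real ^ 'n ^ 'n) set \<Rightarrow> real \<Rightarrow> ('n::finite, 'k::finite) grp_rep
      \<Rightarrow> (complex ^ 'k \<Rightarrow> complex ^ 'k \<Rightarrow> complex)
      \<Rightarrow> (('n, 'k) pre_tensor set \<Rightarrow> ('n, 'k) pre_tensor set \<Rightarrow> complex) \<Rightarrow> bool"
  where "contravariant_form W c \<tau> \<beta>0 \<beta> \<longleftrightarrow>
    (let M = std_module W c \<tau>; H = cherednik_alg W c;
         act = (\<lambda>p. std_act W c \<tau> (cls W c p))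
     in hermitian_form M (\<lambda>a. act (const a)) \<beta> \<and>
        (\<forall>v v'. \<beta> (tens W c \<tau> \<one>\<^bsub>H\<^esub> v) (tens W c \<tau> \<one>\<^bsub>H\<^esub> v') = \<beta>0 v v') \<and>
        (\<forall>w\<in>W. \<forall>m\<in>carrier M. \<forall>m'\<in>carrier M.
           \<beta> (act (gen (Grp w)) m) (act (gen (Grp w)) m') = \<beta> m m') \<and>
        (\<forall>y. \<forall>m\<in>carrier M. \<forall>m'\<in>carrier M.
           \<beta> (act (gen (Vec y)) m) m' = \<beta> m (act (gen (Cov (T_map y))) m')))"

text \<open>
  The invariant inner product \<open>\<beta>0\<close> on an irreducible \<open>\<tau>\<close> exists and is unique up to a positive factor,
  \<open>\<beta>\<close> is its unique contravariant extension and \<open>\<gamma>\<close> the form induced by \<open>\<beta>\<close>, so unitarity does not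
  depend on the choice of \<open>\<beta>0\<close>.
\<close>

definition unitary_irr ::
    "(real ^ 'n ^ 'n) set \<Rightarrow> real \<Rightarrow> ('n::finite, 'k::finite) grp_rep \<Rightarrow> bool"
  where "unitary_irr W c \<tau> \<longleftrightarrow>
    (\<exists>\<beta>0 \<beta> \<gamma>. invariant_inner_product W \<tau> \<beta>0 \<and> contravariant_form W c \<tau> \<beta>0 \<beta> \<and>
      (let M = std_module W c \<tau>; J = max_submodule W c \<tau>
       in (\<forall>m\<in>carrier M. \<forall>m'\<in>carrier M. \<gamma> (J #>\<^bsub>M\<^esub> m) (J #>\<^bsub>M\<^esub> m') = \<beta> m m')) \<and>
      positive_definite (irr_module W c \<tau>) \<gamma>)"

definition unitary_set ::
    "(real ^ 'n ^ 'n) set \<Rightarrow> ('n::finite, 'k::finite) grp_rep \<Rightarrow> real set"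
  where "unitary_set W \<tau> = {c. unitary_irr W c \<tau>}"

section \<open>Dihedral groups and their irreducible representations\<close>

definition rotation :: "real \<Rightarrow> real ^ 2 ^ 2"
  where "rotation \<theta> = vector [vector [cos \<theta>, - sin \<theta>], vector [sin \<theta>, cos \<theta>]]"

definition axis_reflection :: "real ^ 2 ^ 2"
  where "axis_reflection = vector [vector [1, 0], vector [0, -1]]"

text \<open>The symmetry group of a regular \<open>m\<close>-gon centred at the origin, of order \<open>2 m\<close> for \<open>m \<ge> 3\<close>.\<close>

definition dihedral :: "nat \<Rightarrow> (real ^ 2 ^ 2) set"
  where "dihedral m =
      (\<lambda>k. rotation (2 * pi * real k / real m)) ` {..<m}
    \<union> (\<lambda>k. rotation (2 * pi * real k / real m) ** axis_reflection) ` {..<m}"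

definition triv_rep :: "(2, 1) grp_rep"
  where "triv_rep w = mat 1"

definition sign_rep :: "(2, 1) grp_rep"
  where "sign_rep w = mat (complex_of_real (det w))"

definition is_tau :: "nat \<Rightarrow> nat \<Rightarrow> (2, 2) grp_rep \<Rightarrow> bool"
  where "is_tau m l \<tau> \<longleftrightarrow> irreducible_rep (dihedral m) \<tau> \<and>
    {z. \<exists>v. v \<noteq> 0 \<and> \<tau> (rotation (2 * pi / real m)) *v v = z *s v}
      = {cis (2 * pi / real m) ^ l, cnj (cis (2 * pi / real m)) ^ l}"

end

theory Submission
  imports Defs "HOL-Library.Function_Algebras"
begin

text \<open>
  The proof reads everything off a module that is easier to handle than \<open>M_c(\<tau>)\<close>: the space
  \<open>T(\<hh>\<^sup>*) \<otimes> \<tau>\<close>, realised as functions on words in the coordinate functionals. A coordinate \<open>x_i\<close>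
  acts by prefixing a letter (\<open>raise\<close>), \<open>W\<close> acts diagonally (\<open>rho\<close>), and the action \<open>lower\<close> of the
  basis of \<open>\<hh>\<close> is forced by killing \<open>\<tau>\<close> and by the formula for \<open>[y, x]\<close>. Two facts make this a
  substitute for the PBW theorem. First, the operators \<open>lower\<close> commute, because \<open>[[y, x], y']\<close> is
  symmetric in \<open>y\<close> and \<open>y'\<close>. Second, the tensor space carries a Hermitian form in which \<open>x_i\<close> is
  adjoint to \<open>y_i\<close>, so commutators of the \<open>x_i\<close>, being adjoint to commutators of the \<open>y_i\<close>, lie in
  its radical. Hence the Cherednik algebra acts on the tensor space modulo the radical
  (\<open>J_radical\<close>).

  The tensors of finite support map onto \<open>M_c(\<tau>)\<close> equivariantly, with kernel inside the radical
  (\<open>frag_of_tens_act\<close>, \<open>frag_of_tens_surj\<close>, \<open>frag_of_tens_kernel_radical\<close>), so the form descends to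
  the contravariant form of \<open>M_c(\<tau>)\<close>. The Euler element of the algebra acts on degree \<open>k\<close> by \<open>k\<close>
  and separates degrees; therefore a proper submodule has no component in degree 0, and the image of
  the radical is the largest one (\<open>max_submodule_eq\<close>). Unitarity thus means that the form is positive
  semidefinite in each degree (\<open>unitary_if_psd\<close>, \<open>psd_if_unitary\<close>).

  Positivity goes by induction on the degree. If the sum \<open>Z\<close> of all reflections acts on \<open>\<tau>\<close> by the
  scalar \<open>r\<close>, then \<open>\<Sum> x_i y_i\<close> acts on degree \<open>k\<close> by \<open>k + c (Z - r)\<close>, while
  \<open>(\<Sum> x_i y_i u, u) = \<Sum> (y_i u, y_i u)\<close>. So the form is nonnegative on an eigenspace of \<open>Z\<close> with
  eigenvalue \<open>\<mu>\<close> as soon as it is so one degree lower and \<open>k + c (\<mu> - r) \<ge> 0\<close> (\<open>psd_eigen\<close>). In the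
  dihedral group of order \<open>2 m\<close> the eigenvalues of \<open>Z\<close> are \<open>m\<close>, \<open>- m\<close> and 0, and nonzero ones need a
  vector invariant under rotations. There is none in degree 1 over the one-dimensional
  representations, and none below degree \<open>l\<close> over \<open>\<tau>_l\<close>; this gives the stated intervals
  (\<open>psd_character\<close>, \<open>psd_tau\<close>).

  Conversely, the norm of \<open>x \<otimes> v\<close> over the character with value \<open>e\<close> on reflections is a positive
  multiple of \<open>1 - c e m\<close>, and over \<open>\<tau>_l\<close>, with \<open>z\<close> the coordinate on which rotations act by a
  scalar and \<open>v\<close> the eigenvector of rotations with eigenvalue \<open>\<zeta>\<^sup>l\<close>, the two combinations of
  \<open>z\<^sup>l \<otimes> v\<close> with its mirror image have norms that are positive multiples of \<open>l + c m\<close> and \<open>l - c m\<close>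
  (\<open>character_bound\<close>, \<open>tau_bound\<close>).
\<close>

section \<open>Tensors as functions on words\<close>

type_synonym ('n, 'k) tens = "'n list \<Rightarrow> complex ^ 'k"

definition scl :: "complex \<Rightarrow> ('b \<Rightarrow> complex ^ 'k) \<Rightarrow> 'b \<Rightarrow> complex ^ ('k::finite)"
  where "scl a u = (\<lambda>w. a *s u w)"

lemma scl_apply [simp]: "scl a u w = a *s u w"
  by (simp add: scl_def)

interpretation tm: vector_space "scl :: complex \<Rightarrow> ('b \<Rightarrow> complex ^ 'k::finite) \<Rightarrow> 'b \<Rightarrow> complex ^ 'k"
  by unfold_locales (auto simp: fun_eq_iff vec.scale_right_distrib vec.scale_left_distrib)

lemma sum_fun_apply: "(\<Sum>i\<in>A. f i) w = (\<Sum>i\<in>A. f i w)" for f :: "_ \<Rightarrow> _ \<Rightarrow> 'c::comm_monoid_add"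
  by (induction A rule: infinite_finite_induct) auto

lemma sum_swap3:
  "(\<Sum>p\<in>A. \<Sum>q\<in>B. \<Sum>s\<in>D. f p q s) = (\<Sum>s\<in>D. \<Sum>p\<in>A. \<Sum>q\<in>B. f p q s)"
  by (rule trans[OF sum.cong[OF refl sum.swap] sum.swap])

text \<open>
  Maps between function spaces are treated with this elementary notion of linearity, over the
  pointwise operations.
\<close>

definition linop :: "(('b \<Rightarrow> complex ^ 'k) \<Rightarrow> 'c \<Rightarrow> complex ^ ('k::finite)) \<Rightarrow> bool"
  where "linop f \<longleftrightarrow> (\<forall>u v. f (u + v) = f u + f v) \<and> (\<forall>a u. f (scl a u) = scl a (f u))"

lemma linopI:
  assumes "\<And>u v. f (u + v) = f u + f v" "\<And>a u. f (scl a u) = scl a (f u)"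
  shows "linop f"
  using assms by (simp add: linop_def)

lemma linop_add: "linop f \<Longrightarrow> f (u + v) = f u + f v"
  and linop_scl: "linop f \<Longrightarrow> f (scl a u) = scl a (f u)"
  by (simp_all add: linop_def)

lemma linop_0: "linop f \<Longrightarrow> f 0 = 0"
  using linop_scl[of f 0 0] by simp

lemma linop_minus: "linop f \<Longrightarrow> f (- u) = - f u"
  using linop_scl[of f "-1" u] by simp

lemma linop_diff: "linop f \<Longrightarrow> f (u - v) = f u - f v"
  by (simp only: diff_conv_add_uminus linop_add linop_minus)

lemma linop_sum: "linop f \<Longrightarrow> f (\<Sum>i\<in>A. g i) = (\<Sum>i\<in>A. f (g i))"
  by (induction A rule: infinite_finite_induct) (auto simp: linop_0 linop_add)

lemmas linop_rules = linop_add linop_scl linop_0 linop_minus linop_diff linop_sum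

text \<open>
  A function on words stands for the tensor with these coefficients: \<open>emb v\<close> is \<open>1 \<otimes> v\<close>, \<open>raise j\<close>
  is left multiplication by \<open>x_j\<close>, and \<open>cut j\<close> extracts the part that starts with \<open>x_j\<close>. Infinite
  sums of tensors are included; this costs nothing and makes recursion on words available.
\<close>

definition emb :: "complex ^ 'k \<Rightarrow> ('n, 'k::finite) tens"
  where "emb v = (\<lambda>w. if w = [] then v else 0)"

definition cut :: "'n \<Rightarrow> ('n, 'k) tens \<Rightarrow> ('n, 'k) tens"
  where "cut j u = (\<lambda>w. u (j # w))"

definition raise :: "'n \<Rightarrow> ('n, 'k) tens \<Rightarrow> ('n, 'k::finite) tens"
  where "raise j u = (\<lambda>w. case w of [] \<Rightarrow> 0 | i # w' \<Rightarrow> if i = j then u w' else 0)"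

lemma emb_simps [simp]: "emb v [] = v" "emb v (j # w) = 0"
  by (simp_all add: emb_def)

lemma cut_apply [simp]: "cut j u w = u (j # w)"
  by (simp add: cut_def)

lemma raise_simps [simp]: "raise j u [] = 0" "raise j u (i # w) = (if i = j then u w else 0)"
  by (simp_all add: raise_def)

lemma tens_eqI:
  assumes "u [] = v []" "\<And>j. cut j u = cut j v"
  shows "u = v"
proof
  fix w show "u w = v w" using assms by (cases w) (auto simp: fun_eq_iff)
qed

lemma linop_raise: "linop (raise j)"
  by (auto intro!: linopI simp: fun_eq_iff raise_def split: list.splits)

lemma cut_rules [simp]:
  "cut j (u + v) = cut j u + cut j v" "cut j (scl a u) = scl a (cut j u)" "cut j 0 = 0"
  "cut j (- u) = - cut j u" "cut j (u - v) = cut j u - cut j v"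
  "cut j (\<Sum>i\<in>A. f i) = (\<Sum>i\<in>A. cut j (f i))"
  by (auto simp: fun_eq_iff sum_fun_apply)

lemma cut_emb [simp]: "cut j (emb v) = 0"
  by (auto simp: fun_eq_iff)

lemma cut_raise [simp]: "cut j (raise i u) = (if i = j then u else 0)"
  by (auto simp: fun_eq_iff)

lemma emb_add: "emb (v + v') = emb v + emb v'"
  and emb_scl: "emb (a *s v) = scl a (emb v)"
  and emb_0: "emb 0 = 0"
  by (auto simp: fun_eq_iff emb_def)

lemma letter_decomp:
  fixes u :: "('n::finite, 'k::finite) tens"
  shows "u = emb (u []) + (\<Sum>j\<in>UNIV. raise j (cut j u))"
  by (rule tens_eqI) (auto simp: sum_fun_apply)

lemma raise_cong:
  assumes "\<And>w'. length w' < length w \<Longrightarrow> u w' = v w'"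
  shows "raise j u w = raise j v w"
  using assms by (cases w) auto

text \<open>
  Identities between operators are proved by induction on the length of the word at which the results
  are evaluated: by linearity it is enough to compare values on \<open>1 \<otimes> v\<close> and on \<open>x_j u\<close>.
\<close>

lemma linop_eqI:
  fixes F G :: "('n::finite, 'k::finite) tens \<Rightarrow> ('n, 'k) tens"
  assumes "linop F" "linop G" "\<And>v. F (emb v) = G (emb v)"
    and step: "\<And>w j u. (\<And>w' u. length w' < length w \<Longrightarrow> F u w' = G u w')
                 \<Longrightarrow> F (raise j u) w = G (raise j u) w"
  shows "F u = G u"
proof
  fix w
  show "F u w = G u w"
  proof (induction "length w" arbitrary: w u rule: less_induct)
    case less
    have "F (raise j (cut j u)) w = G (raise j (cut j u)) w" for j
      by (rule step) (use less in auto)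
    moreover have D: "H u = H (emb (u [])) + (\<Sum>j\<in>UNIV. H (raise j (cut j u)))" if "linop H" for H
      using arg_cong[OF letter_decomp[of u], of H] by (simp only: linop_rules[OF that])
    ultimately show ?case
      unfolding D[OF assms(1)] D[OF assms(2)] by (simp add: sum_fun_apply assms(3))
  qed
qed

section \<open>The group and the lowering operators\<close>

text \<open>
  The shape \<open>s = 1 - n n\<^sup>T\<close> of a reflection is needed for two things: \<open>s\<close> is symmetric, and the
  two-by-two minors of \<open>1 - s\<close> vanish, which is what makes the lowering operators commute.
\<close>

locale refl_rep =
  fixes W :: "(real ^ 'n ^ 'n) set" and S :: "(real ^ ('n::finite) ^ 'n) set"
    and c :: real and \<tau> :: "('n, 'k::finite) grp_rep"
  assumes fin_W: "finite W"
    and one_W: "mat 1 \<in> W"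
    and mult_W: "g \<in> W \<Longrightarrow> h \<in> W \<Longrightarrow> g ** h \<in> W"
    and transpose_W: "g \<in> W \<Longrightarrow> transpose g \<in> W"
    and orth_W: "g \<in> W \<Longrightarrow> transpose g ** g = mat 1"
    and S_W: "S \<subseteq> W"
    and refl_S: "s \<in> S \<Longrightarrow> \<exists>n. \<forall>i j. s $ i $ j = (if i = j then 1 else 0) - n i * n j"
    and conj_S: "g \<in> W \<Longrightarrow> s \<in> S \<Longrightarrow> g ** s ** transpose g \<in> S"
    and rep: "is_rep W \<tau>"
begin

abbreviation kd :: "'n \<Rightarrow> 'n \<Rightarrow> complex" where "kd i j \<equiv> (if i = j then 1 else 0)"
abbreviation en :: "real ^ 'n ^ 'n \<Rightarrow> 'n \<Rightarrow> 'n \<Rightarrow> complex"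
  where "en g i j \<equiv> complex_of_real (g $ i $ j)"

lemma orth_W': "g \<in> W \<Longrightarrow> g ** transpose g = mat 1"
  using orth_W[of "transpose g"] transpose_W by (simp add: transpose_transpose)

lemma en_mult: "en (g ** h) i j = (\<Sum>k\<in>UNIV. en g i k * en h k j)"
  by (simp add: matrix_matrix_mult_def)

lemma en_one: "en (mat 1) i j = kd i j"
  by (simp add: mat_def)

lemma en_orth: 
  assumes "g \<in> W" 
  shows "(\<Sum>k\<in>UNIV. en g k i * en g k j) = kd i j" "(\<Sum>k\<in>UNIV. en g i k * en g j k) = kd i j"
  using en_mult[of "transpose g" g i j] en_mult[of g "transpose g" i j] assms
  by (simp_all only: orth_W orth_W' en_one) (simp_all add: transpose_def)

lemma S_sym: "s \<in> S \<Longrightarrow> s $ i $ j = s $ j $ i"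
  using refl_S[of s] by (auto simp: mult.commute)

lemma S_transpose: "s \<in> S \<Longrightarrow> transpose s = s"
  using S_sym[of s] by (simp add: transpose_def vec_eq_iff)

lemma S_invol: "s \<in> S \<Longrightarrow> s ** s = mat 1"
  using orth_W[of s] S_transpose S_W by auto

text \<open>
  The diagonal action on \<open>T(\<hh>\<^sup>*) \<otimes> \<tau>\<close>, by \<open>g x_j = \<Sum>\<^sub>i g\<^sub>i\<^sub>j x_i\<close> for orthogonal \<open>g\<close>.
\<close>

primrec grp_w :: "real ^ 'n ^ 'n \<Rightarrow> 'n list \<Rightarrow> ('n, 'k) tens \<Rightarrow> complex ^ 'k" where
  "grp_w g [] u = \<tau> g *v u []"
| "grp_w g (i # w) u = (\<Sum>j\<in>UNIV. en g i j *s grp_w g w (cut j u))"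

definition rho :: "real ^ 'n ^ 'n \<Rightarrow> ('n, 'k) tens \<Rightarrow> ('n, 'k) tens"
  where "rho g u = (\<lambda>w. grp_w g w u)"

lemma rho_Nil [simp]: "rho g u [] = \<tau> g *v u []"
  by (simp add: rho_def)

lemma cut_rho: "cut i (rho g u) = (\<Sum>j\<in>UNIV. scl (en g i j) (rho g (cut j u)))"
  by (auto simp: rho_def fun_eq_iff sum_fun_apply)

lemma linop_rho: "linop (rho g)"
proof -
  have 1: "grp_w g w (u + v) = grp_w g w u + grp_w g w v" for w u v
    by (induction w arbitrary: u v) (auto simp: matrix_vector_right_distrib vec.scale_right_distrib sum.distrib)
  have 2: "grp_w g w (scl a u) = a *s grp_w g w u" for a w u
    by (induction w arbitrary: u)
       (auto simp: vec.scale_sum_right mult.commute vector_scalar_commute)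
  show ?thesis by (rule linopI) (auto simp: rho_def fun_eq_iff 1 2)
qed

lemmas rho_rules = linop_rules[OF linop_rho]

lemma rho_emb: "rho g (emb v) = emb (\<tau> g *v v)"
  by (rule tens_eqI) (auto simp: cut_rho rho_rules)

lemma rho_raise: "rho g (raise j u) = (\<Sum>i\<in>UNIV. scl (en g i j) (raise i (rho g u)))"
proof (rule tens_eqI)
  fix i show "cut i (rho g (raise j u)) = cut i (\<Sum>i\<in>UNIV. scl (en g i j) (raise i (rho g u)))"
    by (simp add: cut_rho if_distrib[of "rho g"] if_distrib[of "scl _"] rho_rules sum.delta sum.delta' cong: if_cong)
qed (simp add: sum_fun_apply)

lemma linop_comp: "linop F \<Longrightarrow> linop G \<Longrightarrow> linop (\<lambda>u. F (G u))"
  and linop_sumop: "(\<And>i. i \<in> A \<Longrightarrow> linop (H i)) \<Longrightarrow> linop (\<lambda>u. \<Sum>i\<in>A. H i u)"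
  and linop_sclop: "linop F \<Longrightarrow> linop (\<lambda>u. scl a (F u))"
  and linop_diffop: "linop F \<Longrightarrow> linop G \<Longrightarrow> linop (\<lambda>u. F u - G u)"
  and linop_addop: "linop F \<Longrightarrow> linop G \<Longrightarrow> linop (\<lambda>u. F u + G u)"
  and linop_id: "linop (\<lambda>u. u)"
proof -
  show "(\<And>i. i \<in> A \<Longrightarrow> linop (H i)) \<Longrightarrow> linop (\<lambda>u. \<Sum>i\<in>A. H i u)"
    by (auto simp: linop_def sum.distrib tm.scale_sum_right)
qed (auto simp: linop_def tm.scale_right_distrib mult.commute tm.scale_right_diff_distrib)

lemma rho_one: "rho (mat 1) u = u"
proof (rule linop_eqI[where G = "\<lambda>u. u"])
  fix w :: "'n list" and j u assume IH: "\<And>w' u. length w' < length w \<Longrightarrow> rho (mat 1) u w' = u w'"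
  have "rho (mat 1) (raise j u) = raise j (rho (mat 1) u)"
    by (simp add: rho_raise mat_def if_distrib[of "\<lambda>a. scl a _"] if_distrib[of complex_of_real] sum.delta cong: if_cong)
  then show "rho (mat 1) (raise j u) w = raise j u w" using raise_cong[of w "rho (mat 1) u" u] IH by simp
qed (use rep in \<open>auto simp: linop_rho linop_id rho_emb is_rep_def\<close>)

lemma rho_mult:
  assumes "g \<in> W" "h \<in> W"
  shows "rho (g ** h) u = rho g (rho h u)"
proof (rule linop_eqI[where G = "\<lambda>u. rho g (rho h u)"])
  show "rho (g ** h) (emb v) = rho g (rho h (emb v))" for v
    using rep assms by (simp add: rho_emb is_rep_def matrix_vector_mul_assoc)
next
  fix w :: "'n list" and j u assume IH: "\<And>w' u. length w' < length w \<Longrightarrow> rho (g ** h) u w' = rho g (rho h u) w'"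
  have "rho (g ** h) (raise j u) w = (\<Sum>i\<in>UNIV. en (g ** h) i j *s raise i (rho (g ** h) u) w)"
    by (simp add: rho_raise sum_fun_apply)
  also have "\<dots> = (\<Sum>i\<in>UNIV. en (g ** h) i j *s raise i (rho g (rho h u)) w)"
    using raise_cong[of w "rho (g ** h) u" "rho g (rho h u)"] IH by simp
  also have "\<dots> = (\<Sum>i\<in>UNIV. \<Sum>k\<in>UNIV. (en g i k * en h k j) *s raise i (rho g (rho h u)) w)"
    unfolding en_mult by (simp add: vec.scale_sum_left)
  also have "\<dots> = (\<Sum>k\<in>UNIV. \<Sum>i\<in>UNIV. (en g i k * en h k j) *s raise i (rho g (rho h u)) w)"
    by (rule sum.swap)
  also have "\<dots> = rho g (rho h (raise j u)) w"
    by (simp add: rho_raise rho_rules sum_fun_apply vec.scale_sum_right mult.commute)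
  finally show "rho (g ** h) (raise j u) w = rho g (rho h (raise j u)) w" .
qed (auto intro: linop_rho linop_comp)

text \<open>
  The operator of \<open>[y_i, x_j]\<close>, with \<open>\<alpha>\<^sub>s(y_i) x_j(\<alpha>\<^sub>s\<^sup>\<or>)\<close> written as \<open>x_j(y_i) - x_j(s y_i)\<close>.
\<close>

definition bracket :: "'n \<Rightarrow> 'n \<Rightarrow> ('n, 'k) tens \<Rightarrow> ('n, 'k) tens"
  where "bracket i j u = scl (kd i j) u - scl (of_real c) (\<Sum>s\<in>S. scl (kd i j - en s j i) (rho s u))"

lemma linop_bracket: "linop (bracket i j)"
  unfolding bracket_def
  by (intro linop_diffop linop_sclop linop_sumop linop_rho linop_id)

lemmas bracket_rules = linop_rules[OF linop_bracket]

text \<open>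
  The recursion solves \<open>y_i x_j = x_j y_i + [y_i, x_j]\<close> letter by letter, starting from \<open>y_i (1 \<otimes> v) = 0\<close>.
\<close>

primrec lower_w :: "'n \<Rightarrow> 'n list \<Rightarrow> ('n, 'k) tens \<Rightarrow> complex ^ 'k" where
  "lower_w i [] u = (\<Sum>j\<in>UNIV. bracket i j (cut j u) [])"
| "lower_w i (l # w) u = lower_w i w (cut l u) + (\<Sum>j\<in>UNIV. bracket i j (cut j u) (l # w))"

definition lower :: "'n \<Rightarrow> ('n, 'k) tens \<Rightarrow> ('n, 'k) tens"
  where "lower i u = (\<lambda>w. lower_w i w u)"

lemma linop_lower: "linop (lower i)"
proof -
  have 1: "lower_w i w (u + v) = lower_w i w u + lower_w i w v" for w u v
    by (induction w arbitrary: u v) (auto simp: bracket_rules sum.distrib)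
  have 2: "lower_w i w (scl a u) = a *s lower_w i w u" for a w u
    by (induction w arbitrary: u)
       (auto simp: vec.scale_sum_right bracket_rules vec.scale_right_distrib)
  show ?thesis by (rule linopI) (auto simp: lower_def fun_eq_iff 1 2)
qed

lemmas lower_rules = linop_rules[OF linop_lower]

lemma lower_Nil: "lower i u [] = (\<Sum>j\<in>UNIV. bracket i j (cut j u) [])"
  by (simp add: lower_def)

lemma cut_lower: "cut l (lower i u) = lower i (cut l u) + cut l (\<Sum>j\<in>UNIV. bracket i j (cut j u))"
  by (rule ext) (simp add: lower_def sum_fun_apply)

lemma lower_emb: "lower i (emb v) = 0"
  by (rule tens_eqI) (simp_all only: lower_Nil cut_lower cut_emb lower_rules bracket_rules cut_rules
        sum.neutral_const zero_fun_apply add_0)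

lemma lower_raise: "lower i (raise j u) = raise j (lower i u) + bracket i j u"
proof -
  have *: "(\<Sum>k\<in>UNIV. bracket i k (if j = k then u else 0)) = bracket i j u"
    by (simp add: if_distrib[of "bracket i _"] bracket_rules sum.delta cong: if_cong)
  show ?thesis
  proof (rule tens_eqI)
    show "lower i (raise j u) [] = (raise j (lower i u) + bracket i j u) []"
      using arg_cong[OF *, of "\<lambda>f. f []"] by (simp add: lower_Nil sum_fun_apply)
    show "cut l (lower i (raise j u)) = cut l (raise j (lower i u) + bracket i j u)" for l
      unfolding cut_lower cut_raise * by (simp add: lower_rules)
  qed
qed

text \<open>
  The sum over reflections is invariant under conjugation, so the brackets transform like the tensor
  \<open>y_i \<otimes> x_j\<close>.
\<close>

lemma bracket_equivariant:
  assumes g: "g \<in> W"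
  shows "rho g (bracket i j u) = (\<Sum>p\<in>UNIV. \<Sum>q\<in>UNIV. scl (en g p i * en g q j) (bracket p q (rho g u)))"
proof -
  let ?cj = "\<lambda>s. g ** s ** transpose g"
  have inv: "transpose g ** (g ** x ** transpose g) ** g = x" for x
  proof -
    have "transpose g ** (g ** x ** transpose g) ** g = (transpose g ** g) ** x ** (transpose g ** g)"
      by (simp add: matrix_mul_assoc)
    then show ?thesis using orth_W[OF g] by simp
  qed
  have bij: "bij_betw ?cj S S"
  proof (rule bij_betwI[where g = "\<lambda>s. transpose g ** s ** g"])
    show "(\<lambda>s. transpose g ** s ** g) \<in> S \<rightarrow> S"
      using conj_S[of "transpose g"] transpose_W g by (auto simp: transpose_transpose)
    show "g ** (transpose g ** y ** g) ** transpose g = y" for y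
    proof -
      have "g ** (transpose g ** y ** g) ** transpose g = (g ** transpose g) ** y ** (g ** transpose g)"
        by (simp add: matrix_mul_assoc)
      then show ?thesis using orth_W'[OF g] by simp
    qed
  qed (use conj_S g inv in auto)
  have kd: "(\<Sum>p\<in>UNIV. \<Sum>q\<in>UNIV. en g p i * en g q j * kd p q) = kd i j"
    using en_orth(1)[OF g, of i j] by (simp add: if_distrib[of "(*) _"] sum.delta cong: if_cong)
  have ens: "(\<Sum>p\<in>UNIV. \<Sum>q\<in>UNIV. en g p i * en g q j * en (?cj s) q p) = en s j i" for s
  proof -
    have "en s j i = en (transpose g ** (?cj s ** g)) j i" using inv[of s] by (simp add: matrix_mul_assoc)
    also have "\<dots> = (\<Sum>q\<in>UNIV. \<Sum>p\<in>UNIV. en g p i * en g q j * en (?cj s) q p)"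
      unfolding en_mult[of "transpose g"] en_mult[of "?cj s" g]
      by (simp add: transpose_def sum_distrib_left mult_ac)
    finally show ?thesis by (subst sum.swap) simp
  qed
  have rs: "rho g (rho s u) = rho (?cj s) (rho g u)" if "s \<in> S" for s
  proof -
    have "?cj s ** g = g ** s" using orth_W[OF g] by (simp add: matrix_mul_assoc[symmetric])
    then show ?thesis using that g S_W conj_S
      by (metis rho_mult subsetD)
  qed
  have lhs: "rho g (bracket i j u) = scl (kd i j) (rho g u)
      - scl (of_real c) (\<Sum>s\<in>S. scl (kd i j - en s j i) (rho (?cj s) (rho g u)))"
    by (simp add: bracket_def rho_rules rs)
  have "(\<Sum>p\<in>UNIV. \<Sum>q\<in>UNIV. scl (en g p i * en g q j) (bracket p q (rho g u)))
    = scl (\<Sum>p\<in>UNIV. \<Sum>q\<in>UNIV. en g p i * en g q j * kd p q) (rho g u)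
     - scl (of_real c) (\<Sum>p\<in>UNIV. \<Sum>q\<in>UNIV. \<Sum>s\<in>S. scl (en g p i * en g q j * (kd p q - en s q p)) (rho s (rho g u)))"
    unfolding bracket_def
    by (simp add: tm.scale_right_diff_distrib sum_subtractf tm.scale_sum_left tm.scale_sum_right mult_ac)
  also have "(\<Sum>p\<in>UNIV. \<Sum>q\<in>UNIV. \<Sum>s\<in>S. scl (en g p i * en g q j * (kd p q - en s q p)) (rho s (rho g u)))
      = (\<Sum>s\<in>S. \<Sum>p\<in>UNIV. \<Sum>q\<in>UNIV. scl (en g p i * en g q j * (kd p q - en s q p)) (rho s (rho g u)))"
    by (rule sum_swap3)
  also have "\<dots> = (\<Sum>s\<in>S. scl (\<Sum>p\<in>UNIV. \<Sum>q\<in>UNIV. en g p i * en g q j * (kd p q - en s q p)) (rho s (rho g u)))"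
    by (simp add: tm.scale_sum_left)
  also have "\<dots> = (\<Sum>s\<in>S. scl (\<Sum>p\<in>UNIV. \<Sum>q\<in>UNIV. en g p i * en g q j * (kd p q - en (?cj s) q p)) (rho (?cj s) (rho g u)))"
    by (rule sum.reindex_bij_betw[OF bij, symmetric])
  also have "\<dots> = (\<Sum>s\<in>S. scl (kd i j - en s j i) (rho (?cj s) (rho g u)))"
    using kd ens by (simp add: right_diff_distrib sum_subtractf)
  finally show ?thesis unfolding lhs kd by (rule sym)
qed

lemma rho_lower:
  assumes g: "g \<in> W"
  shows "rho g (lower i u) = (\<Sum>p\<in>UNIV. scl (en g p i) (lower p (rho g u)))"
proof (rule linop_eqI[where F = "\<lambda>u. rho g (lower i u)" and G = "\<lambda>u. \<Sum>p\<in>UNIV. scl (en g p i) (lower p (rho g u))"])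
  fix w :: "'n list" and j and u :: "('n, 'k) tens"
  let ?G = "\<lambda>u. \<Sum>p\<in>UNIV. scl (en g p i) (lower p (rho g u))"
  assume IH: "\<And>w' u. length w' < length w \<Longrightarrow> rho g (lower i u) w' = ?G u w'"
  have c: "rho g (bracket i j u) = (\<Sum>p\<in>UNIV. \<Sum>q\<in>UNIV. scl (en g p i * en g q j) (bracket p q (rho g u)))"
    by (rule bracket_equivariant[OF g])
  have "?G (raise j u) = (\<Sum>p\<in>UNIV. \<Sum>q\<in>UNIV. scl (en g p i * en g q j) (raise q (lower p (rho g u)) + bracket p q (rho g u)))"
    by (simp add: rho_raise lower_rules lower_raise tm.scale_sum_right)
  also have "\<dots> = (\<Sum>p\<in>UNIV. \<Sum>q\<in>UNIV. scl (en g p i * en g q j) (raise q (lower p (rho g u)))) + rho g (bracket i j u)"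
    unfolding c by (simp add: tm.scale_right_distrib sum.distrib)
  also have "(\<Sum>p\<in>UNIV. \<Sum>q\<in>UNIV. scl (en g p i * en g q j) (raise q (lower p (rho g u))))
     = (\<Sum>q\<in>UNIV. scl (en g q j) (raise q (?G u)))"
    by (subst sum.swap) (simp add: linop_rules[OF linop_raise] tm.scale_sum_right mult.commute)
  finally have G0: "?G (raise j u) = (\<Sum>q\<in>UNIV. scl (en g q j) (raise q (?G u))) + rho g (bracket i j u)" .
  have G: "?G (raise j u) w = (\<Sum>q\<in>UNIV. en g q j *s raise q (?G u) w) + rho g (bracket i j u) w"
    unfolding fun_cong[OF G0, of w] by (simp only: sum_fun_apply plus_fun_apply scl_apply)
  have "rho g (lower i (raise j u)) w = (\<Sum>q\<in>UNIV. en g q j *s raise q (rho g (lower i u)) w) + rho g (bracket i j u) w"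
    by (simp only: lower_raise rho_rules rho_raise sum_fun_apply plus_fun_apply scl_apply)
  moreover have "raise q (rho g (lower i u)) w = raise q (?G u) w" for q
    by (rule raise_cong) (rule IH)
  ultimately show "rho g (lower i (raise j u)) w = ?G (raise j u) w"
    unfolding G by simp
next
  show "linop (\<lambda>u. \<Sum>p\<in>UNIV. scl (en g p i) (lower p (rho g u)))"
    by (intro linop_sumop linop_sclop linop_comp[OF linop_lower linop_rho])
qed (auto intro: linop_comp linop_rho linop_lower simp: lower_emb rho_emb rho_rules)

lemma rho_lower_S:
  assumes s: "s \<in> S"
  shows "lower i (rho s u) = (\<Sum>p\<in>UNIV. scl (en s p i) (rho s (lower p u)))"
proof -
  have sW: "s \<in> W" using s S_W by auto
  have "(\<Sum>p\<in>UNIV. scl (en s p i) (rho s (lower p u)))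
      = (\<Sum>p\<in>UNIV. \<Sum>q\<in>UNIV. scl (en s p i * en s q p) (lower q (rho s u)))"
    by (simp add: rho_lower[OF sW] tm.scale_sum_right)
  also have "\<dots> = (\<Sum>q\<in>UNIV. scl (\<Sum>p\<in>UNIV. en s i p * en s q p) (lower q (rho s u)))"
    by (subst sum.swap) (simp add: tm.scale_sum_left S_sym[OF s, of _ i])
  also have "\<dots> = lower i (rho s u)"
    by (simp add: en_orth(2)[OF sW] if_distrib[of "\<lambda>a. scl a _"] sum.delta cong: if_cong)
  finally show ?thesis ..
qed

text \<open>
  Commuting a reflection \<open>s\<close> past \<open>y_k\<close> produces the coefficient \<open>(1 - s)\<^sub>j\<^sub>i (s - 1)\<^sub>p\<^sub>k\<close>, which is symmetric
  in \<open>i\<close> and \<open>k\<close> since \<open>1 - s\<close> has rank one.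
\<close>

lemma bracket_lower_symmetric:
  "bracket i j (lower k u) - lower k (bracket i j u) = bracket k j (lower i u) - lower i (bracket k j u)"
proof -
  have *: "bracket i j (lower k u) - lower k (bracket i j u)
     = scl (of_real c) (\<Sum>s\<in>S. \<Sum>p\<in>UNIV. scl ((kd i j - en s j i) * (en s p k - kd p k)) (rho s (lower p u)))"
    for i k
  proof -
    have "bracket i j (lower k u) - lower k (bracket i j u) =
      scl (of_real c) (\<Sum>s\<in>S. scl (kd i j - en s j i) (lower k (rho s u) - rho s (lower k u)))"
      unfolding bracket_def by (simp add: lower_rules tm.scale_right_diff_distrib sum_subtractf)
    also have "\<dots> = scl (of_real c) (\<Sum>s\<in>S. scl (kd i j - en s j i) (\<Sum>p\<in>UNIV. scl (en s p k - kd p k) (rho s (lower p u))))"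
      by (simp add: rho_lower_S tm.scale_left_diff_distrib sum_subtractf
          if_distrib[of "\<lambda>a. scl a _"] sum.delta cong: if_cong)
    finally show ?thesis by (simp add: tm.scale_sum_right)
  qed
  have "(kd i j - en s j i) * (en s p k - kd p k) = (kd k j - en s j k) * (en s p i - kd p i)"
    if s: "s \<in> S" for s p
  proof -
    obtain n where n: "\<And>i j. s $ i $ j = (if i = j then 1 else 0) - n i * n j"
      using refl_S[OF s] by blast
    have "en s a b = kd a b - of_real (n a) * of_real (n b)" for a b
      by (simp add: n)
    then show ?thesis by simp
  qed
  then show ?thesis unfolding * by simp
qed

text \<open>
  By the preceding symmetry \<open>[y_i, y_k]\<close> commutes with each \<open>x_j\<close>, and it kills \<open>1 \<otimes> v\<close>.
\<close>

lemma lower_commute: "lower i (lower k u) = lower k (lower i u)"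
proof (rule linop_eqI[where F = "\<lambda>u. lower i (lower k u)" and G = "\<lambda>u. lower k (lower i u)"])
  fix w :: "'n list" and j and u :: "('n, 'k) tens"
  assume IH: "\<And>w' u. length w' < length w \<Longrightarrow> lower i (lower k u) w' = lower k (lower i u) w'"
  have *: "lower i (lower k (raise j u)) = raise j (lower i (lower k u)) + (bracket i j (lower k u) + lower i (bracket k j u))" for i k
    by (simp add: lower_raise lower_rules add.assoc)
  have "bracket i j (lower k u) + lower i (bracket k j u) = bracket k j (lower i u) + lower k (bracket i j u)"
  proof -
    have "a + d = b' + e" if "a - e = b' - d" for a b' d e :: "('n, 'k) tens"
      using that by (metis add.commute diff_add_cancel diff_add_eq)
    then show ?thesis using bracket_lower_symmetric[of i j k u] by blast
  qed
  moreover have "raise j (lower i (lower k u)) w = raise j (lower k (lower i u)) w"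
    by (rule raise_cong) (rule IH)
  ultimately show "lower i (lower k (raise j u)) w = lower k (lower i (raise j u)) w"
    unfolding * plus_fun_apply[of "raise j (lower i (lower k u))"] plus_fun_apply[of "raise j (lower k (lower i u))"]
    by (simp only:)
qed (auto intro: linop_comp linop_lower simp: lower_emb lower_rules)

end

section \<open>The contravariant form and its radical\<close>

locale refl_form = refl_rep W S c \<tau>
  for W :: "(real ^ 'n ^ 'n) set" and S :: "(real ^ ('n::finite) ^ 'n) set"
    and c :: real and \<tau> :: "('n, 'k::finite) grp_rep" +
  fixes \<beta>0 :: "complex ^ 'k \<Rightarrow> complex ^ 'k \<Rightarrow> complex"
  assumes inner: "invariant_inner_product W \<tau> \<beta>0"
begin

lemma inner_add1: "\<beta>0 (u + u') v = \<beta>0 u v + \<beta>0 u' v"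
  and inner_scl1: "\<beta>0 (a *s u) v = a * \<beta>0 u v"
  and inner_herm: "\<beta>0 v u = cnj (\<beta>0 u v)"
  and inner_inv: "g \<in> W \<Longrightarrow> \<beta>0 (\<tau> g *v u) (\<tau> g *v v) = \<beta>0 u v"
  and inner_pos: "u \<noteq> 0 \<Longrightarrow> Re (\<beta>0 u u) > 0"
proof -
  have hf: "hermitian_form vec_group (*s) \<beta>0" and pd: "positive_definite vec_group \<beta>0"
    and iv: "\<forall>g\<in>W. \<forall>v v'. \<beta>0 (\<tau> g *v v) (\<tau> g *v v') = \<beta>0 v v'"
    using inner unfolding invariant_inner_product_def by blast+
  have c: "x \<in> carrier vec_group" for x :: "complex ^ 'k" by (simp add: vec_group_def)
  have m: "x \<otimes>\<^bsub>vec_group\<^esub> y = x + y" for x y :: "complex ^ 'k" by (simp add: vec_group_def)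
  have z: "\<one>\<^bsub>vec_group\<^esub> = (0 :: complex ^ 'k)" by (simp add: vec_group_def)
  show "\<beta>0 (u + u') v = \<beta>0 u v + \<beta>0 u' v"
    using hf c m unfolding hermitian_form_def by metis
  show "\<beta>0 (a *s u) v = a * \<beta>0 u v"
    using hf c unfolding hermitian_form_def by metis
  show "\<beta>0 v u = cnj (\<beta>0 u v)"
    using hf c unfolding hermitian_form_def by blast
  show "u \<noteq> 0 \<Longrightarrow> Re (\<beta>0 u u) > 0"
    using pd c z unfolding positive_definite_def by metis
  show "g \<in> W \<Longrightarrow> \<beta>0 (\<tau> g *v u) (\<tau> g *v v) = \<beta>0 u v"
    using iv by blast
qed

lemma inner_add2: "\<beta>0 u (v + v') = \<beta>0 u v + \<beta>0 u v'"
  and inner_scl2: "\<beta>0 u (a *s v) = cnj a * \<beta>0 u v"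
  by (metis inner_herm inner_add1 complex_cnj_add) (metis inner_herm inner_scl1 complex_cnj_mult)

lemma inner_nonneg: "Re (\<beta>0 u u) \<ge> 0"
  using inner_pos[of u] inner_scl1[of 0 u u] by (cases "u = 0") auto

text \<open>
  The degree \<open>k\<close> part of the form, defined by the one rule that \<open>(u, x_i v) = (y_i u, v)\<close>. The
  Hermitian symmetry is then a theorem.
\<close>

primrec dform :: "nat \<Rightarrow> ('n, 'k) tens \<Rightarrow> ('n, 'k) tens \<Rightarrow> complex" where
  "dform 0 u v = \<beta>0 (u []) (v [])"
| "dform (Suc k) u v = (\<Sum>i\<in>UNIV. dform k (lower i u) (cut i v))"

lemma dform_add1: "dform k (u + u') v = dform k u v + dform k u' v"
  by (induction k arbitrary: u u' v) (auto simp: inner_add1 lower_rules sum.distrib)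

lemma dform_scl1: "dform k (scl a u) v = a * dform k u v"
  by (induction k arbitrary: u v) (auto simp: inner_scl1 lower_rules sum_distrib_left)

lemma dform_add2: "dform k u (v + v') = dform k u v + dform k u v'"
  by (induction k arbitrary: u v v') (auto simp: inner_add2 sum.distrib)

lemma dform_scl2: "dform k u (scl a v) = cnj a * dform k u v"
  by (induction k arbitrary: u v) (auto simp: inner_scl2 sum_distrib_left)

lemma dform_01 [simp]: "dform k 0 v = 0" and dform_02 [simp]: "dform k u 0 = 0"
  using dform_scl1[of k 0 0 v] dform_scl2[of k u 0 0] by simp_all

lemma dform_minus1: "dform k (- u) v = - dform k u v" and dform_minus2: "dform k u (- v) = - dform k u v"
  using dform_scl1[of k "-1" u v] dform_scl2[of k u "-1" v] by simp_all

lemma dform_diff1: "dform k (u - u') v = dform k u v - dform k u' v" 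
  and dform_diff2: "dform k u (v - v') = dform k u v - dform k u v'"
  by (simp_all only: diff_conv_add_uminus dform_add1 dform_add2 dform_minus1 dform_minus2)

lemma dform_sum1: "dform k (\<Sum>i\<in>A. f i) v = (\<Sum>i\<in>A. dform k (f i) v)"
  and dform_sum2: "dform k u (\<Sum>i\<in>A. f i) = (\<Sum>i\<in>A. dform k u (f i))"
  by (induction A rule: infinite_finite_induct) (auto simp: dform_add1 dform_add2)

lemmas dform_rules = dform_add1 dform_add2 dform_scl1 dform_scl2 dform_minus1 dform_minus2 dform_diff1 dform_diff2 dform_sum1 dform_sum2

lemma dform_raise: "dform (Suc k) u (raise i v) = dform k (lower i u) v"
  by (simp add: if_distrib[of "dform k _"] sum.delta cong: if_cong)

lemma dform_raise_0: "dform 0 u (raise i v) = 0"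
  using inner_scl2[of "u []" 0 0] by simp

lemma dform_cong2: "(\<And>w. length w = k \<Longrightarrow> v w = v' w) \<Longrightarrow> dform k u v = dform k u v'"
proof (induction k arbitrary: u v v')
  case (Suc k)
  show ?case using Suc.prems by (auto intro!: sum.cong Suc.IH)
qed simp

lemma dform_inv:
  assumes g: "g \<in> W"
  shows "dform k (rho g u) (rho g v) = dform k u v"
proof (induction k arbitrary: u v)
  case 0 then show ?case using inner_inv[OF g] by simp
next
  case (Suc k)
  have "dform (Suc k) (rho g u) (rho g v)
     = (\<Sum>i\<in>UNIV. \<Sum>j\<in>UNIV. en g i j * dform k (lower i (rho g u)) (rho g (cut j v)))"
    by (simp add: cut_rho dform_rules)
  also have "\<dots> = (\<Sum>j\<in>UNIV. dform k (\<Sum>i\<in>UNIV. scl (en g i j) (lower i (rho g u))) (rho g (cut j v)))"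
    by (subst sum.swap) (simp add: dform_rules)
  also have "\<dots> = (\<Sum>j\<in>UNIV. dform k (lower j u) (cut j v))"
    by (simp only: rho_lower[OF g, symmetric] Suc.IH)
  finally show ?case by simp
qed

lemma dform_rho_S: "s \<in> S \<Longrightarrow> dform k (rho s u) v = dform k u (rho s v)"
proof -
  assume s: "s \<in> S"
  then have sW: "s \<in> W" using S_W by auto
  have "rho s (rho s v) = v" using rho_mult[OF sW sW, of v] S_invol[OF s] rho_one by simp
  then show ?thesis using dform_inv[OF sW, of k u "rho s v"] by simp
qed

text \<open>
  The adjoint of \<open>[y_i, x_j]\<close> is \<open>[y_j, x_i]\<close>, because reflections are self-adjoint and have symmetric
  matrices.
\<close>

lemma dform_bracket: "dform k (bracket i j u) v = dform k u (bracket j i v)"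
proof -
  have "en s j i = en s i j" if "s \<in> S" for s using S_sym[OF that] by simp
  then show ?thesis unfolding bracket_def by (auto simp: dform_rules dform_rho_S intro!: arg_cong2[where f = "(*)"] sum.cong)
qed

lemma dform_Suc_expand:
  "dform (Suc k) u v = (\<Sum>i\<in>UNIV. \<Sum>j\<in>UNIV. dform k (raise j (lower i (cut j u))) (cut i v))
     + (\<Sum>i\<in>UNIV. \<Sum>j\<in>UNIV. dform k (bracket i j (cut j u)) (cut i v))"
proof -
  have "lower i u = (\<Sum>j\<in>UNIV. raise j (lower i (cut j u)) + bracket i j (cut j u))" for i
    using arg_cong[OF letter_decomp[of u], of "lower i"] by (simp only: lower_rules lower_emb lower_raise add_0)
  then show ?thesis by (simp only: dform.simps dform_rules sum.distrib)
qed

text \<open>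
  After \<open>y_i\<close> has been moved past the first letter of \<open>u\<close>, both sums in the expansion are Hermitian:
  the first by two steps down in degree, the second by the adjunction of the brackets.
\<close>

lemma dform_herm: "dform k v u = cnj (dform k u v)"
proof (induction k arbitrary: u v rule: less_induct)
  case (less k)
  show ?case
  proof (cases k)
    case 0 show ?thesis unfolding 0 dform.simps by (rule inner_herm)
  next
    case (Suc n)
    have h: "dform n (raise j a) b = cnj (dform n b (raise j a))" for j a b
      by (rule less) (simp add: Suc)
    have 1: "dform n (raise j (lower i a)) b = cnj (dform n (raise i (lower j b)) a)" for i j a b
    proof (cases n)
      case 0 then show ?thesis using h dform_raise_0 by (metis complex_cnj_zero)
    next
      case (Suc m)
      have "dform m (lower j b) (lower i a) = cnj (dform m (lower i a) (lower j b))"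
        by (rule less) (simp add: Suc \<open>k = Suc n\<close>)
      then show ?thesis unfolding h[of j] h[of i] unfolding Suc dform_raise by simp
    qed
    have 2: "dform n (bracket i j a) b = cnj (dform n (bracket j i b) a)" for i j a b
      unfolding dform_bracket[of n i j a b] by (rule less) (simp add: Suc)
    have "dform (Suc n) v u = (\<Sum>i\<in>UNIV. \<Sum>j\<in>UNIV. cnj (dform n (raise i (lower j (cut i u))) (cut j v)))
     + (\<Sum>i\<in>UNIV. \<Sum>j\<in>UNIV. cnj (dform n (bracket j i (cut i u)) (cut j v)))"
      unfolding dform_Suc_expand[of n v u]
      by (intro arg_cong2[where f = "(+)"] sum.cong 1 2) simp_all
    also have "\<dots> = cnj (dform (Suc n) u v)"
      unfolding dform_Suc_expand[of n u v] complex_cnj_add cnj_sum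
      by (rule arg_cong2[where f = "(+)", OF sum.swap sum.swap])
    finally show ?thesis unfolding Suc .
  qed
qed

lemma dform_cong1: "(\<And>w. length w = k \<Longrightarrow> u w = u' w) \<Longrightarrow> dform k u v = dform k u' v"
  using dform_cong2 dform_herm by metis

definition radical :: "('n, 'k) tens \<Rightarrow> bool"
  where "radical u \<longleftrightarrow> (\<forall>k v. dform k u v = 0)"

lemma radical_rules:
  "radical 0" "radical u \<Longrightarrow> radical v \<Longrightarrow> radical (u + v)" "radical u \<Longrightarrow> radical (scl a u)" "radical u \<Longrightarrow> radical v \<Longrightarrow> radical (u - v)"
  "radical u \<Longrightarrow> radical (- u)" 
  by (auto simp: radical_def dform_rules)

lemma radical_sum: "(\<And>i. i \<in> A \<Longrightarrow> radical (f i)) \<Longrightarrow> radical (\<Sum>i\<in>A. f i)"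
  by (auto simp: radical_def dform_rules)

lemma radical_dform: "radical u \<Longrightarrow> dform k u v = 0" "radical u \<Longrightarrow> dform k v u = 0"
  unfolding radical_def by (blast, metis dform_herm complex_cnj_zero)

lemma radical_raise: "radical u \<Longrightarrow> radical (raise i u)"
proof (unfold radical_def, intro allI)
  fix k v assume u: "\<forall>k v. dform k u v = 0"
  have "dform k v (raise i u) = 0"
  proof (cases k)
    case (Suc n)
    show ?thesis unfolding Suc dform_raise by (rule radical_dform(2)) (simp add: radical_def u)
  qed (simp only: dform_raise_0)
  then show "dform k (raise i u) v = 0" by (metis dform_herm complex_cnj_zero)
qed

lemma radical_lower: "radical u \<Longrightarrow> radical (lower i u)"
  unfolding radical_def by (metis dform_raise)

lemma radical_rho: "g \<in> W \<Longrightarrow> radical u \<Longrightarrow> radical (rho g u)"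
proof (unfold radical_def, intro allI)
  fix k v assume u: "\<forall>k v. dform k u v = 0" and g: "g \<in> W"
  have "rho g (rho (transpose g) v) = v"
    using rho_mult[OF g transpose_W[OF g]] orth_W'[OF g] rho_one by metis
  then show "dform k (rho g u) v = 0" using dform_inv[OF g, of k u "rho (transpose g) v"] u by simp
qed

text \<open>
  The adjoint of \<open>[x_i, x_j]\<close> is \<open>[y_j, y_i] = 0\<close>.
\<close>

lemma radical_commutator: "radical (raise i (raise j u) - raise j (raise i u))"
proof (unfold radical_def, intro allI)
  fix k v
  have "dform k v (raise i (raise j u)) = dform k v (raise j (raise i u))"
  proof (cases k)
    case (Suc n)
    then show ?thesis
      by (cases n) (simp_all only: dform_raise dform_raise_0 lower_commute[of j i])
  qed (simp_all only: dform_raise_0)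
  then show "dform k (raise i (raise j u) - raise j (raise i u)) v = 0"
    by (metis dform_herm dform_diff2 diff_self complex_cnj_zero)
qed

end

section \<open>Finite support and the Euler operator\<close>

definition supp_le :: "nat \<Rightarrow> ('n, 'k::finite) tens \<Rightarrow> bool"
  where "supp_le n u \<longleftrightarrow> (\<forall>w. n < length w \<longrightarrow> u w = 0)"

definition fsupp :: "('n, 'k::finite) tens \<Rightarrow> bool"
  where "fsupp u \<longleftrightarrow> (\<exists>n. supp_le n u)"

definition times_degree :: "('n, 'k::finite) tens \<Rightarrow> ('n, 'k) tens"
  where "times_degree u = (\<lambda>w. of_nat (length w) *s u w)"

lemma supp_le_mono: "supp_le n u \<Longrightarrow> n \<le> m \<Longrightarrow> supp_le m u"
  by (auto simp: supp_le_def)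

lemma supp_le_rules:
  "supp_le n 0" "supp_le n u \<Longrightarrow> supp_le n v \<Longrightarrow> supp_le n (u + v)"
  "supp_le n u \<Longrightarrow> supp_le n v \<Longrightarrow> supp_le n (u - v)" "supp_le n u \<Longrightarrow> supp_le n (scl a u)"
  "supp_le n (emb x)" "supp_le n u \<Longrightarrow> supp_le n (- u)"
  by (auto simp: supp_le_def emb_def)

lemma supp_le_sum: "(\<And>i. i \<in> A \<Longrightarrow> supp_le n (f i)) \<Longrightarrow> supp_le n (\<Sum>i\<in>A. f i)"
  by (induction A rule: infinite_finite_induct) (auto simp: supp_le_rules)

lemma supp_le_cut: "supp_le (Suc n) u \<Longrightarrow> supp_le n (cut i u)"
  by (auto simp: supp_le_def)

lemma supp_le_cut': "supp_le n u \<Longrightarrow> supp_le n (cut i u)"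
  by (auto simp: supp_le_def)

lemma supp_le_raise: "supp_le n u \<Longrightarrow> supp_le (Suc n) (raise i u)"
  by (auto simp: supp_le_def raise_def split: list.splits)

lemma supp_le_0: "supp_le 0 u \<Longrightarrow> u = emb (u [])"
  by (auto simp: supp_le_def emb_def fun_eq_iff)

lemma supp_le_times_degree: "supp_le n u \<Longrightarrow> supp_le n (times_degree u)"
  by (auto simp: supp_le_def times_degree_def)

lemma fsupp_rules:
  "fsupp 0" "fsupp u \<Longrightarrow> fsupp v \<Longrightarrow> fsupp (u + v)"
  "fsupp u \<Longrightarrow> fsupp v \<Longrightarrow> fsupp (u - v)" "fsupp u \<Longrightarrow> fsupp (scl a u)"
  "fsupp (emb x)" "fsupp u \<Longrightarrow> fsupp (- u)" "fsupp u \<Longrightarrow> fsupp (raise i u)" "fsupp u \<Longrightarrow> fsupp (cut i u)"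
  "fsupp u \<Longrightarrow> fsupp (times_degree u)"
proof -
  show "fsupp u \<Longrightarrow> fsupp v \<Longrightarrow> fsupp (u + v)" "fsupp u \<Longrightarrow> fsupp v \<Longrightarrow> fsupp (u - v)"
    unfolding fsupp_def by (meson supp_le_rules supp_le_mono nat_le_linear)+
qed (auto simp: fsupp_def intro: supp_le_rules supp_le_raise supp_le_cut' supp_le_times_degree)

lemma fsupp_sum: "(\<And>i. i \<in> A \<Longrightarrow> fsupp (f i)) \<Longrightarrow> fsupp (\<Sum>i\<in>A. f i)"
  by (induction A rule: infinite_finite_induct) (auto simp: fsupp_rules)

lemma linop_times_degree: "linop times_degree"
  by (rule linopI) (auto simp: times_degree_def fun_eq_iff vec.scale_right_distrib mult.commute)

lemma times_degree_emb: "times_degree (emb v) = 0"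
  by (auto simp: times_degree_def fun_eq_iff emb_def)

lemma times_degree_raise: "times_degree (raise i u) = raise i (times_degree u) + raise i u"
proof
  fix w show "times_degree (raise i u) w = (raise i (times_degree u) + raise i u) w"
    by (cases w) (auto simp: times_degree_def vec.scale_left_distrib)
qed

text \<open>
  From here on equations between operators are kept as equations between functions, and evaluation at a
  word happens only on request.
\<close>

lemmas pointwise = plus_fun_apply minus_apply uminus_apply zero_fun_apply scl_apply cut_apply

declare pointwise [simp del]

context refl_rep
begin

lemma supp_le_rho: "supp_le n u \<Longrightarrow> supp_le n (rho g u)"
proof -
  have "grp_w g w u = 0" if "\<And>w'. length w' = length w \<Longrightarrow> u w' = 0" for w u
    using that
  proof (induction w arbitrary: u)
    case (Cons i w)
    have "grp_w g w (cut j u) = 0" for j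
      by (rule Cons.IH) (use Cons.prems in \<open>auto simp: cut_apply\<close>)
    then show ?case by simp
  qed simp
  then show "supp_le n u \<Longrightarrow> supp_le n (rho g u)"
    by (simp add: supp_le_def rho_def)
qed

lemma supp_le_bracket: "supp_le n u \<Longrightarrow> supp_le n (bracket i j u)"
  unfolding bracket_def by (intro supp_le_rules supp_le_sum supp_le_rho)

lemma supp_le_lower: "supp_le n u \<Longrightarrow> supp_le n (lower i u)"
proof (induction n arbitrary: u)
  case 0
  have "lower i u = lower i (emb (u []))" by (rule arg_cong[OF supp_le_0[OF 0]])
  then show ?case by (simp only: lower_emb supp_le_rules)
next
  case (Suc n)
  have "lower i u = lower i (emb (u [])) + (\<Sum>j\<in>UNIV. lower i (raise j (cut j u)))"
    using arg_cong[OF letter_decomp[of u], of "lower i"] by (simp only: lower_rules)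
  then have "lower i u = (\<Sum>j\<in>UNIV. lower i (raise j (cut j u)))" by (simp only: lower_emb add_0)
  moreover have "supp_le (Suc n) (lower i (raise j (cut j u)))" for j
    unfolding lower_raise using Suc.prems
    by (intro supp_le_rules supp_le_raise Suc.IH supp_le_bracket supp_le_cut) (auto intro: supp_le_mono)
  ultimately show ?case by (simp only: supp_le_sum)
qed

lemma fsupp_ops: "fsupp u \<Longrightarrow> fsupp (rho g u)" "fsupp u \<Longrightarrow> fsupp (lower i u)" "fsupp u \<Longrightarrow> fsupp (bracket i j u)"
  by (auto simp: fsupp_def intro: supp_le_rho supp_le_lower supp_le_bracket)

definition refl_sum :: "('n, 'k) tens \<Rightarrow> ('n, 'k) tens"
  where "refl_sum u = (\<Sum>s\<in>S. rho s u)"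

definition raise_lower :: "('n, 'k) tens \<Rightarrow> ('n, 'k) tens"
  where "raise_lower u = (\<Sum>i\<in>UNIV. raise i (lower i u))"

lemma linop_refl_sum: "linop refl_sum"
  unfolding refl_sum_def[abs_def] by (intro linop_sumop linop_rho)

lemma linop_raise_lower: "linop raise_lower"
  unfolding raise_lower_def[abs_def] by (intro linop_sumop linop_comp[OF linop_raise linop_lower])

text \<open>
  Here \<open>\<Sum>\<^sub>i x_i [y_i, x_j] = x_j - c \<Sum>\<^sub>s (x_j - s x_j) s\<close>, and \<open>(s x_j) s = s x_j\<close> as operators. The last sum
  records that the \<open>x_i\<close> do not commute on tensors.
\<close>

lemma raise_lower_raise:
  "raise_lower (raise j u) = raise j (raise_lower u) + raise j u - scl (of_real c) (raise j (refl_sum u)) + scl (of_real c) (refl_sum (raise j u))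
     + (\<Sum>i\<in>UNIV. raise i (raise j (lower i u)) - raise j (raise i (lower i u)))"
proof -
  have "(\<Sum>i\<in>UNIV. raise i (bracket i j u)) = raise j u - scl (of_real c) (raise j (refl_sum u)) + scl (of_real c) (refl_sum (raise j u))"
  proof -
    have "(\<Sum>i\<in>UNIV. raise i (bracket i j u))
      = (\<Sum>i\<in>UNIV. scl (kd i j) (raise i u)) - scl (of_real c) (\<Sum>i\<in>UNIV. \<Sum>s\<in>S. scl (kd i j - en s j i) (raise i (rho s u)))"
      unfolding bracket_def by (simp add: linop_rules[OF linop_raise] sum_subtractf tm.scale_sum_right)
    also have "(\<Sum>i\<in>UNIV. \<Sum>s\<in>S. scl (kd i j - en s j i) (raise i (rho s u)))
      = (\<Sum>s\<in>S. \<Sum>i\<in>UNIV. scl (kd i j - en s i j) (raise i (rho s u)))"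
      by (subst sum.swap) (auto intro!: sum.cong simp: S_sym)
    also have "\<dots> = raise j (refl_sum u) - refl_sum (raise j u)"
      by (simp add: refl_sum_def rho_raise linop_rules[OF linop_raise] tm.scale_left_diff_distrib sum_subtractf
          if_distrib[of "\<lambda>a. scl a _"] sum.delta cong: if_cong)
    also have "(\<Sum>i\<in>UNIV. scl (kd i j) (raise i u)) = raise j u"
      by (simp add: if_distrib[of "\<lambda>a. scl a _"] sum.delta cong: if_cong)
    finally show ?thesis by (simp add: tm.scale_right_diff_distrib)
  qed
  moreover have "raise_lower (raise j u) = (\<Sum>i\<in>UNIV. raise i (raise j (lower i u))) + (\<Sum>i\<in>UNIV. raise i (bracket i j u))"
    by (simp add: raise_lower_def lower_raise linop_rules[OF linop_raise] sum.distrib)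
  moreover have "raise j (raise_lower u) = (\<Sum>i\<in>UNIV. raise j (raise i (lower i u)))"
    by (simp add: raise_lower_def linop_rules[OF linop_raise])
  ultimately show ?thesis
    by (simp add: sum_subtractf)
qed

definition scalar_Z :: "complex \<Rightarrow> bool"
  where "scalar_Z \<zeta> \<longleftrightarrow> (\<forall>v. (\<Sum>s\<in>S. \<tau> s *v v) = \<zeta> *s v)"

text \<open>
  The Euler element \<open>\<Sum> x_i y_i - c Z\<close>, normalised to vanish in degree 0, where \<open>Z\<close> acts by the
  scalar \<open>\<zeta>\<close>.
\<close>

definition euler :: "complex \<Rightarrow> ('n, 'k) tens \<Rightarrow> ('n, 'k) tens"
  where "euler \<zeta> u = raise_lower u - scl (of_real c) (refl_sum u) + scl (of_real c * \<zeta>) u"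

lemma linop_euler: "linop (euler \<zeta>)"
  unfolding euler_def[abs_def] by (intro linop_addop linop_diffop linop_raise_lower linop_sclop linop_refl_sum linop_id)

lemma euler_emb: "scalar_Z \<zeta> \<Longrightarrow> euler \<zeta> (emb v) = 0"
proof -
  assume z: "scalar_Z \<zeta>"
  have "refl_sum (emb v) = emb (\<Sum>s\<in>S. \<tau> s *v v)"
    by (rule tens_eqI) (simp_all add: refl_sum_def rho_emb sum_fun_apply pointwise)
  then show ?thesis using z
    by (simp add: euler_def raise_lower_def lower_emb linop_rules[OF linop_raise] scalar_Z_def emb_scl)
qed

lemma euler_raise:
  "euler \<zeta> (raise j u) = raise j (euler \<zeta> u) + raise j u
     + (\<Sum>i\<in>UNIV. raise i (raise j (lower i u)) - raise j (raise i (lower i u)))"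
  unfolding euler_def raise_lower_raise by (simp add: linop_rules[OF linop_raise] algebra_simps)

text \<open>
  Up to commutators of the \<open>x_i\<close>, the bracket of the Euler element with \<open>x_j\<close> is \<open>x_j\<close>, so it counts
  letters. The statement is relative to an arbitrary subspace \<open>R\<close> containing these commutators
  because it is applied both to the radical and to the preimages of submodules of the standard
  module.
\<close>

lemma euler_eq_times_degree_modulo:
  assumes z: "scalar_Z \<zeta>"
    and add: "\<And>u v. R u \<Longrightarrow> R v \<Longrightarrow> R (u + v)" and zero: "R 0"
    and x: "\<And>i u. fsupp u \<Longrightarrow> R u \<Longrightarrow> R (raise i u)"
    and xx: "\<And>i j u. fsupp u \<Longrightarrow> R (raise i (raise j u) - raise j (raise i u))"
    and u: "fsupp u"
  shows "R (euler \<zeta> u - times_degree u)"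
proof -
  have sumR: "(\<And>i. R (f i)) \<Longrightarrow> R (\<Sum>i\<in>A. f i)" for f and A :: "'n set"
    by (induction A rule: infinite_finite_induct) (auto simp: add zero)
  have lD: "linop (\<lambda>u. euler \<zeta> u - times_degree u)" by (intro linop_diffop linop_euler linop_times_degree)
  have fa: "fsupp (euler \<zeta> u - times_degree u)" if "fsupp u" for u
    unfolding euler_def raise_lower_def refl_sum_def using that
    by (intro fsupp_rules fsupp_sum fsupp_ops)
  obtain n where "supp_le n u" using u by (auto simp: fsupp_def)
  then show ?thesis
  proof (induction n arbitrary: u)
    case 0
    have "euler \<zeta> u - times_degree u = 0"
      using supp_le_0[OF 0] euler_emb[OF z] times_degree_emb by (metis diff_self)
    then show ?case using zero by simp
  next
    case (Suc n)
    have fs: "fsupp u" using Suc.prems by (auto simp: fsupp_def)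
    have *: "R (euler \<zeta> (raise j (cut j u)) - times_degree (raise j (cut j u)))" for j
    proof -
      let ?v = "cut j u"
      have "euler \<zeta> (raise j ?v) - times_degree (raise j ?v) = raise j (euler \<zeta> ?v - times_degree ?v)
         + (\<Sum>i\<in>UNIV. raise i (raise j (lower i ?v)) - raise j (raise i (lower i ?v)))"
        unfolding euler_raise times_degree_raise by (simp add: linop_rules[OF linop_raise])
      moreover have "R (raise j (euler \<zeta> ?v - times_degree ?v))"
        by (intro x fa Suc.IH supp_le_cut Suc.prems fsupp_rules fs)
      moreover have "R (\<Sum>i\<in>UNIV. raise i (raise j (lower i ?v)) - raise j (raise i (lower i ?v)))"
        by (intro sumR xx fsupp_ops fsupp_rules fs)
      ultimately show ?thesis by (simp add: add)
    qed
    have "euler \<zeta> u - times_degree u = (euler \<zeta> (emb (u [])) - times_degree (emb (u [])))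
        + (\<Sum>j\<in>UNIV. euler \<zeta> (raise j (cut j u)) - times_degree (raise j (cut j u)))"
      using arg_cong[OF letter_decomp[of u], of "\<lambda>u. euler \<zeta> u - times_degree u"] by (simp only: linop_rules[OF lD])
    also have "euler \<zeta> (emb (u [])) - times_degree (emb (u [])) = 0"
      by (simp add: euler_emb[OF z] times_degree_emb)
    finally have "euler \<zeta> u - times_degree u = (\<Sum>j\<in>UNIV. euler \<zeta> (raise j (cut j u)) - times_degree (raise j (cut j u)))"
      by (simp only: add_0)
    moreover have "R (\<Sum>j\<in>UNIV. euler \<zeta> (raise j (cut j u)) - times_degree (raise j (cut j u)))"
      by (rule sumR) (rule *)
    ultimately show ?case by (simp only:)
  qed
qed

end

context refl_form
begin

lemma dform_raise_lower: "dform (Suc k) u (raise_lower v) = (\<Sum>i\<in>UNIV. dform k (lower i u) (lower i v))"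
  by (simp only: raise_lower_def dform_sum2 dform_raise)

lemma dform_refl_sum: "dform k (refl_sum u) v = dform k u (refl_sum v)"
  unfolding refl_sum_def dform_sum1 dform_sum2 by (rule sum.cong) (auto simp: dform_rho_S)

text \<open>
  The left side is the form of \<open>\<Sum> x_i y_i u\<close> with \<open>v\<close>, and on degree \<open>k + 1\<close> the operator \<open>\<Sum> x_i y_i\<close>
  is \<open>k + 1 + c (Z - \<zeta>)\<close>, modulo the radical.
\<close>

lemma dform_eigen:
  assumes z: "scalar_Z \<zeta>" and u: "fsupp u" and e: "refl_sum u = scl \<mu> u"
  shows "(\<Sum>i\<in>UNIV. dform k (lower i u) (lower i v)) = (of_nat (Suc k) + of_real c * (\<mu> - \<zeta>)) * dform (Suc k) u v"
proof -
  have "radical (euler \<zeta> u - times_degree u)"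
    by (rule euler_eq_times_degree_modulo[OF z]) (auto intro: radical_rules radical_raise radical_commutator u)
  then have "dform (Suc k) (euler \<zeta> u) v = dform (Suc k) (times_degree u) v"
    using radical_dform(1)[of "euler \<zeta> u - times_degree u" "Suc k" v] by (simp only: dform_diff1 right_minus_eq)
  also have "\<dots> = dform (Suc k) (scl (of_nat (Suc k)) u) v"
    by (rule dform_cong1) (simp add: times_degree_def pointwise)
  also have "\<dots> = of_nat (Suc k) * dform (Suc k) u v"
    by (simp only: dform_scl1)
  finally have 1: "dform (Suc k) (raise_lower u) v + of_real c * (\<zeta> - \<mu>) * dform (Suc k) u v = of_nat (Suc k) * dform (Suc k) u v"
    unfolding euler_def e by (simp only: dform_add1 dform_diff1 dform_scl1) (simp add: algebra_simps)
  have "dform (Suc k) (raise_lower u) v = cnj (dform (Suc k) v (raise_lower u))" by (rule dform_herm)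
  also have "\<dots> = (\<Sum>i\<in>UNIV. cnj (dform k (lower i v) (lower i u)))" unfolding dform_raise_lower by simp
  also have "\<dots> = (\<Sum>i\<in>UNIV. dform k (lower i u) (lower i v))" by (simp only: dform_herm[symmetric])
  finally show ?thesis using 1 by (simp add: algebra_simps)
qed

definition psd :: "nat \<Rightarrow> bool"
  where "psd k \<longleftrightarrow> (\<forall>u. fsupp u \<longrightarrow> 0 \<le> Re (dform k u u))"

lemma dform_real: "dform k u u = of_real (Re (dform k u u))"
proof -
  have "Im (dform k u u) = Im (cnj (dform k u u))"
    by (rule arg_cong[OF dform_herm])
  then show ?thesis by (simp add: complex_eq_iff)
qed

text \<open>
  The Cauchy-Schwarz argument for a null vector \<open>u\<close>.
\<close>

lemma psd_null:
  assumes p: "psd k" and u: "fsupp u" "Re (dform k u u) = 0" and v: "fsupp v"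
  shows "dform k u v = 0"
proof (rule ccontr)
  assume n: "dform k u v \<noteq> 0"
  \<comment> \<open>chosen so that the norm of the combination below would be \<open>2 t + (v, v) = - 1\<close>\<close>
  define t where "t = - (1 + Re (dform k v v)) / 2"
  let ?a = "t"
  let ?w = "scl (of_real t / dform k u v) u + v"
  have uu: "dform k u u = 0" using u dform_real by (metis of_real_0)
  have vu: "dform k v u = cnj (dform k u v)" by (rule dform_herm)
  have "dform k ?w ?w = of_real (2 * t) + dform k v v"
    using n by (simp add: dform_rules uu vu)
  then have "Re (dform k ?w ?w) = 2 * t + Re (dform k v v)" by simp
  moreover have "fsupp ?w" by (intro fsupp_rules u v)
  ultimately have "0 \<le> 2 * t + Re (dform k v v)" using p unfolding psd_def by metis
  then show False unfolding t_def by (simp add: field_simps)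
qed

text \<open>
  If the factor is positive it can be divided out. If it is zero, then all \<open>y_i u\<close> are null vectors,
  hence orthogonal to everything in the lower degree, and so is \<open>u\<close> in its own degree.
\<close>

lemma psd_eigen:
  assumes z: "scalar_Z \<zeta>" and p: "psd k" and u: "fsupp u" and e: "refl_sum u = scl (of_real \<mu>) u"
    and r: "\<zeta> = of_real r" and nn: "0 \<le> real (Suc k) + c * (\<mu> - r)"
  shows "0 \<le> Re (dform (Suc k) u u)"
proof -
  let ?m = "real (Suc k) + c * (\<mu> - r)"
  have m: "of_nat (Suc k) + of_real c * (of_real \<mu> - \<zeta>) = complex_of_real ?m" by (simp add: r)
  have rm: "Re (complex_of_real a * x) = a * Re x" for a x by simp
  have eq: "(\<Sum>i\<in>UNIV. Re (dform k (lower i u) (lower i u))) = ?m * Re (dform (Suc k) u u)"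
    using arg_cong[OF dform_eigen[OF z u e, of k u], of Re] unfolding m rm by (simp only: Re_sum)
  have nn': "0 \<le> Re (dform k (lower i u) (lower i u))" for i
    using p u fsupp_ops(2) unfolding psd_def by blast
  show ?thesis
  proof (cases "?m = 0")
    case False
    then have "0 < ?m" using nn by simp
    moreover have "0 \<le> ?m * Re (dform (Suc k) u u)" unfolding eq[symmetric] by (intro sum_nonneg nn')
    ultimately show ?thesis by (metis zero_le_mult_iff not_less)
  next
    case True
    then have "(\<Sum>i\<in>UNIV. Re (dform k (lower i u) (lower i u))) = 0" using eq by simp
    then have "Re (dform k (lower i u) (lower i u)) = 0" for i
      using sum_nonneg_eq_0_iff[of UNIV "\<lambda>i. Re (dform k (lower i u) (lower i u))"] nn' by simp
    then have "dform k (lower i u) (cut i u) = 0" for i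
      by (intro psd_null[OF p] fsupp_ops fsupp_rules u) auto
    then show ?thesis by simp
  qed
qed

end

section \<open>Modules over the free algebra\<close>

lemma falg_expand: "p = (\<Sum>w\<in>Poly_Mapping.keys p. Poly_Mapping.single w (Poly_Mapping.lookup p w))"
proof (rule poly_mapping_eqI)
  fix w
  have "Poly_Mapping.lookup (\<Sum>w\<in>Poly_Mapping.keys p. Poly_Mapping.single w (Poly_Mapping.lookup p w)) w
     = (\<Sum>v\<in>Poly_Mapping.keys p. if v = w then Poly_Mapping.lookup p w else 0)"
    by (auto simp: lookup_sum lookup_single when_def intro!: sum.cong)
  also have "\<dots> = Poly_Mapping.lookup p w"
    by (simp add: in_keys_iff)
  finally show "Poly_Mapping.lookup p w = Poly_Mapping.lookup (\<Sum>w\<in>Poly_Mapping.keys p. Poly_Mapping.single w (Poly_Mapping.lookup p w)) w"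
    by simp
qed

lemma falg_induct [consumes 1, case_names zero single add]:
  fixes p :: "'a \<Rightarrow>\<^sub>0 'b::comm_monoid_add"
  assumes "Poly_Mapping.keys p \<subseteq> K" and "P 0"
    and "\<And>w a. w \<in> K \<Longrightarrow> P (Poly_Mapping.single w a)"
    and "\<And>p q. Poly_Mapping.keys p \<subseteq> K \<Longrightarrow> Poly_Mapping.keys q \<subseteq> K \<Longrightarrow> P p \<Longrightarrow> P q \<Longrightarrow> P (p + q)"
  shows "P p"
proof -
  have "P (\<Sum>w\<in>A. Poly_Mapping.single w (f w)) \<and> Poly_Mapping.keys (\<Sum>w\<in>A. Poly_Mapping.single w (f w)) \<subseteq> K"
    if "finite A" "A \<subseteq> K" for A and f :: "'a \<Rightarrow> 'b"
    using that
  proof (induction A)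
    case (insert w A)
    have k: "Poly_Mapping.keys (Poly_Mapping.single w (f w)) \<subseteq> K" using insert by auto
    let ?q = "\<Sum>w\<in>A. Poly_Mapping.single w (f w)"
    have q: "P ?q" "Poly_Mapping.keys ?q \<subseteq> K" using insert by auto
    have "P (Poly_Mapping.single w (f w))" using insert assms(3) by auto
    then have "P (Poly_Mapping.single w (f w) + ?q)" using assms(4)[OF k q(2)] q by blast
    moreover have "Poly_Mapping.keys (Poly_Mapping.single w (f w) + ?q) \<subseteq> K"
      using keys_add[of "Poly_Mapping.single w (f w)" ?q] k q by blast
    ultimately show ?case using insert by simp
  qed (use assms in auto)
  from this[of "Poly_Mapping.keys p" "Poly_Mapping.lookup p"] show ?thesis
    unfolding falg_expand[of p, symmetric] using assms(1) by simp
qed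

definition falg_act ::
    "('g \<Rightarrow> ('b \<Rightarrow> complex ^ 'k) \<Rightarrow> 'b \<Rightarrow> complex ^ 'k) \<Rightarrow> 'g falg \<Rightarrow> ('b \<Rightarrow> complex ^ 'k) \<Rightarrow> 'b \<Rightarrow> complex ^ ('k::finite)"
  where "falg_act L p u =
    (\<Sum>w\<in>Poly_Mapping.keys p. scl (Poly_Mapping.lookup p w) (foldr L (letters w) u))"

lemma falg_act_superset:
  "finite A \<Longrightarrow> Poly_Mapping.keys p \<subseteq> A \<Longrightarrow>
    falg_act L p u = (\<Sum>w\<in>A. scl (Poly_Mapping.lookup p w) (foldr L (letters w) u))"
  unfolding falg_act_def by (rule sum.mono_neutral_left) (auto simp: in_keys_iff)

lemma falg_act_add: "falg_act L (p + q) u = falg_act L p u + falg_act L q u"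
proof -
  let ?A = "Poly_Mapping.keys p \<union> Poly_Mapping.keys q"
  have "falg_act L r u = (\<Sum>w\<in>?A. scl (Poly_Mapping.lookup r w) (foldr L (letters w) u))"
    if "Poly_Mapping.keys r \<subseteq> ?A" for r
    using that by (intro falg_act_superset) auto
  then show ?thesis using keys_add[of p q]
    by (simp add: lookup_add tm.scale_left_distrib sum.distrib)
qed

lemma falg_act_single: "falg_act L (Poly_Mapping.single w a) u = scl a (foldr L (letters w) u)"
  unfolding falg_act_def by (cases "a = 0") simp_all

lemma falg_act_0: "falg_act L 0 u = 0"
  by (simp add: falg_act_def)

lemma falg_act_minus: "falg_act L (- p) u = - falg_act L p u"
  using falg_act_add[of L p "- p" u] by (simp add: falg_act_0 eq_neg_iff_add_eq_0 add.commute)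

lemma falg_act_diff: "falg_act L (p - q) u = falg_act L p u - falg_act L q u"
  by (simp only: diff_conv_add_uminus falg_act_add falg_act_minus)

lemma falg_act_sum: "falg_act L (\<Sum>i\<in>A. f i) u = (\<Sum>i\<in>A. falg_act L (f i) u)"
  by (induction A rule: infinite_finite_induct) (auto simp: falg_act_0 falg_act_add)

lemma falg_act_gen: "falg_act L (gen g) u = L g u"
  by (simp add: gen_def falg_act_single)

lemma falg_act_const: "falg_act L (const a) u = scl a u"
  by (simp add: const_def falg_act_single zero_word_def)

lemma falg_act_1: "falg_act L 1 u = u"
  using falg_act_const[of L 1 u] by (simp add: const_def)

lemma linop_foldr: "(\<And>g. linop (L g)) \<Longrightarrow> linop (foldr L ws)"
  by (induction ws) (auto simp: linop_def)

lemma linop_falg_act: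
  assumes "\<And>g. linop (L g)"
  shows "linop (falg_act L p)"
  by (rule linopI)
     (simp_all add: falg_act_def linop_rules[OF linop_foldr[OF assms]] tm.scale_right_distrib sum.distrib
       tm.scale_sum_right mult.commute)

text \<open>
  Any choice of linear operators for the letters extends to an action of the free algebra.
\<close>

lemma falg_act_mult:
  assumes "\<And>g. linop (L g)"
  shows "falg_act L (p * q) u = falg_act L p (falg_act L q u)"
  using subset_UNIV[of "Poly_Mapping.keys p"]
proof (induction p rule: falg_induct)
  case (single w a)
  show ?case
    using subset_UNIV[of "Poly_Mapping.keys q"]
  proof (induction q rule: falg_induct)
    case (single v b)
    have "letters (w + v) = letters w @ letters v" by (simp add: plus_word_def)
    then show ?case
      by (simp add: falg_act_single mult_single linop_rules[OF linop_foldr[OF assms]])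
  qed (simp_all add: falg_act_0 falg_act_add falg_act_single linop_rules[OF linop_foldr[OF assms]]
         linop_rules[OF linop_falg_act[OF assms]] tm.scale_right_distrib distrib_left)
qed (simp_all add: falg_act_0 falg_act_add distrib_right)

lemmas falg_act_simps = falg_act_add falg_act_diff falg_act_sum falg_act_gen falg_act_const falg_act_1 falg_act_0 falg_act_minus

lemma carrier_free_alg: "p \<in> carrier (free_alg A) \<longleftrightarrow> Poly_Mapping.keys p \<subseteq> {w. set (letters w) \<subseteq> A}"
  by (auto simp: free_alg_def)

lemma free_alg_ops [simp]:
  "p \<otimes>\<^bsub>free_alg A\<^esub> q = p * q" "\<one>\<^bsub>free_alg A\<^esub> = 1" "\<zero>\<^bsub>free_alg A\<^esub> = 0" "p \<oplus>\<^bsub>free_alg A\<^esub> q = p + q"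
  by (simp_all add: free_alg_def)

lemma free_alg_closed:
  "0 \<in> carrier (free_alg A)" "1 \<in> carrier (free_alg A)"
  "p \<in> carrier (free_alg A) \<Longrightarrow> q \<in> carrier (free_alg A) \<Longrightarrow> p + q \<in> carrier (free_alg A)"
  "p \<in> carrier (free_alg A) \<Longrightarrow> q \<in> carrier (free_alg A) \<Longrightarrow> p * q \<in> carrier (free_alg A)"
  "p \<in> carrier (free_alg A) \<Longrightarrow> - p \<in> carrier (free_alg A)"
  "p \<in> carrier (free_alg A) \<Longrightarrow> q \<in> carrier (free_alg A) \<Longrightarrow> p - q \<in> carrier (free_alg A)"
  "g \<in> A \<Longrightarrow> gen g \<in> carrier (free_alg A)" "const a \<in> carrier (free_alg A)"
proof -
  show *: "p \<in> carrier (free_alg A) \<Longrightarrow> q \<in> carrier (free_alg A) \<Longrightarrow> p + q \<in> carrier (free_alg A)" for p q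
    using keys_add[of p q] unfolding carrier_free_alg by blast
  show **: "p \<in> carrier (free_alg A) \<Longrightarrow> - p \<in> carrier (free_alg A)" for p
    unfolding carrier_free_alg by (auto simp: in_keys_iff)
  show "p \<in> carrier (free_alg A) \<Longrightarrow> q \<in> carrier (free_alg A) \<Longrightarrow> p - q \<in> carrier (free_alg A)"
    using *[of p "- q"] **[of q] by simp
  show "p \<in> carrier (free_alg A) \<Longrightarrow> q \<in> carrier (free_alg A) \<Longrightarrow> p * q \<in> carrier (free_alg A)"
  proof -
    assume p: "p \<in> carrier (free_alg A)" and q: "q \<in> carrier (free_alg A)"
    show ?thesis unfolding carrier_free_alg
    proof
      fix w assume "w \<in> Poly_Mapping.keys (p * q)"
      then obtain a b where "w = a + b" "a \<in> Poly_Mapping.keys p" "b \<in> Poly_Mapping.keys q"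
        using keys_mult[of p q] by blast
      then show "w \<in> {w. set (letters w) \<subseteq> A}"
        using p q unfolding carrier_free_alg by (auto simp: plus_word_def)
    qed
  qed
qed (auto simp: carrier_free_alg gen_def const_def zero_word_def)

lemma free_alg_sum_closed:
  "(\<And>i. i \<in> I \<Longrightarrow> f i \<in> carrier (free_alg A)) \<Longrightarrow> (\<Sum>i\<in>I. f i) \<in> carrier (free_alg A)"
  by (induction I rule: infinite_finite_induct) (auto intro: free_alg_closed)

lemma ring_free_alg: "ring (free_alg A)"
proof (rule ringI)
  show "abelian_group (free_alg A)"
  proof (rule abelian_groupI)
    fix x assume "x \<in> carrier (free_alg A)"
    then show "\<exists>y\<in>carrier (free_alg A). y \<oplus>\<^bsub>free_alg A\<^esub> x = \<zero>\<^bsub>free_alg A\<^esub>"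
      by (intro bexI[of _ "- x"]) (auto intro: free_alg_closed)
  qed (auto intro: free_alg_closed simp: add.assoc add.commute)
  show "Group.monoid (free_alg A)"
    by (rule monoidI) (auto intro: free_alg_closed simp: mult.assoc)
qed (auto simp: distrib_left distrib_right)

lemma a_minus_free_alg: "p \<in> carrier (free_alg A) \<Longrightarrow> \<ominus>\<^bsub>free_alg A\<^esub> p = - p"
  by (rule abelian_group.minus_equality[OF ring.is_abelian_group[OF ring_free_alg]])
     (auto intro: free_alg_closed)

section \<open>The Cherednik algebra acts on tensors modulo the radical\<close>

lemma matrix_inv_eqI:
  fixes A B :: "real ^ 'n ^ ('n::finite)"
  assumes "A ** B = mat 1" "B ** A = mat 1"
  shows "matrix_inv A = B"
proof -
  have "A ** matrix_inv A = mat 1 \<and> matrix_inv A ** A = mat 1"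
    unfolding matrix_inv_def by (rule someI[of _ B]) (simp add: assms)
  then have "matrix_inv A = matrix_inv A ** (A ** B)" "matrix_inv A ** A = mat 1"
    using assms by auto
  then show ?thesis by (simp add: matrix_mul_assoc)
qed

lemma dual_expand:
  assumes "x \<in> dual_space"
  shows "x y = (\<Sum>i\<in>UNIV. y $ i * x (axis i 1))"
proof -
  interpret l: Vector_Spaces.linear "(*s)" "(*)" x using assms by (simp add: dual_space_def)
  have "x y = x (\<Sum>i\<in>UNIV. y $ i *s axis i 1)"
    by (simp add: basis_expansion)
  also have "\<dots> = (\<Sum>i\<in>UNIV. y $ i * x (axis i 1))"
    by (simp add: l.sum l.scale)
  finally show ?thesis .
qed

lemma dualI:
  assumes "\<And>y z. x (y + z) = x y + x z" "\<And>a y. x (a *s y) = a * x y"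
  shows "x \<in> dual_space"
  unfolding dual_space_def
  by (simp, unfold_locales) (auto simp: assms algebra_simps)

lemma dual_add: "x \<in> dual_space \<Longrightarrow> x (y + z) = x y + x z"
  and dual_scl: "x \<in> dual_space \<Longrightarrow> x (a *s y) = a * x y"
proof -
  assume "x \<in> dual_space"
  then interpret l: Vector_Spaces.linear "(*s)" "(*)" x by (simp add: dual_space_def)
  show "x (y + z) = x y + x z" "x (a *s y) = a * x y" by (rule l.add l.scale)+
qed

lemma act_h_add: "act_h g (y + z) = act_h g y + act_h g z"
  and act_h_scl: "act_h g (a *s y) = a *s act_h g y"
  and act_h_nth: "act_h g y $ i = (\<Sum>j\<in>UNIV. complex_of_real (g $ i $ j) * y $ j)"
  by (auto simp: act_h_def matrix_vector_mult_def vec_eq_iff algebra_simps sum.distrib sum_distrib_left)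

lemma dual_closed:
  "x \<in> dual_space \<Longrightarrow> x' \<in> dual_space \<Longrightarrow> (\<lambda>y. x y + x' y) \<in> dual_space"
  "x \<in> dual_space \<Longrightarrow> (\<lambda>y. a * x y) \<in> dual_space"
  "x \<in> dual_space \<Longrightarrow> act_dual g x \<in> dual_space"
  "T_map z \<in> dual_space"
  by (auto intro!: dualI simp: dual_add dual_scl act_dual_def act_h_add act_h_scl T_map_def herm_def
      algebra_simps sum.distrib sum_distrib_left)

text \<open>
  The relations see a root pair only through the product of the two pairings, and this product is
  \<open>x(y) - x(s y)\<close>; the concrete groups have to supply this formula.
\<close>

locale cherednik_form = refl_form W "reflections W" c \<tau> \<beta>0
  for W :: "(real ^ 'n ^ ('n::finite)) set" and c :: real and \<tau> :: "('n, 'k::finite) grp_rep"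
    and \<beta>0 :: "complex ^ 'k \<Rightarrow> complex ^ 'k \<Rightarrow> complex" +
  assumes root: "s \<in> reflections W \<Longrightarrow> x \<in> dual_space \<Longrightarrow>
    fst (root_pair s) y * x (snd (root_pair s)) = x y - x (act_h s y)"
begin

primrec letter_op :: "'n letter \<Rightarrow> ('n, 'k) tens \<Rightarrow> ('n, 'k) tens" where
  "letter_op (Grp g) u = rho g u"
| "letter_op (Vec y) u = (\<Sum>i\<in>UNIV. scl (y $ i) (lower i u))"
| "letter_op (Cov x) u = (\<Sum>i\<in>UNIV. scl (x (axis i 1)) (raise i u))"

lemma linop_letter_op: "linop (letter_op g)"
proof (cases g)
  case (Grp x) then show ?thesis using linop_rho[of x] by (simp add: linop_def)
next
  case (Vec y)
  have "linop (\<lambda>u. \<Sum>i\<in>UNIV. scl (y $ i) (lower i u))"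
    by (intro linop_sumop linop_sclop linop_lower)
  then show ?thesis using Vec by (simp add: linop_def)
next
  case (Cov x)
  have "linop (\<lambda>u. \<Sum>i\<in>UNIV. scl (x (axis i 1)) (raise i u))"
    by (intro linop_sumop linop_sclop linop_raise)
  then show ?thesis using Cov by (simp add: linop_def)
qed

abbreviation act :: "'n letter falg \<Rightarrow> ('n, 'k) tens \<Rightarrow> ('n, 'k) tens" where "act \<equiv> falg_act letter_op"

lemmas act_mult = falg_act_mult[of letter_op, OF linop_letter_op]
lemmas linop_act = linop_falg_act[of letter_op, OF linop_letter_op]

lemma letters_preserve:
  assumes "g \<in> all_letters W"
  shows "fsupp u \<Longrightarrow> fsupp (letter_op g u)" and "radical u \<Longrightarrow> radical (letter_op g u)"
  using assms
  by (auto simp: all_letters_def intro!: fsupp_sum fsupp_rules fsupp_ops radical_sum radical_rules radical_raise radical_lower radical_rho)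

lemma act_preserve:
  assumes "p \<in> carrier (free_alg (all_letters W))"
  shows "fsupp u \<Longrightarrow> fsupp (act p u)" and "radical u \<Longrightarrow> radical (act p u)"
proof -
  have f: "set ws \<subseteq> all_letters W \<Longrightarrow> (fsupp u \<longrightarrow> fsupp (foldr letter_op ws u)) \<and> (radical u \<longrightarrow> radical (foldr letter_op ws u))" for ws
    by (induction ws) (auto intro: letters_preserve)
  have "(fsupp u \<longrightarrow> fsupp (act p u)) \<and> (radical u \<longrightarrow> radical (act p u))"
    using assms unfolding carrier_free_alg
  proof (induction p rule: falg_induct)
    case (single w a)
    then show ?case using f[of "letters w"] by (auto simp: falg_act_single intro: fsupp_rules radical_rules)
  qed (auto simp: falg_act_simps intro: fsupp_rules radical_rules)
  then show "fsupp u \<Longrightarrow> fsupp (act p u)" and "radical u \<Longrightarrow> radical (act p u)" by auto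
qed

lemma matrix_inv_W: "g \<in> W \<Longrightarrow> matrix_inv g = transpose g"
  by (rule matrix_inv_eqI) (simp_all add: orth_W orth_W')

lemma act_dual_axis:
  assumes "g \<in> W" "x \<in> dual_space"
  shows "act_dual g x (axis i 1) = (\<Sum>j\<in>UNIV. en g i j * x (axis j 1))"
proof -
  have "act_h (matrix_inv g) (axis i 1) $ j = en g i j" for j
    unfolding act_h_nth matrix_inv_W[OF assms(1)]
    by (simp add: transpose_def axis_def if_distrib[of "\<lambda>a. _ * a"] sum.delta cong: if_cong)
  then show ?thesis
    unfolding act_dual_def by (subst dual_expand[OF assms(2)]) simp
qed

text \<open>
  The bracket relation for arbitrary \<open>y\<close> and \<open>x\<close>, by expanding both in coordinates.
\<close>

lemma letter_op_comm:
  assumes x: "x \<in> dual_space"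
  shows "letter_op (Vec y) (letter_op (Cov x) u) - letter_op (Cov x) (letter_op (Vec y) u) =
     scl (x y) u - scl (of_real c) (\<Sum>s\<in>reflections W. scl (x y - x (act_h s y)) (rho s u))"
proof -
  have xy: "(\<Sum>i\<in>UNIV. \<Sum>j\<in>UNIV. y $ i * x (axis j 1) * kd i j) = x y"
    by (simp add: dual_expand[OF x, of y] if_distrib[of "\<lambda>a. _ * a"] sum.delta cong: if_cong)
  have xsy: "(\<Sum>i\<in>UNIV. \<Sum>j\<in>UNIV. y $ i * x (axis j 1) * en s j i) = x (act_h s y)" for s
    by (subst sum.swap) (simp add: dual_expand[OF x, of "act_h s y"] act_h_nth sum_distrib_right sum_distrib_left mult_ac)
  have h: "scl a (bracket i j u) = scl (a * kd i j) u
      - scl (of_real c) (\<Sum>s\<in>reflections W. scl (a * (kd i j - en s j i)) (rho s u))" for a i j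
    unfolding bracket_def tm.scale_right_diff_distrib tm.scale_left_commute[of a "complex_of_real c"]
    by (simp only: tm.scale_sum_right tm.scale_scale)
  have "letter_op (Vec y) (letter_op (Cov x) u) - letter_op (Cov x) (letter_op (Vec y) u)
     = (\<Sum>i\<in>UNIV. \<Sum>j\<in>UNIV. scl (y $ i * x (axis j 1)) (lower i (raise j u)))
       - (\<Sum>j\<in>UNIV. \<Sum>i\<in>UNIV. scl (y $ i * x (axis j 1)) (raise j (lower i u)))"
    by (simp only: letter_op.simps lower_rules linop_rules[OF linop_raise] tm.scale_sum_right tm.scale_scale mult.commute)
  also have "(\<Sum>j\<in>UNIV. \<Sum>i\<in>UNIV. scl (y $ i * x (axis j 1)) (raise j (lower i u)))
      = (\<Sum>i\<in>UNIV. \<Sum>j\<in>UNIV. scl (y $ i * x (axis j 1)) (raise j (lower i u)))"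
    by (rule sum.swap)
  also have "(\<Sum>i\<in>UNIV. \<Sum>j\<in>UNIV. scl (y $ i * x (axis j 1)) (lower i (raise j u))) - \<dots>
      = (\<Sum>i\<in>UNIV. \<Sum>j\<in>UNIV. scl (y $ i * x (axis j 1)) (bracket i j u))"
    by (simp only: lower_raise tm.scale_right_distrib sum.distrib add_diff_cancel_left')
  also have "\<dots> = scl (\<Sum>i\<in>UNIV. \<Sum>j\<in>UNIV. y $ i * x (axis j 1) * kd i j) u
     - scl (of_real c) (\<Sum>i\<in>UNIV. \<Sum>j\<in>UNIV. \<Sum>s\<in>reflections W. scl (y $ i * x (axis j 1) * (kd i j - en s j i)) (rho s u))"
    by (simp only: h sum_subtractf tm.scale_sum_left tm.scale_sum_right)
  also have "(\<Sum>i\<in>UNIV. \<Sum>j\<in>UNIV. \<Sum>s\<in>reflections W. scl (y $ i * x (axis j 1) * (kd i j - en s j i)) (rho s u))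
     = (\<Sum>s\<in>reflections W. scl (\<Sum>i\<in>UNIV. \<Sum>j\<in>UNIV. y $ i * x (axis j 1) * (kd i j - en s j i)) (rho s u))"
    unfolding tm.scale_sum_left by (rule sum_swap3)
  finally show ?thesis
    by (simp only: right_diff_distrib sum_subtractf xy xsy)
qed

lemma letter_op_rho_Vec: 
  assumes g: "g \<in> W"
  shows "rho g (letter_op (Vec y) u) = letter_op (Vec (act_h g y)) (rho g u)"
proof -
  have "rho g (letter_op (Vec y) u) = (\<Sum>i\<in>UNIV. \<Sum>p\<in>UNIV. scl (y $ i * en g p i) (lower p (rho g u)))"
    by (simp add: rho_rules rho_lower[OF g] tm.scale_sum_right)
  also have "\<dots> = letter_op (Vec (act_h g y)) (rho g u)"
    by (subst sum.swap) (simp add: act_h_nth tm.scale_sum_left mult.commute)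
  finally show ?thesis .
qed

lemma letter_op_rho_Cov: 
  assumes g: "g \<in> W" and x: "x \<in> dual_space"
  shows "rho g (letter_op (Cov x) u) = letter_op (Cov (act_dual g x)) (rho g u)"
proof -
  have "rho g (letter_op (Cov x) u) = (\<Sum>j\<in>UNIV. \<Sum>i\<in>UNIV. scl (x (axis j 1) * en g i j) (raise i (rho g u)))"
    by (simp add: rho_rules rho_raise tm.scale_sum_right)
  also have "\<dots> = letter_op (Cov (act_dual g x)) (rho g u)"
    by (subst sum.swap) (simp add: act_dual_axis[OF g x] tm.scale_sum_left mult.commute)
  finally show ?thesis .
qed

lemma letter_op_Vec_commute: "letter_op (Vec y) (letter_op (Vec y') u) = letter_op (Vec y') (letter_op (Vec y) u)"
proof -
  have "letter_op (Vec y) (letter_op (Vec y') u) = (\<Sum>i\<in>UNIV. \<Sum>j\<in>UNIV. scl (y $ i * y' $ j) (lower i (lower j u)))" for y y'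
    by (simp add: lower_rules tm.scale_sum_right)
  note * = this
  have "(\<Sum>i\<in>UNIV. \<Sum>j\<in>UNIV. scl (y $ i * y' $ j) (lower i (lower j u)))
      = (\<Sum>i\<in>UNIV. \<Sum>j\<in>UNIV. scl (y' $ i * y $ j) (lower i (lower j u)))"
    by (subst sum.swap) (simp only: lower_commute mult.commute)
  then show ?thesis unfolding * .
qed

lemma letter_op_Cov_commute: "radical (letter_op (Cov x) (letter_op (Cov x') u) - letter_op (Cov x') (letter_op (Cov x) u))"
proof -
  have *: "letter_op (Cov x) (letter_op (Cov x') u) = (\<Sum>i\<in>UNIV. \<Sum>j\<in>UNIV. scl (x (axis i 1) * x' (axis j 1)) (raise i (raise j u)))" for x x'
    by (simp add: linop_rules[OF linop_raise] tm.scale_sum_right)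
  have "letter_op (Cov x') (letter_op (Cov x) u) = (\<Sum>i\<in>UNIV. \<Sum>j\<in>UNIV. scl (x (axis i 1) * x' (axis j 1)) (raise j (raise i u)))"
    unfolding * by (subst sum.swap) (simp only: mult.commute)
  then have "letter_op (Cov x) (letter_op (Cov x') u) - letter_op (Cov x') (letter_op (Cov x) u) =
     (\<Sum>i\<in>UNIV. \<Sum>j\<in>UNIV. scl (x (axis i 1) * x' (axis j 1)) (raise i (raise j u) - raise j (raise i u)))"
    unfolding * by (simp only: tm.scale_right_diff_distrib sum_subtractf)
  then show ?thesis by (simp only: radical_sum radical_rules radical_commutator)
qed

abbreviation "F \<equiv> free_alg (all_letters W)"
abbreviation "J \<equiv> cherednik_ideal W c"

lemma letters_mem:
  "g \<in> W \<Longrightarrow> Grp g \<in> all_letters W" "Vec y \<in> all_letters W" "x \<in> dual_space \<Longrightarrow> Cov x \<in> all_letters W"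
  by (auto simp: all_letters_def)

lemma gen_mem:
  "g \<in> W \<Longrightarrow> gen (Grp g) \<in> carrier F" "gen (Vec y) \<in> carrier F" "x \<in> dual_space \<Longrightarrow> gen (Cov x) \<in> carrier F"
  by (auto intro: free_alg_closed letters_mem)

lemma rels_carrier: "smash_rels W \<union> cherednik_rels W c \<subseteq> carrier F"
proof -
  have "s \<in> reflections W \<Longrightarrow> s \<in> W" for s by (simp add: reflections_def)
  then show ?thesis
    unfolding smash_rels_def cherednik_rels_def
    by (auto intro!: free_alg_closed(1-6,8) free_alg_sum_closed gen_mem dual_closed one_W mult_W)
qed

text \<open>
  All relations hold exactly on tensors, with the exception of \<open>x x' = x' x\<close>, which holds modulo the
  radical.
\<close>

lemma rels_radical:
  assumes "p \<in> smash_rels W \<union> cherednik_rels W c"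
  shows "radical (act p u)"
proof -
  note sc = tm.scale_left_distrib sum.distrib tm.scale_sum_right tm.scale_scale
  note ev = falg_act_simps act_mult
  have sm: "act p u = 0" if "p \<in> smash_rels W"
    using that unfolding smash_rels_def Un_iff mem_Collect_eq insert_iff empty_iff
  proof (elim disjE exE conjE)
    assume "p = gen (Grp (mat 1)) - 1"
    then show ?thesis by (simp only: ev letter_op.simps rho_one diff_self)
  next
    fix w w' assume "p = gen (Grp w) * gen (Grp w') - gen (Grp (w ** w'))" "w \<in> W" "w' \<in> W"
    then show ?thesis by (simp only: ev letter_op.simps rho_mult diff_self)
  next
    fix y y' assume p: "p = gen (Vec (y + y')) - gen (Vec y) - gen (Vec y')"
    show ?thesis unfolding p by (simp only: ev letter_op.simps vector_add_component sc) simp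
  next
    fix a y assume p: "p = gen (Vec (a *s y)) - const a * gen (Vec y)"
    show ?thesis unfolding p by (simp only: ev letter_op.simps vector_smult_component sc) simp
  next
    fix x x' assume p: "p = gen (Cov (\<lambda>y. x y + x' y)) - gen (Cov x) - gen (Cov x')"
    show ?thesis unfolding p by (simp only: ev letter_op.simps sc) simp
  next
    fix a x assume p: "p = gen (Cov (\<lambda>y. a * x y)) - const a * gen (Cov x)"
    show ?thesis unfolding p by (simp only: ev letter_op.simps sc) simp
  next
    fix w y assume p: "p = gen (Grp w) * gen (Vec y) - gen (Vec (act_h w y)) * gen (Grp w)" and w: "w \<in> W"
    show ?thesis unfolding p by (simp only: ev letter_op.simps(1) letter_op_rho_Vec[OF w] diff_self)
  next
    fix w x assume p: "p = gen (Grp w) * gen (Cov x) - gen (Cov (act_dual w x)) * gen (Grp w)"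
      and w: "w \<in> W" and x: "x \<in> dual_space"
    show ?thesis unfolding p by (simp only: ev letter_op.simps(1) letter_op_rho_Cov[OF w x] diff_self)
  qed simp
  have ch: "radical (act p u)" if "p \<in> cherednik_rels W c"
    using that unfolding cherednik_rels_def Un_iff mem_Collect_eq
  proof (elim disjE exE conjE)
    fix x x' assume p: "p = gen (Cov x) * gen (Cov x') - gen (Cov x') * gen (Cov x)"
    show ?thesis unfolding p by (simp only: ev letter_op_Cov_commute)
  next
    fix y y' assume p: "p = gen (Vec y) * gen (Vec y') - gen (Vec y') * gen (Vec y)"
    show ?thesis unfolding p by (simp only: ev letter_op_Vec_commute[of y y'] diff_self radical_rules)
  next
    fix x y assume x: "x \<in> dual_space"
      and p: "p = gen (Vec y) * gen (Cov x) - gen (Cov x) * gen (Vec y)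
         - (const (x y) - const (complex_of_real c) *
              (\<Sum>s\<in>reflections W.
                 const (fst (root_pair s) y * x (snd (root_pair s))) * gen (Grp s)))"
    have "(\<Sum>s\<in>reflections W. scl (fst (root_pair s) y * x (snd (root_pair s))) (letter_op (Grp s) u))
       = (\<Sum>s\<in>reflections W. scl (x y - x (act_h s y)) (rho s u))"
      by (rule sum.cong) (simp_all add: root[OF _ x])
    then have "act p u = 0"
      unfolding p by (simp only: ev letter_op_comm[OF x] diff_self)
    then show ?thesis by (simp only: radical_rules)
  qed
  from assms show ?thesis
  proof
    assume "p \<in> smash_rels W" then show ?thesis by (simp only: sm radical_rules)
  qed (rule ch)
qed

lemma ideal_J: "ideal J F"
  unfolding cherednik_ideal_def by (rule ring.genideal_ideal[OF ring_free_alg rels_carrier])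

lemma rels_J: "smash_rels W \<union> cherednik_rels W c \<subseteq> J"
  unfolding cherednik_ideal_def by (rule ring.genideal_self[OF ring_free_alg rels_carrier])

text \<open>
  The elements that map everything into the radical form a two-sided ideal, because the radical is
  stable under all letters.
\<close>

lemma J_radical: "p \<in> J \<Longrightarrow> radical (act p u)"
proof -
  let ?I = "{p \<in> carrier F. \<forall>u. radical (act p u)}"
  interpret F: ring F by (rule ring_free_alg)
  have "ideal ?I F"
  proof (rule idealI[OF ring_free_alg])
    show "subgroup ?I (add_monoid F)"
    proof (rule group.subgroupI[OF F.a_group])
      show "?I \<noteq> {}" using free_alg_closed(1) by (auto simp: falg_act_simps radical_rules intro!: exI[of _ 0])
      fix a b assume a: "a \<in> ?I"
      then have "\<ominus>\<^bsub>F\<^esub> a = - a" by (auto intro: a_minus_free_alg)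
      then have "inv\<^bsub>add_monoid F\<^esub> a = - a" by (simp only: a_inv_def)
      moreover have "- a \<in> ?I" using a by (auto simp: falg_act_simps radical_rules free_alg_closed)
      ultimately show "inv\<^bsub>add_monoid F\<^esub> a \<in> ?I" by (simp only:)
      assume "b \<in> ?I"
      then show "a \<otimes>\<^bsub>add_monoid F\<^esub> b \<in> ?I"
        using a by (simp add: falg_act_simps radical_rules free_alg_closed)
    qed auto
  qed (auto simp: act_mult free_alg_closed intro: act_preserve)
  moreover have "smash_rels W \<union> cherednik_rels W c \<subseteq> ?I"
    using rels_carrier rels_radical by auto
  ultimately have "J \<subseteq> ?I"
    unfolding cherednik_ideal_def by (rule F.genideal_minimal)
  then show "p \<in> J \<Longrightarrow> radical (act p u)" by auto
qed

end

section \<open>The standard module as fragments modulo relations\<close>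

lemma const_commute: "const a * p = p * const a"
  using subset_UNIV[of "Poly_Mapping.keys p"]
proof (induction p rule: falg_induct)
  case (single w b)
  then show ?case by (simp add: const_def mult_single mult.commute)
qed (auto simp: distrib_left distrib_right)

lemma rep_act_const: "rep_act \<tau> (const a) v = a *s v"
  by (cases "a = 0") (auto simp: rep_act_def const_def zero_word_def)

lemma rep_act_gen: "rep_act \<tau> (gen g) v = letter_act \<tau> g v"
  by (simp add: rep_act_def gen_def)

context cherednik_form
begin

abbreviation "H \<equiv> cherednik_alg W c"
abbreviation "cl \<equiv> cls W c"
abbreviation "PT \<equiv> pre_tensor_group W c \<tau>"
abbreviation "K \<equiv> tensor_kernel W c \<tau>"

lemma cl_ops:
  assumes "p \<in> carrier F" "q \<in> carrier F"
  shows "cl p \<otimes>\<^bsub>H\<^esub> cl q = cl (p * q)" "cl p \<oplus>\<^bsub>H\<^esub> cl q = cl (p + q)"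
  using ideal.rcoset_mult_add[OF ideal_J assms] ideal.a_rcos_sum[OF ideal_J assms]
  by (simp_all add: cherednik_alg_def FactRing_def cls_def)

lemma one_H: "\<one>\<^bsub>H\<^esub> = cl 1"
  by (simp add: cherednik_alg_def FactRing_def cls_def)

lemma cl_def: "cl p = (\<lambda>h. h + p) ` J"
  by (auto simp: cls_def a_r_coset_def r_coset_def)

lemma carrier_H: "carrier H = cl ` carrier F"
  by (auto simp: cherednik_alg_def FactRing_def A_RCOSETS_defs cls_def a_r_coset_def)

lemma cl_carrier: "p \<in> carrier F \<Longrightarrow> cl p \<in> carrier H"
  by (simp add: carrier_H)

lemma J_closed: "0 \<in> J" "p \<in> J \<Longrightarrow> q \<in> J \<Longrightarrow> p + q \<in> J" "p \<in> J \<Longrightarrow> - p \<in> J"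
proof -
  interpret I: ideal J F by (rule ideal_J)
  have f: "p \<in> J \<Longrightarrow> p \<in> carrier F" for p by (rule I.a_Hcarr)
  show "0 \<in> J" using additive_subgroup.zero_closed[OF ideal.axioms(1)[OF ideal_J]] by simp
  show "p \<in> J \<Longrightarrow> q \<in> J \<Longrightarrow> p + q \<in> J" using additive_subgroup.a_closed[OF ideal.axioms(1)[OF ideal_J], of p q] by simp
  show "p \<in> J \<Longrightarrow> - p \<in> J" using additive_subgroup.a_inv_closed[OF ideal.axioms(1)[OF ideal_J], of p] a_minus_free_alg[OF f, of p] by simp
qed

lemma cl_eqD: "cl p = cl q \<Longrightarrow> p - q \<in> J"
proof -
  assume e: "cl p = cl q"
  have "p \<in> cl p" unfolding cl_def using J_closed(1) by (intro image_eqI[of _ _ 0]) auto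
  then have "p \<in> (\<lambda>h. h + q) ` J" unfolding e cl_def[of q] .
  then show ?thesis by auto
qed

lemma cl_eqI: "p - q \<in> J \<Longrightarrow> cl p = cl q"
proof -
  have "cl p \<subseteq> cl q" if "p - q \<in> J" for p q
  proof
    fix x assume "x \<in> cl p"
    then obtain h where h: "h \<in> J" "x = h + p" by (auto simp: cl_def)
    then have "x = (h + (p - q)) + q" by simp
    then show "x \<in> cl q" unfolding cl_def using J_closed(2)[OF h(1) that] by (rule image_eqI)
  qed
  moreover assume "p - q \<in> J"
  moreover from this have "q - p \<in> J" using J_closed(3)[of "p - q"] by simp
  ultimately show ?thesis by blast
qed

lemma carrier_PT: "x \<in> carrier PT \<longleftrightarrow> Poly_Mapping.keys x \<subseteq> carrier H \<times> UNIV"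
  by (simp add: pre_tensor_group_def)

lemma PT_ops: "x \<otimes>\<^bsub>PT\<^esub> y = x + y" "\<one>\<^bsub>PT\<^esub> = 0" "x \<in> carrier PT \<Longrightarrow> inv\<^bsub>PT\<^esub> x = - x"
  by (auto simp: pre_tensor_group_def)

lemma comm_group_PT: "comm_group PT"
  by (simp add: pre_tensor_group_def abelian_free_Abelian_group)

lemma group_PT: "group PT"
  using comm_group_PT comm_group.axioms by blast

lemma PT_closed:
  "0 \<in> carrier PT" "x \<in> carrier PT \<Longrightarrow> y \<in> carrier PT \<Longrightarrow> x + y \<in> carrier PT"
  "x \<in> carrier PT \<Longrightarrow> y \<in> carrier PT \<Longrightarrow> x - y \<in> carrier PT" "x \<in> carrier PT \<Longrightarrow> - x \<in> carrier PT"
  using keys_add[of x y] keys_diff[of x y] by (auto simp: carrier_PT)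

lemma PT_sum_closed: "(\<And>i. i \<in> A \<Longrightarrow> f i \<in> carrier PT) \<Longrightarrow> (\<Sum>i\<in>A. f i) \<in> carrier PT"
  by (induction A rule: infinite_finite_induct) (auto intro: PT_closed)

definition pure :: "'n letter falg \<Rightarrow> complex ^ 'k \<Rightarrow> ('n, 'k) pre_tensor"
  where "pure p v = frag_of (cl p, v)"

lemma pure_closed: "p \<in> carrier F \<Longrightarrow> pure p v \<in> carrier PT"
  by (simp add: pure_def carrier_PT keys_frag_of cl_carrier)

lemma PT_induct [consumes 1, case_names zero pure diff]:
  assumes "x \<in> carrier PT" "P 0" "\<And>p v. p \<in> carrier F \<Longrightarrow> P (pure p v)"
    "\<And>x y. x \<in> carrier PT \<Longrightarrow> y \<in> carrier PT \<Longrightarrow> P x \<Longrightarrow> P y \<Longrightarrow> P (x - y)"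
  shows "P x"
proof -
  have "x \<in> carrier PT \<and> P x"
    using assms(1)[unfolded carrier_PT]
  proof (induction x rule: frag_induction)
    case (one x)
    then show ?case using assms(3) pure_closed by (auto simp: carrier_H pure_def)
  qed (use assms PT_closed in auto)
  then show ?thesis ..
qed

text \<open>
  Elements of the Cherednik algebra are replaced by representatives in the free algebra throughout.
\<close>

lemma tensor_rels_cases:
  assumes "x \<in> tensor_rels W c \<tau>"
  obtains (add1) p q v where "p \<in> carrier F" "q \<in> carrier F" "x = pure (p + q) v - pure p v - pure q v"
    | (add2) p v v' where "p \<in> carrier F" "x = pure p (v + v') - pure p v - pure p v'"
    | (bal) p q v where "p \<in> carrier F" "q \<in> carrier (free_alg (sub_letters W))" "q \<in> carrier F"
        "x = pure (p * q) v - pure p (rep_act \<tau> q v)"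
proof -
  have sub: "q \<in> carrier F" if "q \<in> carrier (free_alg (sub_letters W))" for q
    using that by (auto simp: carrier_free_alg sub_letters_def all_letters_def)
  from assms show ?thesis unfolding tensor_rels_def Let_def Un_iff mem_Collect_eq
  proof (elim disjE exE conjE)
    fix a b v assume x: "x = frag_of (a \<oplus>\<^bsub>H\<^esub> b, v) - frag_of (a, v) - frag_of (b, v)"
      and ab: "a \<in> carrier H" "b \<in> carrier H"
    then obtain p q where pq: "p \<in> carrier F" "q \<in> carrier F" "a = cl p" "b = cl q"
      by (auto simp: carrier_H)
    show ?thesis by (rule add1[OF pq(1,2), of v]) (simp add: x pq cl_ops pure_def)
  next
    fix a v v' assume x: "x = frag_of (a, v + v') - frag_of (a, v) - frag_of (a, v')" and a: "a \<in> carrier H"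
    then obtain p where p: "p \<in> carrier F" "a = cl p"
      by (auto simp: carrier_H)
    show ?thesis by (rule add2[OF p(1), of v v']) (simp add: x p pure_def)
  next
    fix a q v assume x: "x = frag_of (a \<otimes>\<^bsub>H\<^esub> cl q, v) - frag_of (a, rep_act \<tau> q v)"
      and a: "a \<in> carrier H" and q: "q \<in> carrier (free_alg (sub_letters W))"
    then obtain p where p: "p \<in> carrier F" "a = cl p"
      by (auto simp: carrier_H)
    show ?thesis by (rule bal[OF p(1) q sub[OF q], of v]) (simp add: x p cl_ops sub[OF q] pure_def)
  qed
qed

lemma tensor_rels_I:
  "p \<in> carrier F \<Longrightarrow> q \<in> carrier F \<Longrightarrow> pure (p + q) v - pure p v - pure q v \<in> tensor_rels W c \<tau>"
  "p \<in> carrier F \<Longrightarrow> pure p (v + v') - pure p v - pure p v' \<in> tensor_rels W c \<tau>"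
  "p \<in> carrier F \<Longrightarrow> q \<in> carrier F \<Longrightarrow> q \<in> carrier (free_alg (sub_letters W)) \<Longrightarrow>
    pure (p * q) v - pure p (rep_act \<tau> q v) \<in> tensor_rels W c \<tau>"
proof -
  show "pure (p + q) v - pure p v - pure q v \<in> tensor_rels W c \<tau>" if "p \<in> carrier F" "q \<in> carrier F"
  proof -
    have "pure (p + q) v - pure p v - pure q v = frag_of (cl p \<oplus>\<^bsub>H\<^esub> cl q, v) - frag_of (cl p, v) - frag_of (cl q, v)"
      by (simp add: pure_def cl_ops that)
    then show ?thesis using that unfolding tensor_rels_def Let_def by (blast intro: cl_carrier)
  qed
  show "pure p (v + v') - pure p v - pure p v' \<in> tensor_rels W c \<tau>" if "p \<in> carrier F"
    using that unfolding tensor_rels_def Let_def pure_def by (blast intro: cl_carrier)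
  show "pure (p * q) v - pure p (rep_act \<tau> q v) \<in> tensor_rels W c \<tau>"
    if "p \<in> carrier F" "q \<in> carrier F" "q \<in> carrier (free_alg (sub_letters W))"
  proof -
    have "pure (p * q) v - pure p (rep_act \<tau> q v) = frag_of (cl p \<otimes>\<^bsub>H\<^esub> cl q, v) - frag_of (cl p, rep_act \<tau> q v)"
      by (simp add: pure_def cl_ops that)
    then show ?thesis using that unfolding tensor_rels_def Let_def by (blast intro: cl_carrier)
  qed
qed

lemma tensor_rels_carrier: "tensor_rels W c \<tau> \<subseteq> carrier PT"
proof
  fix x assume "x \<in> tensor_rels W c \<tau>"
  then show "x \<in> carrier PT"
    by (cases rule: tensor_rels_cases) (auto intro!: PT_closed pure_closed free_alg_closed)
qed

lemma subgroup_K: "subgroup K PT"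
  unfolding tensor_kernel_def by (rule group.generate_is_subgroup[OF group_PT tensor_rels_carrier])

lemma K_closed:
  "0 \<in> K" "x \<in> K \<Longrightarrow> y \<in> K \<Longrightarrow> x + y \<in> K" "x \<in> K \<Longrightarrow> - x \<in> K" "x \<in> K \<Longrightarrow> y \<in> K \<Longrightarrow> x - y \<in> K"
proof -
  have c: "x \<in> K \<Longrightarrow> x \<in> carrier PT" for x using subgroup.mem_carrier[OF subgroup_K] .
  show "0 \<in> K" using subgroup.one_closed[OF subgroup_K] by (simp add: PT_ops)
  show a: "x \<in> K \<Longrightarrow> y \<in> K \<Longrightarrow> x + y \<in> K" for x y using subgroup.m_closed[OF subgroup_K] by (simp add: PT_ops)
  show m: "x \<in> K \<Longrightarrow> - x \<in> K" for x using subgroup.m_inv_closed[OF subgroup_K] c by (metis PT_ops(3))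
  show "x \<in> K \<Longrightarrow> y \<in> K \<Longrightarrow> x - y \<in> K" using a[of x "- y"] m[of y] by simp
qed

lemma K_induct [consumes 1, case_names rel zero diff]:
  assumes "x \<in> K" "\<And>x. x \<in> tensor_rels W c \<tau> \<Longrightarrow> P x" "P 0"
    "\<And>x y. P x \<Longrightarrow> P y \<Longrightarrow> P (x - y)"
  shows "P x"
  using assms(1) unfolding tensor_kernel_def
proof (induction rule: generate.induct)
  case one then show ?case using assms(3) by (simp add: PT_ops)
next
  case (incl h) then show ?case by (rule assms(2))
next
  case (inv h)
  then have "inv\<^bsub>PT\<^esub> h = 0 - h" using tensor_rels_carrier by (auto simp: PT_ops)
  then show ?case using assms(4)[OF assms(3) assms(2)[OF inv]] by simp
next
  case (eng h1 h2)
  have "P (h1 - (0 - h2))" using eng.IH assms(3,4) by blast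
  then show ?case by (simp add: PT_ops)
qed

text \<open>
  Computations in the standard module are done with fragments up to this congruence; this avoids
  working with cosets and the multiplicative notation of the quotient group.
\<close>

definition eqv :: "('n, 'k) pre_tensor \<Rightarrow> ('n, 'k) pre_tensor \<Rightarrow> bool" (infix \<open>\<approx>\<approx>\<close> 50)
  where "x \<approx>\<approx> y \<longleftrightarrow> x - y \<in> K"

lemma eqv_refl [simp]: "x \<approx>\<approx> x"
  by (simp add: eqv_def K_closed)

lemma eqv_sym: "x \<approx>\<approx> y \<Longrightarrow> y \<approx>\<approx> x"
  unfolding eqv_def using K_closed(3)[of "x - y"] by simp

lemma eqv_trans [trans]: "x \<approx>\<approx> y \<Longrightarrow> y \<approx>\<approx> z \<Longrightarrow> x \<approx>\<approx> z"
  unfolding eqv_def using K_closed(2)[of "x - y" "y - z"] by simp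

lemma eqv_add: "x \<approx>\<approx> y \<Longrightarrow> x' \<approx>\<approx> y' \<Longrightarrow> x + x' \<approx>\<approx> y + y'"
  unfolding eqv_def using K_closed(2)[of "x - y" "x' - y'"] by (simp add: algebra_simps)

lemma eqv_diff: "x \<approx>\<approx> y \<Longrightarrow> x' \<approx>\<approx> y' \<Longrightarrow> x - x' \<approx>\<approx> y - y'"
  unfolding eqv_def using K_closed(4)[of "x - y" "x' - y'"] by (simp add: algebra_simps)

lemma eqv_sum: "(\<And>i. i \<in> A \<Longrightarrow> f i \<approx>\<approx> g i) \<Longrightarrow> (\<Sum>i\<in>A. f i) \<approx>\<approx> (\<Sum>i\<in>A. g i)"
  by (induction A rule: infinite_finite_induct) (auto intro: eqv_add)

lemma rel_K: "x \<in> tensor_rels W c \<tau> \<Longrightarrow> x \<in> K"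
  unfolding tensor_kernel_def by (rule generate.incl)

lemma pure_add1: "p \<in> carrier F \<Longrightarrow> q \<in> carrier F \<Longrightarrow> pure (p + q) v \<approx>\<approx> pure p v + pure q v"
  unfolding eqv_def using rel_K[OF tensor_rels_I(1)[of p q v]] by (simp add: algebra_simps)

lemma pure_add2: "p \<in> carrier F \<Longrightarrow> pure p (v + v') \<approx>\<approx> pure p v + pure p v'"
  unfolding eqv_def using rel_K[OF tensor_rels_I(2)[of p v v']] by (simp add: algebra_simps)

lemma sub_letters_mem: "g \<in> W \<Longrightarrow> Grp g \<in> sub_letters W" "Vec y \<in> sub_letters W"
  by (auto simp: sub_letters_def)

lemma pure_const: "p \<in> carrier F \<Longrightarrow> pure (p * const a) v \<approx>\<approx> pure p (a *s v)"
  unfolding eqv_def using rel_K[OF tensor_rels_I(3)[of p "const a" v]]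
  by (simp add: free_alg_closed rep_act_const)

lemma pure_grp: "p \<in> carrier F \<Longrightarrow> g \<in> W \<Longrightarrow> pure (p * gen (Grp g)) v \<approx>\<approx> pure p (\<tau> g *v v)"
  unfolding eqv_def using rel_K[OF tensor_rels_I(3)[of p "gen (Grp g)" v]]
  by (simp add: gen_mem free_alg_closed(7) sub_letters_mem rep_act_gen)

lemma pure_0: "p \<in> carrier F \<Longrightarrow> pure p 0 \<approx>\<approx> 0"
  using eqv_diff[OF pure_add2[of p 0 0] eqv_refl[of "pure p 0"]] eqv_sym by simp

lemma pure_vec: "p \<in> carrier F \<Longrightarrow> pure (p * gen (Vec y)) v \<approx>\<approx> 0"
proof -
  assume p: "p \<in> carrier F"
  have "pure (p * gen (Vec y)) v \<approx>\<approx> pure p 0"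
    unfolding eqv_def using rel_K[OF tensor_rels_I(3)[of p "gen (Vec y)" v]] p
    by (simp add: gen_mem free_alg_closed(7) sub_letters_mem rep_act_gen)
  then show ?thesis using pure_0[OF p] eqv_trans by blast
qed

text \<open>
  The left action of the class of \<open>p\<close>, before passing to cosets.
\<close>

definition L :: "'n letter falg \<Rightarrow> ('n, 'k) pre_tensor \<Rightarrow> ('n, 'k) pre_tensor"
  where "L p x = frag_extend (\<lambda>(a, v). frag_of (cl p \<otimes>\<^bsub>H\<^esub> a, v)) x"

lemma L_pure: "p \<in> carrier F \<Longrightarrow> q \<in> carrier F \<Longrightarrow> L p (pure q v) = pure (p * q) v"
  by (simp add: L_def pure_def cl_ops)

lemma L_lin: "L p (x + y) = L p x + L p y" "L p (x - y) = L p x - L p y" "L p 0 = 0"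
  by (simp_all add: L_def frag_extend_add frag_extend_diff)

lemma L_sum: "L p (\<Sum>i\<in>A. f i) = (\<Sum>i\<in>A. L p (f i))"
  by (induction A rule: infinite_finite_induct) (auto simp: L_lin)

lemma L_closed: "p \<in> carrier F \<Longrightarrow> x \<in> carrier PT \<Longrightarrow> L p x \<in> carrier PT"
proof -
  assume p: "p \<in> carrier F"
  show "x \<in> carrier PT \<Longrightarrow> L p x \<in> carrier PT"
    by (induction x rule: PT_induct) (auto simp: L_lin L_pure p intro!: PT_closed pure_closed free_alg_closed)
qed

lemma L_K: "p \<in> carrier F \<Longrightarrow> x \<in> K \<Longrightarrow> L p x \<in> K"
proof -
  assume p: "p \<in> carrier F"
  show "x \<in> K \<Longrightarrow> L p x \<in> K"
  proof (induction x rule: K_induct)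
    case (rel x)
    then show ?case
    proof (cases rule: tensor_rels_cases)
      case (add1 q r v)
      then have "L p x = pure (p * q + p * r) v - pure (p * q) v - pure (p * r) v"
        by (simp add: L_lin L_pure p free_alg_closed distrib_left)
      then show ?thesis using add1 p by (simp add: rel_K tensor_rels_I free_alg_closed)
    next
      case (add2 q v v')
      then show ?thesis using p by (simp add: L_lin L_pure rel_K tensor_rels_I free_alg_closed)
    next
      case (bal q r v)
      then have "L p x = pure ((p * q) * r) v - pure (p * q) (rep_act \<tau> r v)"
        by (simp add: L_lin L_pure p free_alg_closed mult.assoc)
      then show ?thesis using bal p by (simp only: rel_K tensor_rels_I free_alg_closed)
    qed
  qed (auto simp: L_lin K_closed)
qed

lemma L_cong: "p \<in> carrier F \<Longrightarrow> x \<approx>\<approx> y \<Longrightarrow> L p x \<approx>\<approx> L p y"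
  unfolding eqv_def using L_K[of p "x - y"] by (simp add: L_lin)

lemma L_mult: "p \<in> carrier F \<Longrightarrow> q \<in> carrier F \<Longrightarrow> x \<in> carrier PT \<Longrightarrow> L (p * q) x = L p (L q x)"
proof -
  assume p: "p \<in> carrier F" and q: "q \<in> carrier F"
  show "x \<in> carrier PT \<Longrightarrow> L (p * q) x = L p (L q x)"
    by (induction x rule: PT_induct) (auto simp: L_lin L_pure p q free_alg_closed mult.assoc)
qed

lemma L_add: "p \<in> carrier F \<Longrightarrow> q \<in> carrier F \<Longrightarrow> x \<in> carrier PT \<Longrightarrow> L (p + q) x \<approx>\<approx> L p x + L q x"
proof -
  assume p: "p \<in> carrier F" and q: "q \<in> carrier F"
  show "x \<in> carrier PT \<Longrightarrow> L (p + q) x \<approx>\<approx> L p x + L q x"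
  proof (induction x rule: PT_induct)
    case (pure r v)
    then show ?case by (simp add: L_pure p q free_alg_closed distrib_right pure_add1)
  next
    case (diff x y)
    then show ?case using eqv_diff[OF diff.IH] by (simp add: L_lin algebra_simps)
  qed (auto simp: L_lin)
qed

lemma L_0: "x \<in> carrier PT \<Longrightarrow> L 0 x \<approx>\<approx> 0"
  using eqv_sym[OF eqv_diff[OF L_add[OF free_alg_closed(1) free_alg_closed(1), of x] eqv_refl[of "L 0 x"]]]
  by simp

lemma L_diff: "p \<in> carrier F \<Longrightarrow> q \<in> carrier F \<Longrightarrow> x \<in> carrier PT \<Longrightarrow> L (p - q) x \<approx>\<approx> L p x - L q x"
  using eqv_sym[OF eqv_diff[OF L_add[of "p - q" q x] eqv_refl[of "L q x"]]] by (simp add: free_alg_closed(6))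

lemma L_sum1: 
  "(\<And>i. i \<in> A \<Longrightarrow> f i \<in> carrier F) \<Longrightarrow> x \<in> carrier PT \<Longrightarrow> L (\<Sum>i\<in>A. f i) x \<approx>\<approx> (\<Sum>i\<in>A. L (f i) x)"
proof (induction A rule: infinite_finite_induct)
  case (insert a A)
  have "L (\<Sum>i\<in>insert a A. f i) x \<approx>\<approx> L (f a) x + L (\<Sum>i\<in>A. f i) x"
    using insert by (simp add: L_add free_alg_sum_closed)
  also have "\<dots> \<approx>\<approx> L (f a) x + (\<Sum>i\<in>A. L (f i) x)"
    using insert by (intro eqv_add eqv_refl) auto
  finally show ?case using insert by simp
qed (auto intro: L_0)

lemma L_J: "p - q \<in> J \<Longrightarrow> L p x = L q x"
  unfolding L_def by (simp only: cl_eqI)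

lemma L_const_pure: "p \<in> carrier F \<Longrightarrow> L (const a) (pure p v) \<approx>\<approx> pure p (a *s v)"
  by (simp add: L_pure free_alg_closed const_commute pure_const)

lemma L_const_commute: "p \<in> carrier F \<Longrightarrow> x \<in> carrier PT \<Longrightarrow> L (const a) (L p x) = L p (L (const a) x)"
  by (metis L_mult const_commute free_alg_closed(8))

text \<open>
  The defining relations of the algebra, as identities for the left action. Those that involve sums of
  algebra elements hold only up to the congruence, since additivity in the first tensor factor is one
  of the imposed relations.
\<close>

lemma rel_L:
  assumes "x \<in> carrier PT"
  shows "g \<in> W \<Longrightarrow> L (gen (Grp g)) (L (gen (Vec y)) x) = L (gen (Vec (act_h g y))) (L (gen (Grp g)) x)" (is "_ \<Longrightarrow> ?A")
    and "g \<in> W \<Longrightarrow> h \<in> dual_space \<Longrightarrow> L (gen (Grp g)) (L (gen (Cov h)) x) = L (gen (Cov (act_dual g h))) (L (gen (Grp g)) x)" (is "_ \<Longrightarrow> _ \<Longrightarrow> ?B")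
    and "h \<in> dual_space \<Longrightarrow> h' \<in> dual_space \<Longrightarrow> L (gen (Cov h)) (L (gen (Cov h')) x) = L (gen (Cov h')) (L (gen (Cov h)) x)"
    and "L (gen (Vec (y + y'))) x \<approx>\<approx> L (gen (Vec y)) x + L (gen (Vec y')) x"
    and "L (gen (Vec (a *s y))) x = L (const a) (L (gen (Vec y)) x)"
    and "h \<in> dual_space \<Longrightarrow> h' \<in> dual_space \<Longrightarrow> L (gen (Cov (\<lambda>y. h y + h' y))) x \<approx>\<approx> L (gen (Cov h)) x + L (gen (Cov h')) x"
    and "h \<in> dual_space \<Longrightarrow> L (gen (Cov (\<lambda>y. a * h y))) x = L (const a) (L (gen (Cov h)) x)"
    and "h \<in> dual_space \<Longrightarrow> L (gen (Vec y)) (L (gen (Cov h)) x) \<approx>\<approx> L (gen (Cov h)) (L (gen (Vec y)) x)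
      + (L (const (h y)) x - L (const (of_real c)) (\<Sum>s\<in>reflections W. L (const (h y - h (act_h s y))) (L (gen (Grp s)) x)))"
proof -
  note cl = gen_mem free_alg_closed(3-6,8) dual_closed
  have sm: "p - q \<in> smash_rels W \<Longrightarrow> p - q \<in> J" and ch: "p - q \<in> cherednik_rels W c \<Longrightarrow> p - q \<in> J" for p q
    using rels_J by auto
  show "L (gen (Grp g)) (L (gen (Vec y)) x) = L (gen (Vec (act_h g y))) (L (gen (Grp g)) x)" if "g \<in> W"
  proof -
    have "gen (Grp g) * gen (Vec y) - gen (Vec (act_h g y)) * gen (Grp g) \<in> smash_rels W"
      unfolding smash_rels_def using that by blast
    from L_J[OF sm[OF this], of x] show ?thesis using assms that by (simp add: cl L_mult)
  qed
  show "L (gen (Grp g)) (L (gen (Cov h)) x) = L (gen (Cov (act_dual g h))) (L (gen (Grp g)) x)"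
    if "g \<in> W" "h \<in> dual_space"
  proof -
    have "gen (Grp g) * gen (Cov h) - gen (Cov (act_dual g h)) * gen (Grp g) \<in> smash_rels W"
      unfolding smash_rels_def using that by blast
    from L_J[OF sm[OF this], of x] show ?thesis using assms that by (simp add: cl L_mult)
  qed
  show "L (gen (Cov h)) (L (gen (Cov h')) x) = L (gen (Cov h')) (L (gen (Cov h)) x)"
    if "h \<in> dual_space" "h' \<in> dual_space"
  proof -
    have "gen (Cov h) * gen (Cov h') - gen (Cov h') * gen (Cov h) \<in> cherednik_rels W c"
      unfolding cherednik_rels_def using that by blast
    from L_J[OF ch[OF this], of x] show ?thesis using assms that by (simp add: cl L_mult)
  qed
  show "L (gen (Vec (y + y'))) x \<approx>\<approx> L (gen (Vec y)) x + L (gen (Vec y')) x"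
  proof -
    have "gen (Vec (y + y')) - gen (Vec y) - gen (Vec y') \<in> smash_rels W"
      unfolding smash_rels_def by blast
    then have "gen (Vec (y + y')) - (gen (Vec y) + gen (Vec y')) \<in> smash_rels W" by (simp add: diff_diff_eq)
    from L_J[OF sm[OF this], of x] show ?thesis using L_add[of "gen (Vec y)" "gen (Vec y')" x] assms by (simp add: cl)
  qed
  show "L (gen (Vec (a *s y))) x = L (const a) (L (gen (Vec y)) x)"
  proof -
    have "gen (Vec (a *s y)) - const a * gen (Vec y) \<in> smash_rels W"
      unfolding smash_rels_def by blast
    from L_J[OF sm[OF this], of x] show ?thesis using assms by (simp add: cl L_mult)
  qed
  show "L (gen (Cov (\<lambda>y. h y + h' y))) x \<approx>\<approx> L (gen (Cov h)) x + L (gen (Cov h')) x"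
    if "h \<in> dual_space" "h' \<in> dual_space"
  proof -
    have "gen (Cov (\<lambda>y. h y + h' y)) - gen (Cov h) - gen (Cov h') \<in> smash_rels W"
      unfolding smash_rels_def using that by blast
    then have "gen (Cov (\<lambda>y. h y + h' y)) - (gen (Cov h) + gen (Cov h')) \<in> smash_rels W" by (simp add: diff_diff_eq)
    from L_J[OF sm[OF this], of x] show ?thesis using L_add[of "gen (Cov h)" "gen (Cov h')" x] assms that by (simp add: cl)
  qed
  show "L (gen (Cov (\<lambda>y. a * h y))) x = L (const a) (L (gen (Cov h)) x)" if "h \<in> dual_space"
  proof -
    have "gen (Cov (\<lambda>y. a * h y)) - const a * gen (Cov h) \<in> smash_rels W"
      unfolding smash_rels_def using that by blast
    from L_J[OF sm[OF this], of x] show ?thesis using assms that by (simp add: cl L_mult)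
  qed
  show "L (gen (Vec y)) (L (gen (Cov h)) x) \<approx>\<approx> L (gen (Cov h)) (L (gen (Vec y)) x)
      + (L (const (h y)) x - L (const (of_real c)) (\<Sum>s\<in>reflections W. L (const (h y - h (act_h s y))) (L (gen (Grp s)) x)))"
    if h: "h \<in> dual_space"
  proof -
    let ?S = "\<Sum>s\<in>reflections W. const (fst (root_pair s) y * h (snd (root_pair s))) * gen (Grp s)"
    let ?q = "const (h y) - const (complex_of_real c) * ?S"
    have "gen (Vec y) * gen (Cov h) - gen (Cov h) * gen (Vec y) - ?q \<in> cherednik_rels W c"
      unfolding cherednik_rels_def using h by blast
    then have r: "gen (Vec y) * gen (Cov h) - (gen (Cov h) * gen (Vec y) + ?q) \<in> cherednik_rels W c"
      by (simp add: diff_diff_eq)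
    have sW: "s \<in> reflections W \<Longrightarrow> s \<in> W" for s by (simp add: reflections_def)
    have S: "?S \<in> carrier F" by (intro free_alg_sum_closed cl sW)
    then have q: "?q \<in> carrier F" by (intro cl)
    have "L (gen (Vec y)) (L (gen (Cov h)) x) = L (gen (Cov h) * gen (Vec y) + ?q) x"
      using L_J[OF ch[OF r], of x] h q assms by (simp add: cl L_mult)
    also have "\<dots> \<approx>\<approx> L (gen (Cov h)) (L (gen (Vec y)) x) + L ?q x"
      using L_add[of "gen (Cov h) * gen (Vec y)" ?q x] q h assms by (simp add: cl L_mult)
    also have "\<dots> \<approx>\<approx> L (gen (Cov h)) (L (gen (Vec y)) x) + (L (const (h y)) x - L (const (of_real c)) (L ?S x))"
      using L_diff[of "const (h y)" "const (of_real c) * ?S" x] S assms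
      by (intro eqv_add eqv_refl) (simp add: cl L_mult)
    also have "\<dots> \<approx>\<approx> L (gen (Cov h)) (L (gen (Vec y)) x)
      + (L (const (h y)) x - L (const (of_real c)) (\<Sum>s\<in>reflections W. L (const (h y - h (act_h s y))) (L (gen (Grp s)) x)))"
    proof (intro eqv_add eqv_diff eqv_refl L_cong cl)
      have "L ?S x \<approx>\<approx> (\<Sum>s\<in>reflections W. L (const (fst (root_pair s) y * h (snd (root_pair s))) * gen (Grp s)) x)"
        by (intro L_sum1 cl sW assms)
      also have "\<dots> = (\<Sum>s\<in>reflections W. L (const (h y - h (act_h s y))) (L (gen (Grp s)) x))"
        by (rule sum.cong) (simp_all add: root[OF _ h] L_mult cl sW assms)
      finally show "L ?S x \<approx>\<approx> (\<Sum>s\<in>reflections W. L (const (h y - h (act_h s y))) (L (gen (Grp s)) x))" .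
    qed
    finally show ?thesis .
  qed
qed

section \<open>From tensors to the standard module and back\<close>

definition coord :: "'n \<Rightarrow> 'n functional" where "coord i = (\<lambda>y. y $ i)"

lemma coord_dual: "coord i \<in> dual_space"
  by (rule dualI) (auto simp: coord_def)

abbreviation "LX i \<equiv> L (gen (Cov (coord i)))"
abbreviation "LC a \<equiv> L (const a)"

lemmas F_closed = free_alg_closed(1-6,8) gen_mem coord_dual

text \<open>
  The part of a tensor with at most \<open>n\<close> letters, mapped to the standard module by reading the word as a
  product of coordinates. The recursion matches the one for \<open>lower\<close>, which makes equivariance an
  induction on \<open>n\<close>.
\<close>

primrec frag_upto :: "nat \<Rightarrow> ('n, 'k) tens \<Rightarrow> ('n, 'k) pre_tensor" where
  "frag_upto 0 u = pure 1 (u [])"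
| "frag_upto (Suc n) u = pure 1 (u []) + (\<Sum>i\<in>UNIV. LX i (frag_upto n (cut i u)))"

lemma frag_upto_closed: "frag_upto n u \<in> carrier PT"
  by (induction n arbitrary: u) (auto intro!: PT_closed PT_sum_closed L_closed pure_closed F_closed)

lemma frag_upto_add: "frag_upto n (u + v) \<approx>\<approx> frag_upto n u + frag_upto n v"
proof (induction n arbitrary: u v)
  case 0
  show ?case by (simp add: pure_add2 F_closed pointwise)
next
  case (Suc n)
  have "frag_upto (Suc n) (u + v) \<approx>\<approx> (pure 1 (u []) + pure 1 (v [])) + (\<Sum>i\<in>UNIV. LX i (frag_upto n (cut i u)) + LX i (frag_upto n (cut i v)))"
    unfolding frag_upto.simps cut_rules(1) L_lin(1)[symmetric] plus_fun_apply[of u v "[]"]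
    by (intro eqv_add eqv_sum pure_add2 L_cong Suc.IH F_closed)
  also have "\<dots> = frag_upto (Suc n) u + frag_upto (Suc n) v"
    by (simp add: sum.distrib algebra_simps)
  finally show ?case .
qed

lemma frag_upto_scl: "frag_upto n (scl a u) \<approx>\<approx> LC a (frag_upto n u)"
proof (induction n arbitrary: u)
  case 0
  show ?case by (simp add: eqv_sym[OF L_const_pure] F_closed pointwise)
next
  case (Suc n)
  have "frag_upto (Suc n) (scl a u) \<approx>\<approx> LC a (pure 1 (u [])) + (\<Sum>i\<in>UNIV. LX i (LC a (frag_upto n (cut i u))))"
    unfolding frag_upto.simps cut_rules(2) scl_apply[of a u "[]"]
    by (intro eqv_add eqv_sum eqv_sym[OF L_const_pure] L_cong Suc.IH F_closed)
  also have "\<dots> = LC a (frag_upto (Suc n) u)"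
    by (simp add: L_lin L_sum L_const_commute F_closed frag_upto_closed)
  finally show ?case .
qed

lemma frag_upto_0: "frag_upto n 0 \<approx>\<approx> 0"
  using eqv_sym[OF eqv_diff[OF frag_upto_add[of n 0 0] eqv_refl[of "frag_upto n 0"]]] by simp

lemma frag_upto_diff: "frag_upto n (u - v) \<approx>\<approx> frag_upto n u - frag_upto n v"
  using eqv_sym[OF eqv_diff[OF frag_upto_add[of n "u - v" v] eqv_refl[of "frag_upto n v"]]] by simp

lemma frag_upto_sum: "frag_upto n (\<Sum>i\<in>A. f i) \<approx>\<approx> (\<Sum>i\<in>A. frag_upto n (f i))"
proof (induction A rule: infinite_finite_induct)
  case (insert a A)
  have "frag_upto n (f a + (\<Sum>i\<in>A. f i)) \<approx>\<approx> frag_upto n (f a) + (\<Sum>i\<in>A. frag_upto n (f i))"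
    using frag_upto_add eqv_add[OF eqv_refl insert.IH] eqv_trans by blast
  then show ?case using insert by simp
qed (auto intro: frag_upto_0)

lemma LX_0: "x \<approx>\<approx> 0 \<Longrightarrow> LX i x \<approx>\<approx> 0"
  using L_cong[of "gen (Cov (coord i))" x 0] by (simp add: F_closed L_lin)

lemma frag_upto_emb: "frag_upto n (emb v) \<approx>\<approx> pure 1 v"
proof (cases n)
  case (Suc m)
  have "frag_upto (Suc m) (emb v) \<approx>\<approx> pure 1 v + (\<Sum>i::'n\<in>UNIV. 0)"
    unfolding frag_upto.simps cut_emb emb_simps by (intro eqv_add eqv_sum eqv_refl LX_0 frag_upto_0)
  then show ?thesis using Suc by simp
qed simp

lemma frag_upto_mono: "supp_le n u \<Longrightarrow> n \<le> m \<Longrightarrow> frag_upto m u \<approx>\<approx> frag_upto n u"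
proof (induction n arbitrary: u m)
  case 0
  show ?case using frag_upto_emb[of m "u []"] unfolding frag_upto.simps supp_le_0[OF 0(1), symmetric] .
next
  case (Suc n)
  then obtain k where k: "m = Suc k" "n \<le> k" by (cases m) auto
  show ?case unfolding k frag_upto.simps
    by (intro eqv_add eqv_sum eqv_refl L_cong F_closed Suc.IH supp_le_cut Suc.prems k)
qed

lemma frag_upto_raise: "frag_upto (Suc n) (raise i u) \<approx>\<approx> LX i (frag_upto n u)"
proof -
  have "frag_upto (Suc n) (raise i u) = pure 1 0 + (\<Sum>j\<in>UNIV. LX j (frag_upto n (if i = j then u else 0)))"
    by simp
  also have "\<dots> \<approx>\<approx> 0 + (\<Sum>j\<in>UNIV. if i = j then LX j (frag_upto n u) else 0)"
    by (intro eqv_add eqv_sum pure_0 F_closed) (auto intro: LX_0 frag_upto_0)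
  finally show ?thesis by simp
qed

lemma Cov_expand:
  assumes h: "h \<in> dual_space" and x: "x \<in> carrier PT"
  shows "L (gen (Cov h)) x \<approx>\<approx> (\<Sum>j\<in>UNIV. LC (h (axis j 1)) (LX j x))"
proof -
  have *: "(\<lambda>y. \<Sum>j\<in>A. h (axis j 1) * y $ j) \<in> dual_space \<and>
       L (gen (Cov (\<lambda>y. \<Sum>j\<in>A. h (axis j 1) * y $ j))) x \<approx>\<approx> (\<Sum>j\<in>A. LC (h (axis j 1)) (LX j x))"
    if "finite A" for A using that
  proof (induction A)
    case (insert a A)
    let ?g = "\<lambda>y. \<Sum>j\<in>A. h (axis j 1) * y $ j"
    let ?h = "\<lambda>y. h (axis a 1) * coord a y"
    have d: "?g \<in> dual_space" "?h \<in> dual_space" using insert coord_dual dual_closed(2) by auto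
    have e: "(\<lambda>y. \<Sum>j\<in>insert a A. h (axis j 1) * y $ j) = (\<lambda>y. ?h y + ?g y)"
      using insert by (simp add: coord_def)
    have "L (gen (Cov (\<lambda>y. ?h y + ?g y))) x \<approx>\<approx> L (gen (Cov ?h)) x + L (gen (Cov ?g)) x"
      by (rule rel_L(6)[OF x d(2,1)])
    also have "\<dots> \<approx>\<approx> LC (h (axis a 1)) (LX a x) + (\<Sum>j\<in>A. LC (h (axis j 1)) (LX j x))"
      using insert by (intro eqv_add) (simp_all add: rel_L(7)[OF x coord_dual])
    finally show ?case unfolding e using dual_closed(1)[OF d(2,1)] insert by simp
  next
    case empty
    have z: "(\<lambda>y. 0 * coord undefined y) = (\<lambda>y. 0 :: complex)" by simp
    have "L (gen (Cov (\<lambda>y. 0 * coord undefined y))) x = LC 0 (LX undefined x)"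
      by (rule rel_L(7)[OF x coord_dual])
    then have "L (gen (Cov (\<lambda>y. 0))) x \<approx>\<approx> 0"
      using L_0[of "LX undefined x"] x unfolding z by (simp add: const_def L_closed F_closed)
    then show ?case using dual_closed(2)[OF coord_dual, of 0] by simp
  qed
  have "(\<lambda>y. \<Sum>j\<in>UNIV. h (axis j 1) * y $ j) = h"
  proof
    fix y show "(\<Sum>j\<in>UNIV. h (axis j 1) * y $ j) = h y"
      unfolding dual_expand[OF h, of y] by (simp add: mult.commute)
  qed
  then show ?thesis using *[of UNIV] by simp
qed

lemma Vec_expand:
  assumes x: "x \<in> carrier PT"
  shows "L (gen (Vec y)) x \<approx>\<approx> (\<Sum>j\<in>UNIV. LC (y $ j) (L (gen (Vec (axis j 1))) x))"
proof -
  have *: "L (gen (Vec (\<Sum>j\<in>A. y $ j *s axis j 1))) x \<approx>\<approx> (\<Sum>j\<in>A. LC (y $ j) (L (gen (Vec (axis j 1))) x))"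
    if "finite A" for A using that
  proof (induction A)
    case (insert a A)
    have "L (gen (Vec (y $ a *s axis a 1 + (\<Sum>j\<in>A. y $ j *s axis j 1)))) x
      \<approx>\<approx> L (gen (Vec (y $ a *s axis a 1))) x + L (gen (Vec (\<Sum>j\<in>A. y $ j *s axis j 1))) x"
      by (rule rel_L(4)[OF x])
    also have "\<dots> \<approx>\<approx> LC (y $ a) (L (gen (Vec (axis a 1))) x) + (\<Sum>j\<in>A. LC (y $ j) (L (gen (Vec (axis j 1))) x))"
      using insert by (intro eqv_add) (simp_all add: rel_L(5)[OF x])
    finally show ?case using insert by simp
  next
    case empty
    have "L (gen (Vec (0 *s 0))) x = LC 0 (L (gen (Vec 0)) x)"
      by (rule rel_L(5)[OF x])
    then show ?case
      using L_0[of "L (gen (Vec 0)) x"] x by (simp add: const_def L_closed F_closed)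
  qed
  show ?thesis using *[of UNIV] by (simp add: basis_expansion)
qed

text \<open>
  Both sides move \<open>g\<close> past the first letter in the same way.
\<close>

lemma frag_upto_rho:
  assumes g: "g \<in> W"
  shows "frag_upto n (rho g u) \<approx>\<approx> L (gen (Grp g)) (frag_upto n u)"
proof (induction n arbitrary: u)
  case 0
  show ?case using eqv_sym[OF pure_grp[OF free_alg_closed(2) g, of "u []"]]
    by (simp add: L_pure F_closed g)
next
  case (Suc n)
  let ?g = "L (gen (Grp g))"
  have "frag_upto (Suc n) (rho g u) = pure 1 (\<tau> g *v u []) + (\<Sum>i\<in>UNIV. LX i (frag_upto n (\<Sum>j\<in>UNIV. scl (en g i j) (rho g (cut j u)))))"
    by (simp add: cut_rho)
  also have "\<dots> \<approx>\<approx> ?g (pure 1 (u [])) + (\<Sum>i\<in>UNIV. LX i (\<Sum>j\<in>UNIV. LC (en g i j) (?g (frag_upto n (cut j u)))))"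
  proof (intro eqv_add eqv_sum L_cong F_closed)
    show "pure 1 (\<tau> g *v u []) \<approx>\<approx> ?g (pure 1 (u []))"
      using eqv_sym[OF pure_grp[OF free_alg_closed(2) g, of "u []"]] by (simp add: L_pure F_closed g)
    show "frag_upto n (\<Sum>j\<in>UNIV. scl (en g i j) (rho g (cut j u))) \<approx>\<approx> (\<Sum>j\<in>UNIV. LC (en g i j) (?g (frag_upto n (cut j u))))" for i
      by (intro eqv_trans[OF frag_upto_sum] eqv_sum eqv_trans[OF frag_upto_scl] L_cong Suc.IH F_closed)
  qed
  also have "\<dots> = ?g (pure 1 (u [])) + (\<Sum>j\<in>UNIV. \<Sum>i\<in>UNIV. LC (en g i j) (LX i (?g (frag_upto n (cut j u)))))"
    by (subst sum.swap) (simp add: L_sum L_const_commute F_closed L_closed frag_upto_closed g)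
  also have "\<dots> \<approx>\<approx> ?g (pure 1 (u [])) + (\<Sum>j\<in>UNIV. L (gen (Cov (act_dual g (coord j)))) (?g (frag_upto n (cut j u))))"
  proof (rule eqv_add[OF eqv_refl], rule eqv_sum, rule eqv_sym)
    fix j
    have "act_dual g (coord j) (axis i 1) = en g i j" for i
      unfolding act_dual_axis[OF g coord_dual] by (simp add: coord_def axis_def if_distrib[of "\<lambda>a. _ * a"] sum.delta cong: if_cong)
    then show "L (gen (Cov (act_dual g (coord j)))) (?g (frag_upto n (cut j u))) \<approx>\<approx> (\<Sum>i\<in>UNIV. LC (en g i j) (LX i (?g (frag_upto n (cut j u)))))"
      using Cov_expand[OF dual_closed(3)[OF coord_dual], of "?g (frag_upto n (cut j u))" g j]
      by (simp add: L_closed F_closed frag_upto_closed g)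
  qed
  also have "\<dots> = ?g (frag_upto (Suc n) u)"
    by (simp add: L_lin L_sum rel_L(2) coord_dual g frag_upto_closed)
  finally show ?case .
qed

lemma frag_upto_bracket:
  "frag_upto n (bracket i j u) \<approx>\<approx> LC (kd i j) (frag_upto n u)
    - LC (of_real c) (\<Sum>s\<in>reflections W. LC (kd i j - en s j i) (L (gen (Grp s)) (frag_upto n u)))"
  unfolding bracket_def
  by (intro eqv_trans[OF frag_upto_diff] eqv_diff eqv_trans[OF frag_upto_scl] L_cong eqv_trans[OF frag_upto_sum] eqv_sum frag_upto_scl frag_upto_rho F_closed eqv_refl)
     (auto simp: reflections_def)

text \<open>
  Both sides move \<open>y_i\<close> past the first letter by the same bracket; at the end, \<open>\<hh>\<close> kills \<open>1 \<otimes> v\<close>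
  in either module.
\<close>

lemma frag_upto_lower:
  "supp_le n u \<Longrightarrow> frag_upto n (lower i u) \<approx>\<approx> L (gen (Vec (axis i 1))) (frag_upto n u)"
proof (induction n arbitrary: u)
  case 0
  have "lower i u = lower i (emb (u []))" by (rule arg_cong[OF supp_le_0[OF 0]])
  then have "frag_upto 0 (lower i u) \<approx>\<approx> 0" by (simp only: lower_emb frag_upto_0)
  also have "0 \<approx>\<approx> L (gen (Vec (axis i 1))) (frag_upto 0 u)"
    using eqv_sym[OF pure_vec[of 1]] by (simp add: L_pure F_closed)
  finally show ?case .
next
  case (Suc n)
  let ?y = "L (gen (Vec (axis i 1)))"
  have s: "supp_le n (cut j u)" for j using Suc.prems by (rule supp_le_cut)
  have "lower i u = (\<Sum>j\<in>UNIV. raise j (lower i (cut j u)) + bracket i j (cut j u))"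
    using arg_cong[OF letter_decomp[of u], of "lower i"] by (simp only: lower_rules lower_emb lower_raise add_0)
  then have "frag_upto (Suc n) (lower i u) \<approx>\<approx> (\<Sum>j\<in>UNIV. frag_upto (Suc n) (raise j (lower i (cut j u)) + bracket i j (cut j u)))"
    by (simp only: frag_upto_sum)
  also have "\<dots> \<approx>\<approx> (\<Sum>j\<in>UNIV. LX j (?y (frag_upto n (cut j u))) + (LC (kd i j) (frag_upto n (cut j u))
    - LC (of_real c) (\<Sum>s\<in>reflections W. LC (kd i j - en s j i) (L (gen (Grp s)) (frag_upto n (cut j u))))))"
  proof (intro eqv_sum eqv_trans[OF frag_upto_add] eqv_add)
    fix j
    show "frag_upto (Suc n) (raise j (lower i (cut j u))) \<approx>\<approx> LX j (?y (frag_upto n (cut j u)))"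
      by (intro eqv_trans[OF frag_upto_raise] L_cong F_closed Suc.IH s)
    have "frag_upto (Suc n) (bracket i j (cut j u)) \<approx>\<approx> frag_upto n (bracket i j (cut j u))"
      by (rule frag_upto_mono) (auto intro: supp_le_bracket s)
    also have "\<dots> \<approx>\<approx> LC (kd i j) (frag_upto n (cut j u))
       - LC (of_real c) (\<Sum>s\<in>reflections W. LC (kd i j - en s j i) (L (gen (Grp s)) (frag_upto n (cut j u))))"
      by (rule frag_upto_bracket)
    finally show "frag_upto (Suc n) (bracket i j (cut j u)) \<approx>\<approx> LC (kd i j) (frag_upto n (cut j u))
       - LC (of_real c) (\<Sum>s\<in>reflections W. LC (kd i j - en s j i) (L (gen (Grp s)) (frag_upto n (cut j u))))" .
  qed
  also have "\<dots> \<approx>\<approx> (\<Sum>j\<in>UNIV. ?y (LX j (frag_upto n (cut j u))))"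
  proof (rule eqv_sum, rule eqv_sym)
    fix j
    have 1: "coord j (axis i 1) = kd i j" by (simp add: coord_def axis_def)
    have 2: "coord j (act_h s (axis i 1)) = en s j i" for s
      by (simp add: coord_def act_h_nth axis_def if_distrib[of "\<lambda>a. _ * a"] sum.delta cong: if_cong)
    show "?y (LX j (frag_upto n (cut j u))) \<approx>\<approx> LX j (?y (frag_upto n (cut j u))) + (LC (kd i j) (frag_upto n (cut j u))
      - LC (of_real c) (\<Sum>s\<in>reflections W. LC (kd i j - en s j i) (L (gen (Grp s)) (frag_upto n (cut j u)))))"
      using rel_L(8)[OF frag_upto_closed[of n "cut j u"] coord_dual[of j], of "axis i 1"] unfolding 1 2 .
  qed
  also have "\<dots> = 0 + \<dots>" by simp
  also have "\<dots> \<approx>\<approx> ?y (pure 1 (u [])) + (\<Sum>j\<in>UNIV. ?y (LX j (frag_upto n (cut j u))))"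
    using eqv_sym[OF pure_vec[of 1]] by (intro eqv_add eqv_refl) (simp add: L_pure F_closed)
  also have "\<dots> = ?y (frag_upto (Suc n) u)"
    by (simp add: L_lin L_sum)
  finally show ?case .
qed

text \<open>
  For a tensor of finite support the truncation does not matter, as long as it is long enough.
\<close>

definition frag_of_tens :: "('n, 'k) tens \<Rightarrow> ('n, 'k) pre_tensor"
  where "frag_of_tens u = frag_upto (LEAST n. supp_le n u) u"

lemma frag_of_tens_eqv: "supp_le n u \<Longrightarrow> frag_of_tens u \<approx>\<approx> frag_upto n u"
  unfolding frag_of_tens_def by (rule eqv_sym, rule frag_upto_mono) (auto intro: LeastI Least_le)

lemma frag_of_tens_closed: "frag_of_tens u \<in> carrier PT"
  by (simp add: frag_of_tens_def frag_upto_closed)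

lemma frag_of_tens_emb: "frag_of_tens (emb v) \<approx>\<approx> pure 1 v"
  using frag_of_tens_eqv[of 0 "emb v"] by (simp add: supp_le_rules)

lemma frag_of_tens_add: 
  assumes "fsupp u" "fsupp v"
  shows "frag_of_tens (u + v) \<approx>\<approx> frag_of_tens u + frag_of_tens v"
proof -
  obtain m n where "supp_le m u" "supp_le n v" using assms by (auto simp: fsupp_def)
  then have s: "supp_le (max m n) u" "supp_le (max m n) v" by (auto intro: supp_le_mono)
  have "frag_of_tens (u + v) \<approx>\<approx> frag_upto (max m n) (u + v)" by (intro frag_of_tens_eqv supp_le_rules s)
  also have "\<dots> \<approx>\<approx> frag_upto (max m n) u + frag_upto (max m n) v" by (rule frag_upto_add)
  also have "\<dots> \<approx>\<approx> frag_of_tens u + frag_of_tens v" by (intro eqv_add eqv_sym[OF frag_of_tens_eqv] s)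
  finally show ?thesis .
qed

lemma frag_of_tens_scl: 
  assumes "fsupp u"
  shows "frag_of_tens (scl a u) \<approx>\<approx> LC a (frag_of_tens u)"
proof -
  obtain n where s: "supp_le n u" using assms by (auto simp: fsupp_def)
  have "frag_of_tens (scl a u) \<approx>\<approx> frag_upto n (scl a u)" by (intro frag_of_tens_eqv supp_le_rules s)
  also have "\<dots> \<approx>\<approx> LC a (frag_upto n u)" by (rule frag_upto_scl)
  also have "\<dots> \<approx>\<approx> LC a (frag_of_tens u)" by (intro L_cong F_closed eqv_sym[OF frag_of_tens_eqv] s)
  finally show ?thesis .
qed

lemma frag_of_tens_0: "frag_of_tens 0 \<approx>\<approx> 0"
  using eqv_trans[OF frag_of_tens_eqv[OF supp_le_rules(1)] frag_upto_0] .

lemma frag_of_tens_diff: "fsupp u \<Longrightarrow> fsupp v \<Longrightarrow> frag_of_tens (u - v) \<approx>\<approx> frag_of_tens u - frag_of_tens v"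
  using eqv_sym[OF eqv_diff[OF frag_of_tens_add[of "u - v" v] eqv_refl[of "frag_of_tens v"]]] by (simp add: fsupp_rules)

lemma frag_of_tens_sum: "(\<And>i. i \<in> A \<Longrightarrow> fsupp (f i)) \<Longrightarrow> frag_of_tens (\<Sum>i\<in>A. f i) \<approx>\<approx> (\<Sum>i\<in>A. frag_of_tens (f i))"
proof (induction A rule: infinite_finite_induct)
  case (insert a A)
  have "frag_of_tens (f a + (\<Sum>i\<in>A. f i)) \<approx>\<approx> frag_of_tens (f a) + frag_of_tens (\<Sum>i\<in>A. f i)"
    using insert by (intro frag_of_tens_add fsupp_sum) auto
  also have "\<dots> \<approx>\<approx> frag_of_tens (f a) + (\<Sum>i\<in>A. frag_of_tens (f i))"
    using insert by (intro eqv_add eqv_refl) auto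
  finally show ?case using insert by simp
qed (auto intro: frag_of_tens_0)

lemma frag_of_tens_letter_op:
  assumes g: "g \<in> all_letters W" and u: "fsupp u"
  shows "frag_of_tens (letter_op g u) \<approx>\<approx> L (gen g) (frag_of_tens u)"
proof -
  obtain n where s: "supp_le n u" using u by (auto simp: fsupp_def)
  show ?thesis
  proof (cases g)
    case (Grp w)
    then have w: "w \<in> W" using g by (auto simp: all_letters_def)
    have "frag_of_tens (rho w u) \<approx>\<approx> frag_upto n (rho w u)" by (intro frag_of_tens_eqv supp_le_rho s)
    also have "\<dots> \<approx>\<approx> L (gen (Grp w)) (frag_upto n u)" by (rule frag_upto_rho[OF w])
    also have "\<dots> \<approx>\<approx> L (gen (Grp w)) (frag_of_tens u)" by (intro L_cong F_closed w eqv_sym[OF frag_of_tens_eqv] s)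
    finally show ?thesis using Grp by simp
  next
    case (Vec y)
    have y: "frag_of_tens (lower i u) \<approx>\<approx> L (gen (Vec (axis i 1))) (frag_of_tens u)" for i
    proof -
      have "frag_of_tens (lower i u) \<approx>\<approx> frag_upto n (lower i u)" by (intro frag_of_tens_eqv supp_le_lower s)
      also have "\<dots> \<approx>\<approx> L (gen (Vec (axis i 1))) (frag_upto n u)" by (rule frag_upto_lower[OF s])
      also have "\<dots> \<approx>\<approx> L (gen (Vec (axis i 1))) (frag_of_tens u)" by (intro L_cong F_closed eqv_sym[OF frag_of_tens_eqv] s)
      finally show ?thesis .
    qed
    have "frag_of_tens (letter_op (Vec y) u) \<approx>\<approx> (\<Sum>i\<in>UNIV. LC (y $ i) (L (gen (Vec (axis i 1))) (frag_of_tens u)))"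
      unfolding letter_op.simps
      by (intro eqv_trans[OF frag_of_tens_sum] eqv_sum eqv_trans[OF frag_of_tens_scl] L_cong F_closed y fsupp_rules fsupp_ops u)
    also have "\<dots> \<approx>\<approx> L (gen (Vec y)) (frag_of_tens u)" by (rule eqv_sym[OF Vec_expand[OF frag_of_tens_closed]])
    finally show ?thesis using Vec by simp
  next
    case (Cov h)
    then have h: "h \<in> dual_space" using g by (auto simp: all_letters_def)
    have x: "frag_of_tens (raise i u) \<approx>\<approx> LX i (frag_of_tens u)" for i
    proof -
      have "frag_of_tens (raise i u) \<approx>\<approx> frag_upto (Suc n) (raise i u)" by (intro frag_of_tens_eqv supp_le_raise s)
      also have "\<dots> \<approx>\<approx> LX i (frag_upto n u)" by (rule frag_upto_raise)
      also have "\<dots> \<approx>\<approx> LX i (frag_of_tens u)" by (intro L_cong F_closed eqv_sym[OF frag_of_tens_eqv] s)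
      finally show ?thesis .
    qed
    have "frag_of_tens (letter_op (Cov h) u) \<approx>\<approx> (\<Sum>i\<in>UNIV. LC (h (axis i 1)) (LX i (frag_of_tens u)))"
      unfolding letter_op.simps
      by (intro eqv_trans[OF frag_of_tens_sum] eqv_sum eqv_trans[OF frag_of_tens_scl] L_cong F_closed x fsupp_rules fsupp_ops u)
    also have "\<dots> \<approx>\<approx> L (gen (Cov h)) (frag_of_tens u)" by (rule eqv_sym[OF Cov_expand[OF h frag_of_tens_closed]])
    finally show ?thesis using Cov by simp
  qed
qed

lemma single_Cons:
  "Poly_Mapping.single (Word (g # ws)) a = gen g * Poly_Mapping.single (Word ws) a"
  by (simp add: gen_def mult_single plus_word_def)

lemma frag_of_tens_act:
  assumes p: "p \<in> carrier F" and u: "fsupp u"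
  shows "frag_of_tens (act p u) \<approx>\<approx> L p (frag_of_tens u)"
proof -
  have w: "Poly_Mapping.single (Word ws) a \<in> carrier F \<and> frag_of_tens (act (Poly_Mapping.single (Word ws) a) u) \<approx>\<approx> L (Poly_Mapping.single (Word ws) a) (frag_of_tens u)"
    if "set ws \<subseteq> all_letters W" for ws a
    using that
  proof (induction ws)
    case Nil
    have "Poly_Mapping.single (Word []) a = (const a :: 'n letter falg)" by (simp add: const_def zero_word_def)
    then show ?case by (simp add: falg_act_const frag_of_tens_scl u F_closed)
  next
    case (Cons g ws)
    let ?p = "Poly_Mapping.single (Word ws) a"
    have IH: "?p \<in> carrier F" "frag_of_tens (act ?p u) \<approx>\<approx> L ?p (frag_of_tens u)" using Cons by auto
    have g: "g \<in> all_letters W" "gen g \<in> carrier F" using Cons.prems free_alg_closed(7) by auto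
    have "frag_of_tens (act (gen g * ?p) u) = frag_of_tens (letter_op g (act ?p u))" by (simp add: act_mult falg_act_gen)
    also have "\<dots> \<approx>\<approx> L (gen g) (frag_of_tens (act ?p u))" by (intro frag_of_tens_letter_op g act_preserve(1) IH u)
    also have "\<dots> \<approx>\<approx> L (gen g) (L ?p (frag_of_tens u))" by (intro L_cong g IH)
    also have "\<dots> = L (gen g * ?p) (frag_of_tens u)" by (simp add: L_mult g IH frag_of_tens_closed)
    finally show ?case unfolding single_Cons using free_alg_closed(4)[OF g(2) IH(1)] by simp
  qed
  have "p \<in> carrier F \<and> frag_of_tens (act p u) \<approx>\<approx> L p (frag_of_tens u)"
    using p unfolding carrier_free_alg
  proof (induction p rule: falg_induct)
    case zero
    then show ?case using eqv_trans[OF frag_of_tens_0 eqv_sym[OF L_0[OF frag_of_tens_closed]]] by (simp add: falg_act_simps)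
  next
    case (single v a)
    then show ?case using w[of "letters v" a] by (simp add: carrier_free_alg)
  next
    case (add p q)
    then have pq: "p \<in> carrier F" "q \<in> carrier F" by (simp_all add: carrier_free_alg)
    have "frag_of_tens (act (p + q) u) \<approx>\<approx> frag_of_tens (act p u) + frag_of_tens (act q u)"
      unfolding falg_act_add by (intro frag_of_tens_add act_preserve(1) pq u)
    also have "\<dots> \<approx>\<approx> L p (frag_of_tens u) + L q (frag_of_tens u)" using add by (intro eqv_add) auto
    also have "\<dots> \<approx>\<approx> L (p + q) (frag_of_tens u)" by (rule eqv_sym[OF L_add[OF pq frag_of_tens_closed]])
    finally show ?case using free_alg_closed(3)[OF pq] by (simp add: carrier_free_alg)
  qed
  then show ?thesis ..
qed

text \<open>
  The image is closed under the algebra by equivariance, and the algebra generates the standard module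
  from \<open>1 \<otimes> \<tau>\<close>.
\<close>

lemma frag_of_tens_surj: 
  assumes "x \<in> carrier PT"
  shows "\<exists>u. fsupp u \<and> x \<approx>\<approx> frag_of_tens u"
  using assms
proof (induction x rule: PT_induct)
  case zero then show ?case using eqv_sym[OF frag_of_tens_0] fsupp_rules(1) by blast
next
  case (pure p v)
  have "pure p v = L p (pure 1 v)" using pure by (simp add: L_pure F_closed)
  also have "\<dots> \<approx>\<approx> L p (frag_of_tens (emb v))" by (intro L_cong pure eqv_sym[OF frag_of_tens_emb])
  also have "\<dots> \<approx>\<approx> frag_of_tens (act p (emb v))" by (intro eqv_sym[OF frag_of_tens_act] pure fsupp_rules)
  finally show ?case using act_preserve(1)[OF pure fsupp_rules(5)] by blast
next
  case (diff x y)
  then obtain u v where uv: "fsupp u" "x \<approx>\<approx> frag_of_tens u" "fsupp v" "y \<approx>\<approx> frag_of_tens v" by blast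
  have "x - y \<approx>\<approx> frag_of_tens u - frag_of_tens v" by (intro eqv_diff uv)
  also have "\<dots> \<approx>\<approx> frag_of_tens (u - v)" by (intro eqv_sym[OF frag_of_tens_diff] uv)
  finally show ?case using uv fsupp_rules(3) by blast
qed

definition coset_rep :: "'n letter falg set \<Rightarrow> 'n letter falg"
  where "coset_rep a = (SOME p. p \<in> carrier F \<and> cl p = a)"

lemma coset_rep_cl: "p \<in> carrier F \<Longrightarrow> coset_rep (cl p) \<in> carrier F \<and> cl (coset_rep (cl p)) = cl p"
  unfolding coset_rep_def by (rule someI[of _ p]) simp

lemma radical_coset_rep: "p \<in> carrier F \<Longrightarrow> radical (act (coset_rep (cl p)) u - act p u)"
  using J_radical[OF cl_eqD[of "coset_rep (cl p)" p], of u] coset_rep_cl[of p] by (simp add: falg_act_diff)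

text \<open>
  The map in the opposite direction lets a representative of the algebra element act on \<open>1 \<otimes> v\<close>. It is
  well defined modulo the radical only.
\<close>

definition tens_of_frag :: "('n, 'k) pre_tensor \<Rightarrow> ('n, 'k) tens"
  where "tens_of_frag x = (\<Sum>q\<in>Poly_Mapping.keys x. scl (of_int (Poly_Mapping.lookup x q)) (act (coset_rep (fst q)) (emb (snd q))))"

lemma tens_of_frag_add: "tens_of_frag (x + y) = tens_of_frag x + tens_of_frag y"
proof -
  let ?A = "Poly_Mapping.keys x \<union> Poly_Mapping.keys y"
  have "tens_of_frag z = (\<Sum>q\<in>?A. scl (of_int (Poly_Mapping.lookup z q)) (act (coset_rep (fst q)) (emb (snd q))))"
    if "Poly_Mapping.keys z \<subseteq> ?A" for z
    unfolding tens_of_frag_def by (rule sum.mono_neutral_left) (use that in \<open>auto simp: in_keys_iff\<close>)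
  then show ?thesis using keys_add[of x y]
    by (simp add: lookup_add tm.scale_left_distrib sum.distrib)
qed

lemma tens_of_frag_0: "tens_of_frag 0 = 0"
  by (simp add: tens_of_frag_def)

lemma tens_of_frag_diff: "tens_of_frag (x - y) = tens_of_frag x - tens_of_frag y"
  using tens_of_frag_add[of "x - y" y] by (simp add: algebra_simps)

lemma tens_of_frag_pure: "tens_of_frag (pure p v) = act (coset_rep (cl p)) (emb v)"
  by (simp add: tens_of_frag_def pure_def keys_frag_of)

lemma tens_of_frag_pure_radical: "p \<in> carrier F \<Longrightarrow> radical (tens_of_frag (pure p v) - act p (emb v))"
  unfolding tens_of_frag_pure by (rule radical_coset_rep)

text \<open>
  On \<open>1 \<otimes> \<tau>\<close> the letters from \<open>W\<close> and \<open>\<hh>\<close> act as they do on \<open>\<tau>\<close>; this makes the balancing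
  relation hold.
\<close>

lemma act_emb:
  assumes "q \<in> carrier (free_alg (sub_letters W))"
  shows "act q (emb v) = emb (rep_act \<tau> q v)"
proof -
  have f: "foldr letter_op ws (emb v) = emb (foldr (letter_act \<tau>) ws v)" if "set ws \<subseteq> sub_letters W" for ws
    using that
    by (induction ws) (auto simp: sub_letters_def rho_emb lower_emb emb_0)
  have "emb (\<Sum>u\<in>A. f u) = (\<Sum>u\<in>A. emb (f u) :: ('n, 'k) tens)" for A and f :: "'n letter word \<Rightarrow> complex ^ 'k"
    by (induction A rule: infinite_finite_induct) (auto simp: emb_0 emb_add)
  then show ?thesis using assms unfolding carrier_free_alg falg_act_def rep_act_def
    by (auto simp: emb_scl f subset_iff intro!: sum.cong)
qed

lemma radical_trans: "radical (x - y) \<Longrightarrow> radical (y - z) \<Longrightarrow> radical (x - z)"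
  using radical_rules(2)[of "x - y" "y - z"] by simp

lemma tens_of_frag_K: "x \<in> K \<Longrightarrow> radical (tens_of_frag x)"
proof (induction x rule: K_induct)
  case (rel x)
  then show ?case
  proof (cases rule: tensor_rels_cases)
    case (add1 p q v)
    have "radical ((tens_of_frag (pure (p + q) v) - act (p + q) (emb v)) - (tens_of_frag (pure p v) - act p (emb v)) - (tens_of_frag (pure q v) - act q (emb v)))"
      using add1 by (intro radical_rules tens_of_frag_pure_radical F_closed)
    then show ?thesis unfolding add1(3) tens_of_frag_diff by (simp add: falg_act_add algebra_simps)
  next
    case (add2 p v v')
    have "radical ((tens_of_frag (pure p (v + v')) - act p (emb (v + v'))) - (tens_of_frag (pure p v) - act p (emb v)) - (tens_of_frag (pure p v') - act p (emb v')))"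
      using add2 by (intro radical_rules tens_of_frag_pure_radical F_closed)
    then show ?thesis unfolding add2(2) tens_of_frag_diff
      by (simp add: emb_add linop_rules[OF linop_act] algebra_simps)
  next
    case (bal p q v)
    have "radical ((tens_of_frag (pure (p * q) v) - act (p * q) (emb v)) - (tens_of_frag (pure p (rep_act \<tau> q v)) - act p (emb (rep_act \<tau> q v))))"
      using bal by (intro radical_rules tens_of_frag_pure_radical F_closed)
    then show ?thesis unfolding bal(4) tens_of_frag_diff using bal(2) by (simp add: act_mult act_emb algebra_simps)
  qed
next
  case zero show ?case by (simp add: tens_of_frag_0 radical_rules)
next
  case (diff x y) then show ?case by (simp add: tens_of_frag_diff radical_rules)
qed

lemma tens_of_frag_L: "p \<in> carrier F \<Longrightarrow> x \<in> carrier PT \<Longrightarrow> radical (tens_of_frag (L p x) - act p (tens_of_frag x))"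
proof -
  assume p: "p \<in> carrier F"
  show "x \<in> carrier PT \<Longrightarrow> radical (tens_of_frag (L p x) - act p (tens_of_frag x))"
  proof (induction x rule: PT_induct)
    case zero show ?case by (simp add: L_lin tens_of_frag_0 linop_rules[OF linop_act] radical_rules)
  next
    case (pure q v)
    have "radical (tens_of_frag (pure (p * q) v) - act (p * q) (emb v) - act p (tens_of_frag (pure q v) - act q (emb v)))"
      using pure p by (intro radical_rules tens_of_frag_pure_radical F_closed act_preserve)
    then show ?case using pure p by (simp add: L_pure act_mult linop_rules[OF linop_act])
  next
    case (diff x y)
    then show ?case using radical_rules(4)[OF diff.IH]
      by (simp add: L_lin tens_of_frag_diff linop_rules[OF linop_act] algebra_simps)
  qed
qed

lemma tens_of_frag_frag_upto: "supp_le n u \<Longrightarrow> radical (tens_of_frag (frag_upto n u) - u)"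
proof (induction n arbitrary: u)
  case 0
  show ?case using tens_of_frag_pure_radical[OF free_alg_closed(2), of "u []"]
    unfolding frag_upto.simps falg_act_1 supp_le_0[OF 0, symmetric] .
next
  case (Suc n)
  have gs: "tens_of_frag (\<Sum>i\<in>A. f i) = (\<Sum>i\<in>A. tens_of_frag (f i))" for A :: "'n set" and f
    by (induction A rule: infinite_finite_induct) (auto simp: tens_of_frag_0 tens_of_frag_add)
  have x: "act (gen (Cov (coord i))) v = raise i v" for i v
    by (simp add: falg_act_gen coord_def axis_def if_distrib[of "\<lambda>a. scl a _"] sum.delta cong: if_cong)
  have 1: "radical (tens_of_frag (LX i (frag_upto n (cut i u))) - raise i (cut i u))" for i
  proof (rule radical_trans)
    show "radical (tens_of_frag (LX i (frag_upto n (cut i u))) - raise i (tens_of_frag (frag_upto n (cut i u))))"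
      using tens_of_frag_L[of "gen (Cov (coord i))" "frag_upto n (cut i u)"] by (simp add: F_closed frag_upto_closed x)
    show "radical (raise i (tens_of_frag (frag_upto n (cut i u))) - raise i (cut i u))"
      using radical_raise[OF Suc.IH[OF supp_le_cut[OF Suc.prems]], of i i] by (simp add: linop_rules[OF linop_raise])
  qed
  have "tens_of_frag (frag_upto (Suc n) u) - u = (tens_of_frag (pure 1 (u [])) - emb (u [])) + (\<Sum>i\<in>UNIV. tens_of_frag (LX i (frag_upto n (cut i u))) - raise i (cut i u))"
  proof -
    have "tens_of_frag (frag_upto (Suc n) u) - (emb (u []) + (\<Sum>j\<in>UNIV. raise j (cut j u)))
      = (tens_of_frag (pure 1 (u [])) - emb (u [])) + (\<Sum>i\<in>UNIV. tens_of_frag (LX i (frag_upto n (cut i u))) - raise i (cut i u))"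
      by (simp add: tens_of_frag_add gs sum_subtractf algebra_simps)
    then show ?thesis unfolding letter_decomp[of u, symmetric] .
  qed
  moreover have "radical (tens_of_frag (pure 1 (u [])) - emb (u []))"
    using tens_of_frag_pure_radical[OF free_alg_closed(2), of "u []"] by (simp add: falg_act_1)
  ultimately show ?case using 1 by (simp add: radical_rules radical_sum)
qed

text \<open>
  This replaces the PBW theorem: the standard module is no smaller than tensors modulo the radical.
\<close>

lemma frag_of_tens_kernel_radical: "fsupp u \<Longrightarrow> frag_of_tens u \<in> K \<Longrightarrow> radical u"
proof -
  assume "fsupp u" and K: "frag_of_tens u \<in> K"
  then obtain n where "supp_le n u" by (auto simp: fsupp_def)
  then have "supp_le (LEAST n. supp_le n u) u" by (rule LeastI)
  then have "radical (tens_of_frag (frag_of_tens u) - u)" unfolding frag_of_tens_def by (rule tens_of_frag_frag_upto)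
  from radical_rules(4)[OF tens_of_frag_K[OF K] this] show ?thesis by simp
qed

end

context refl_form
begin

section \<open>The form on tensors of finite support\<close>

text \<open>
  For finite support only finitely many degrees contribute.
\<close>

definition form :: "('n, 'k) tens \<Rightarrow> ('n, 'k) tens \<Rightarrow> complex"
  where "form u v = suminf (\<lambda>k. dform k u v)"

lemma form_eq:
  assumes "supp_le n v"
  shows "form u v = (\<Sum>k\<le>n. dform k u v)"
  unfolding form_def
proof (rule suminf_finite)
  fix k assume "k \<notin> {..n}"
  then have "dform k u v = dform k u 0"
    using assms by (intro dform_cong2) (auto simp: supp_le_def pointwise)
  then show "dform k u v = 0" by simp
qed simp

lemma form_rules:
  assumes "fsupp v"
  shows "form (u + u') v = form u v + form u' v" "form (scl a u) v = a * form u v" "form (u - u') v = form u v - form u' v"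
    "form (\<Sum>i\<in>A. f i) v = (\<Sum>i\<in>A. form (f i) v)" "form 0 v = 0"
proof -
  obtain n where n: "supp_le n v" using assms by (auto simp: fsupp_def)
  show "form (u + u') v = form u v + form u' v" "form (scl a u) v = a * form u v" "form (u - u') v = form u v - form u' v"
    "form 0 v = 0"
    unfolding form_eq[OF n] dform_add1 dform_scl1 dform_diff1 
    by (simp_all only: sum.distrib sum_distrib_left sum_subtractf dform_01 sum.neutral_const)
  show "form (\<Sum>i\<in>A. f i) v = (\<Sum>i\<in>A. form (f i) v)"
    unfolding form_eq[OF n] dform_sum1 by (rule sum.swap)
qed

lemma form_herm:
  assumes "fsupp u" "fsupp v"
  shows "form v u = cnj (form u v)"
proof -
  obtain m n where "supp_le m u" "supp_le n v" using assms by (auto simp: fsupp_def)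
  then have s: "supp_le (max m n) u" "supp_le (max m n) v" by (auto intro: supp_le_mono)
  have "form v u = (\<Sum>k\<le>max m n. cnj (dform k u v))"
    unfolding form_eq[OF s(1)] by (rule sum.cong[OF HOL.refl dform_herm])
  then show ?thesis unfolding form_eq[OF s(2)] cnj_sum .
qed

lemma form_rules2:
  assumes "fsupp u" "fsupp v"
  shows "fsupp v' \<Longrightarrow> form u (v + v') = form u v + form u v'" "form u (scl a v) = cnj a * form u v" 
    "fsupp v' \<Longrightarrow> form u (v - v') = form u v - form u v'"
proof -
  show "form u (v + v') = form u v + form u v'" if "fsupp v'"
    using assms that form_herm[of "v + v'" u] form_herm[of v u] form_herm[of v' u] form_rules(1)[of u v v']
    by (simp add: fsupp_rules)
  show "form u (v - v') = form u v - form u v'" if "fsupp v'"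
    using assms that form_herm[of "v - v'" u] form_herm[of v u] form_herm[of v' u] form_rules(3)[of u v v']
    by (simp add: fsupp_rules)
  show "form u (scl a v) = cnj a * form u v"
    using assms form_herm[of "scl a v" u] form_herm[of v u] form_rules(2)[of u a v]
    by (simp add: fsupp_rules)
qed

lemma form_lower: 
  assumes "fsupp v"
  shows "form (lower i u) v = form u (raise i v)"
proof -
  obtain n where n: "supp_le n v" using assms by (auto simp: fsupp_def)
  show ?thesis unfolding form_eq[OF n] form_eq[OF supp_le_raise[OF n]] sum.atMost_Suc_shift dform_raise dform_raise_0 by simp
qed

lemma form_rho:
  assumes "g \<in> W" "fsupp v"
  shows "form (rho g u) (rho g v) = form u v"
proof -
  obtain n where n: "supp_le n v" using assms by (auto simp: fsupp_def)
  show ?thesis unfolding form_eq[OF n] form_eq[OF supp_le_rho[OF n]] by (simp only: dform_inv[OF assms(1)])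
qed

lemma form_emb: "form (emb v) (emb v') = \<beta>0 v v'"
  by (simp add: form_eq[of 0 "emb v'"] supp_le_rules)

lemma form_radical: "fsupp v \<Longrightarrow> radical u \<Longrightarrow> form u v = 0" 
  by (simp add: form_def radical_dform)

text \<open>
  Each summand is nonnegative, so a null vector is null in each degree. Orthogonality to tensors of
  finite support then suffices, since the degree \<open>k\<close> form only sees words of length \<open>k\<close>.
\<close>

lemma form_null_radical:
  assumes p: "\<And>k. psd k" and u: "fsupp u"
  shows "0 \<le> Re (form u u)" and "Re (form u u) = 0 \<Longrightarrow> radical u"
proof -
  obtain n where n: "supp_le n u" using u by (auto simp: fsupp_def)
  have nn: "0 \<le> Re (dform k u u)" for k using p u unfolding psd_def by blast
  have e: "Re (form u u) = (\<Sum>k\<le>n. Re (dform k u u))" unfolding form_eq[OF n] by simp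
  show "0 \<le> Re (form u u)" unfolding e by (intro sum_nonneg nn)
  assume "Re (form u u) = 0"
  then have z: "Re (dform k u u) = 0" if "k \<le> n" for k
    using sum_nonneg_eq_0_iff[of "{..n}" "\<lambda>k. Re (dform k u u)"] nn that unfolding e by auto
  have z': "Re (dform k u u) = 0" for k
  proof (cases "k \<le> n")
    case False
    then have "dform k u u = dform k u 0"
      using n by (intro dform_cong2) (auto simp: supp_le_def pointwise)
    then show ?thesis by simp
  qed (rule z)
  show "radical u" unfolding radical_def
  proof (intro allI)
    fix k and v :: "('n, 'k) tens"
    let ?v = "\<lambda>w. if length w = k then v w else 0"
    have "supp_le k ?v" by (auto simp: supp_le_def)
    then have "fsupp ?v" by (auto simp: fsupp_def)
    then have "dform k u ?v = 0" by (rule psd_null[OF p u z'])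
    then show "dform k u v = 0" using dform_cong2[of k v ?v u] by simp
  qed
qed

end

section \<open>The maximal submodule of the standard module\<close>

locale cherednik_irr = cherednik_form W c \<tau> \<beta>0
  for W :: "(real ^ 'n ^ ('n::finite)) set" and c :: real and \<tau> :: "('n, 'k::finite) grp_rep"
    and \<beta>0 :: "complex ^ 'k \<Rightarrow> complex ^ 'k \<Rightarrow> complex" +
  fixes \<zeta> :: complex
  assumes irr: "irreducible_rep W \<tau>" and sZ: "scalar_Z \<zeta>"
begin

abbreviation "M \<equiv> std_module W c \<tau>"

definition ker_coset :: "('n, 'k) pre_tensor \<Rightarrow> ('n, 'k) pre_tensor set" where "ker_coset x = K #>\<^bsub>PT\<^esub> x"

lemma ker_coset_image: "ker_coset x = (\<lambda>h. h + x) ` K"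
  by (auto simp: ker_coset_def r_coset_def PT_ops)

lemma ker_coset_eq: "ker_coset x = ker_coset y \<longleftrightarrow> x \<approx>\<approx> y"
proof
  assume e: "ker_coset x = ker_coset y"
  have "x \<in> ker_coset x" unfolding ker_coset_image using K_closed(1) by (intro image_eqI[of _ _ 0]) auto
  then have "x \<in> (\<lambda>h. h + y) ` K" unfolding e ker_coset_image[of y] .
  then show "x \<approx>\<approx> y" by (auto simp: eqv_def)
next
  have "ker_coset x \<subseteq> ker_coset y" if "x \<approx>\<approx> y" for x y
  proof
    fix z assume "z \<in> ker_coset x"
    then obtain h where h: "h \<in> K" "z = h + x" by (auto simp: ker_coset_image)
    then have "z = (h + (x - y)) + y" by simp
    then show "z \<in> ker_coset y" unfolding ker_coset_image using K_closed(2)[OF h(1) that[unfolded eqv_def]] by (rule image_eqI)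
  qed
  then show "x \<approx>\<approx> y \<Longrightarrow> ker_coset x = ker_coset y" using eqv_sym by blast
qed

lemma normal_K: "K \<lhd> PT"
  using comm_group.subgroup_imp_normal[OF comm_group_PT subgroup_K] .

lemma carrier_M: "carrier M = ker_coset ` carrier PT"
  by (auto simp: std_module_def FactGroup_def RCOSETS_def ker_coset_def)

lemma mult_M: "x \<in> carrier PT \<Longrightarrow> y \<in> carrier PT \<Longrightarrow> ker_coset x \<otimes>\<^bsub>M\<^esub> ker_coset y = ker_coset (x + y)"
  using normal.rcos_sum[OF normal_K, of x y] by (simp add: std_module_def FactGroup_def ker_coset_def PT_ops)

lemma one_M: "\<one>\<^bsub>M\<^esub> = ker_coset 0"
  by (simp add: std_module_def FactGroup_def ker_coset_image)

lemma group_M: "group M"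
  unfolding std_module_def by (rule normal.factorgroup_is_group[OF normal_K])

definition std_of :: "('n, 'k) tens \<Rightarrow> ('n, 'k) pre_tensor set"
  where "std_of u = ker_coset (frag_of_tens u)"

lemma std_of_carrier: "carrier M = std_of ` {u. fsupp u}"
proof -
  have "\<exists>u. fsupp u \<and> ker_coset x = std_of u" if "x \<in> carrier PT" for x
    using frag_of_tens_surj[OF that] by (auto simp: std_of_def ker_coset_eq)
  then show ?thesis by (auto simp: carrier_M std_of_def frag_of_tens_closed)
qed

lemma std_of_mem: "fsupp u \<Longrightarrow> std_of u \<in> carrier M"
  by (simp add: std_of_carrier)

lemma std_of_mult: "fsupp u \<Longrightarrow> fsupp v \<Longrightarrow> std_of u \<otimes>\<^bsub>M\<^esub> std_of v = std_of (u + v)"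
  by (simp add: std_of_def mult_M frag_of_tens_closed ker_coset_eq eqv_sym[OF frag_of_tens_add])

lemma std_of_one: "\<one>\<^bsub>M\<^esub> = std_of 0"
  by (simp add: std_of_def one_M ker_coset_eq eqv_sym[OF frag_of_tens_0])

lemma std_of_inv: "fsupp u \<Longrightarrow> inv\<^bsub>M\<^esub> (std_of u) = std_of (- u)"
  by (rule group.inv_equality[OF group_M]) (simp_all add: std_of_mult std_of_one std_of_mem fsupp_rules)

text \<open>
  Tensors with the same image have the same inner products; this is what makes the descended form well
  defined.
\<close>

lemma std_of_eq_radical:
  assumes "fsupp u" "fsupp v" "std_of u = std_of v"
  shows "radical (u - v)"
proof (rule frag_of_tens_kernel_radical)
  show "fsupp (u - v)" by (intro fsupp_rules assms)
  have "frag_of_tens u \<approx>\<approx> frag_of_tens v" using assms(3) by (simp add: std_of_def ker_coset_eq)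
  from eqv_trans[OF frag_of_tens_diff[OF assms(1,2)] eqv_diff[OF this eqv_refl]]
  show "frag_of_tens (u - v) \<in> K" by (simp add: eqv_def)
qed

lemma std_of_act: 
  assumes p: "p \<in> carrier F" and u: "fsupp u"
  shows "std_act W c \<tau> (cl p) (std_of u) = std_of (act p u)"
proof -
  have "std_act W c \<tau> (cl p) (std_of u) = K <#>\<^bsub>PT\<^esub> (L p ` std_of u)"
    by (simp add: std_act_def L_def[abs_def])
  also have "\<dots> = ker_coset (L p (frag_of_tens u))"
  proof
    show "K <#>\<^bsub>PT\<^esub> (L p ` std_of u) \<subseteq> ker_coset (L p (frag_of_tens u))"
    proof
      fix x assume "x \<in> K <#>\<^bsub>PT\<^esub> (L p ` std_of u)"
      then obtain h k where hk: "h \<in> K" "k \<in> K" "x = h + L p (k + frag_of_tens u)"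
        by (auto simp: set_mult_def PT_ops std_of_def ker_coset_image)
      then have "x = (h + L p k) + L p (frag_of_tens u)" by (simp add: L_lin)
      then show "x \<in> ker_coset (L p (frag_of_tens u))" unfolding ker_coset_image
        using K_closed(2)[OF hk(1) L_K[OF p hk(2)]] by (rule image_eqI)
    qed
    show "ker_coset (L p (frag_of_tens u)) \<subseteq> K <#>\<^bsub>PT\<^esub> (L p ` std_of u)"
    proof
      fix x assume "x \<in> ker_coset (L p (frag_of_tens u))"
      then obtain h where "h \<in> K" "x = h + L p (frag_of_tens u)" by (auto simp: ker_coset_image)
      moreover have "frag_of_tens u \<in> std_of u"
        unfolding std_of_def ker_coset_image using K_closed(1) by (intro image_eqI[of _ _ 0]) auto
      ultimately show "x \<in> K <#>\<^bsub>PT\<^esub> (L p ` std_of u)" by (auto simp: set_mult_def PT_ops)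
    qed
  qed
  also have "\<dots> = std_of (act p u)"
    unfolding std_of_def ker_coset_eq by (rule eqv_sym[OF frag_of_tens_act[OF p u]])
  finally show ?thesis .
qed

lemma std_of_gen: "g \<in> all_letters W \<Longrightarrow> fsupp u \<Longrightarrow> std_act W c \<tau> (cl (gen g)) (std_of u) = std_of (letter_op g u)"
  by (simp add: std_of_act free_alg_closed(7) falg_act_gen)

lemma std_of_const: "fsupp u \<Longrightarrow> std_act W c \<tau> (cl (const a)) (std_of u) = std_of (scl a u)"
  by (simp add: std_of_act F_closed falg_act_const)

lemma std_of_emb: "tens W c \<tau> \<one>\<^bsub>H\<^esub> v = std_of (emb v)"
proof -
  have "tens W c \<tau> \<one>\<^bsub>H\<^esub> v = ker_coset (pure 1 v)" by (simp add: tens_def ker_coset_def pure_def one_H)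
  also have "\<dots> = std_of (emb v)" unfolding std_of_def ker_coset_eq by (rule eqv_sym[OF frag_of_tens_emb])
  finally show ?thesis .
qed

definition radical_std :: "('n, 'k) pre_tensor set set"
  where "radical_std = std_of ` {u. fsupp u \<and> radical u}"

lemma std_of_radical_std: "fsupp u \<Longrightarrow> std_of u \<in> radical_std \<longleftrightarrow> radical u"
proof
  assume u: "fsupp u" and "std_of u \<in> radical_std"
  then obtain v where v: "fsupp v" "radical v" "std_of u = std_of v" by (auto simp: radical_std_def)
  have "radical ((u - v) + v)" by (intro radical_rules(2) std_of_eq_radical u v)
  then show "radical u" by simp
qed (auto simp: radical_std_def)

lemma subgroup_radical_std: "subgroup radical_std M"
proof (rule group.subgroupI[OF group_M])
  show "radical_std \<subseteq> carrier M" by (auto simp: radical_std_def std_of_carrier)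
  show "radical_std \<noteq> {}" using std_of_radical_std[of 0] radical_rules(1) fsupp_rules(1) by auto
  fix a assume "a \<in> radical_std"
  then obtain u where u: "fsupp u" "radical u" "a = std_of u" by (auto simp: radical_std_def)
  show "inv\<^bsub>M\<^esub> a \<in> radical_std" unfolding u(3) std_of_inv[OF u(1)] using u by (simp add: std_of_radical_std fsupp_rules radical_rules)
  fix b assume "b \<in> radical_std"
  then obtain v where v: "fsupp v" "radical v" "b = std_of v" by (auto simp: radical_std_def)
  show "a \<otimes>\<^bsub>M\<^esub> b \<in> radical_std" unfolding u(3) v(3) std_of_mult[OF u(1) v(1)] using u v by (simp add: std_of_radical_std fsupp_rules radical_rules)
qed

lemma submodule_radical_std: "submodule_std W c \<tau> radical_std"
  unfolding submodule_std_def
proof (intro conjI ballI subgroup_radical_std)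
  fix h m assume "h \<in> carrier H" "m \<in> radical_std"
  then obtain p u where pu: "p \<in> carrier F" "h = cl p" "fsupp u" "radical u" "m = std_of u"
    by (auto simp: carrier_H radical_std_def)
  then show "std_act W c \<tau> h m \<in> radical_std" by (simp add: std_of_act std_of_radical_std act_preserve)
qed

lemma radical_emb: "radical (emb v) \<Longrightarrow> v = 0"
  using radical_dform(1)[of "emb v" 0 "emb v"] inner_pos[of v] by fastforce

lemma radical_std_proper: "radical_std \<noteq> carrier M"
proof
  let ?v = "(\<chi> i. 1) :: complex ^ 'k"
  assume "radical_std = carrier M"
  then have "radical (emb ?v)" using std_of_mem[of "emb ?v"] std_of_radical_std[of "emb ?v"] fsupp_rules(5) by blast
  then have "?v = 0" by (rule radical_emb)
  then show False by (simp add: vec_eq_iff)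
qed

text \<open>
  Let \<open>P\<close> be the preimage of a proper submodule \<open>Q\<close> in the tensors of finite support. It is stable
  under the Euler element, which acts on \<open>M_c(\<tau>)\<close> by the degree; this isolates the degree 0 part of
  an element of \<open>P\<close>, so by irreducibility of \<open>\<tau>\<close> all elements of \<open>P\<close> vanish in degree 0. As \<open>P\<close> is
  also stable under lowering, its elements are orthogonal to everything.
\<close>

lemma proper_submodule_radical_std:
  assumes Q: "submodule_std W c \<tau> Q" "Q \<noteq> carrier M"
  shows "Q \<subseteq> radical_std"
proof -
  define P where "P u \<longleftrightarrow> fsupp u \<and> std_of u \<in> Q" for u
  have sg: "subgroup Q M" using Q by (simp add: submodule_std_def)
  have Pf: "fsupp u" if "P u" for u using that by (simp add: P_def)
  have P0: "P u" if "fsupp u" "frag_of_tens u \<approx>\<approx> 0" for u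
  proof -
    have "std_of u = \<one>\<^bsub>M\<^esub>" using that by (simp add: std_of_def one_M ker_coset_eq)
    then show ?thesis using that subgroup.one_closed[OF sg] by (simp add: P_def)
  qed
  have Padd: "P (u + v)" if "P u" "P v" for u v
    using that subgroup.m_closed[OF sg, of "std_of u" "std_of v"] by (simp add: P_def fsupp_rules std_of_mult)
  have Pact: "P (act p u)" if "P u" "p \<in> carrier F" for p u
    using that Q unfolding P_def submodule_std_def
    by (metis std_of_act act_preserve(1) cl_carrier)
  have Pscl: "P (scl a u)" if "P u" for a u
    using Pact[OF that, of "const a"] by (simp add: F_closed falg_act_const)
  have Prho: "P (rho g u)" if "P u" "g \<in> W" for g u
    using Pact[OF that(1), of "gen (Grp g)"] that by (simp add: F_closed falg_act_gen)
  have lx: "act (gen (Cov (coord i))) u = raise i u" for i u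
    by (simp add: falg_act_gen coord_def axis_def if_distrib[of "\<lambda>a. scl a _"] sum.delta cong: if_cong)
  have ly: "act (gen (Vec (axis i 1))) u = lower i u" for i u
    by (simp add: falg_act_gen axis_def if_distrib[of "\<lambda>a. scl a _"] sum.delta cong: if_cong)
  have Px: "P (raise i u)" if "P u" for i u
    using Pact[OF that, of "gen (Cov (coord i))"] by (simp only: F_closed lx)
  have Py: "P (lower i u)" if "P u" for i u
    using Pact[OF that, of "gen (Vec (axis i 1))"] by (simp only: F_closed ly)
  have Psum: "P (\<Sum>i\<in>A. f i)" if "\<And>i. i \<in> A \<Longrightarrow> P (f i)" for f and A :: "'z set"
    using that by (induction A rule: infinite_finite_induct) (auto intro: Padd P0 fsupp_rules frag_of_tens_0)
  have Pdiff: "P (u - v)" if "P u" "P v" for u v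
    using Padd[OF that(1) Pscl[OF that(2), of "-1"]] by simp
  have Pxx: "P (raise i (raise j u) - raise j (raise i u))" if "fsupp u" for i j u
  proof (rule P0)
    have Thx: "frag_of_tens (raise i u) \<approx>\<approx> LX i (frag_of_tens u)" if "fsupp u" for i u
      using frag_of_tens_act[OF gen_mem(3)[OF coord_dual] that, of i] by (simp only: lx)
    have Thxx: "frag_of_tens (raise i (raise j u)) \<approx>\<approx> LX i (LX j (frag_of_tens u))" for i j
      by (intro eqv_trans[OF Thx] L_cong F_closed Thx fsupp_rules that)
    have "frag_of_tens (raise i (raise j u) - raise j (raise i u)) \<approx>\<approx> LX i (LX j (frag_of_tens u)) - LX j (LX i (frag_of_tens u))"
      by (intro eqv_trans[OF frag_of_tens_diff] eqv_diff Thxx fsupp_rules that)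
    then show "frag_of_tens (raise i (raise j u) - raise j (raise i u)) \<approx>\<approx> 0"
      using rel_L(3)[OF frag_of_tens_closed[of u] coord_dual[of i] coord_dual[of j]] by simp
  qed (intro fsupp_rules that)
  have Peu: "P (euler \<zeta> u)" if "P u" for u
  proof -
    have sW: "s \<in> reflections W \<Longrightarrow> s \<in> W" for s by (simp add: reflections_def)
    show ?thesis unfolding euler_def raise_lower_def refl_sum_def
      by (intro Padd Pdiff Pscl Psum Px Py Prho that sW)
  qed
  have Pwlen: "P (euler \<zeta> u - times_degree u)" if "fsupp u" for u
    by (rule euler_eq_times_degree_modulo[OF sZ]) (auto intro: Padd Px Pxx that P0 fsupp_rules frag_of_tens_0)
  have top: "P (emb (u []))" if "P u" "supp_le n u" for n u
    using that
  proof (induction n arbitrary: u)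
    case 0
    then show ?case unfolding supp_le_0[OF 0(2), symmetric] by simp
  next
    case (Suc n)
    \<comment> \<open>removes the top degree and multiplies degree 0 by \<open>n + 1\<close>\<close>
    let ?v = "scl (of_nat (Suc n)) u - times_degree u"
    have "?v = scl (of_nat (Suc n)) u - euler \<zeta> u + (euler \<zeta> u - times_degree u)" by simp
    moreover have "P (scl (of_nat (Suc n)) u - euler \<zeta> u + (euler \<zeta> u - times_degree u))"
      by (intro Padd Pdiff Pscl Peu Pwlen Pf Suc.prems)
    ultimately have "P ?v" by (simp only:)
    moreover have "supp_le n ?v"
      unfolding supp_le_def
    proof (intro allI impI)
      fix w :: "'n list" assume w: "n < length w"
      show "?v w = 0"
      proof (cases "length w = Suc n")
        case True then show ?thesis by (simp add: pointwise times_degree_def)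
      next
        case False
        then have "u w = 0" using w Suc.prems(2) by (auto simp: supp_le_def)
        then show ?thesis by (simp add: pointwise times_degree_def)
      qed
    qed
    ultimately have "P (emb (?v []))" by (rule Suc.IH)
    moreover have "?v [] = of_nat (Suc n) *s u []" by (simp add: pointwise times_degree_def)
    ultimately have "P (scl (of_nat (Suc n)) (emb (u [])))" by (simp only: emb_scl)
    then have "P (scl (inverse (of_nat (Suc n))) (scl (of_nat (Suc n)) (emb (u []))))" by (rule Pscl)
    moreover have "inverse (of_nat (Suc n)) * of_nat (Suc n) = (1 :: complex)"
      by (rule left_inverse) (rule of_nat_neq_0)
    ultimately show ?case by (simp only: tm.scale_scale tm.scale_one)
  qed
  define U where "U = {v. P (emb v)}"
  have "vec.subspace U" unfolding vec.subspace_def U_def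
    by (auto simp: emb_0 emb_add emb_scl intro: Padd Pscl P0 fsupp_rules frag_of_tens_0)
  moreover have "\<forall>g\<in>W. \<forall>v\<in>U. \<tau> g *v v \<in> U"
    unfolding U_def using Prho by (force simp: rho_emb[symmetric])
  ultimately have "U = {0} \<or> U = UNIV" using irr unfolding irreducible_rep_def by blast
  moreover have "U \<noteq> UNIV"
  proof
    assume U: "U = UNIV"
    have all: "P u" if "supp_le n u" for n u
      using that
    proof (induction n arbitrary: u)
      case 0
      have "P (emb (u []))" using U by (auto simp: U_def)
      then show ?case unfolding supp_le_0[OF 0, symmetric] .
    next
      case (Suc n)
      have "P (emb (u []) + (\<Sum>j\<in>UNIV. raise j (cut j u)))"
        by (rule Padd, use U in \<open>auto simp: U_def\<close>) (intro Psum Px Suc.IH supp_le_cut Suc.prems)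
      then show ?case unfolding letter_decomp[of u, symmetric] .
    qed
    have "carrier M \<subseteq> Q" using all by (auto simp: std_of_carrier fsupp_def P_def)
    then show False using Q(2) subgroup.subset[OF sg] by blast
  qed
  ultimately have "U = {0}" by blast
  then have nil: "u [] = 0" if "P u" for u
    using top[OF that] Pf[OF that] by (auto simp: fsupp_def U_def that)
  have "dform k u v = 0" if "P u" for k u v
    using that
  proof (induction k arbitrary: u v)
    case 0
    then show ?case using nil[OF 0] inner_scl1[of 0 0 "v []"] by simp
  next
    case (Suc k) then show ?case using Py by simp
  qed
  then have "radical u" if "P u" for u using that by (simp add: radical_def)
  then show ?thesis using subgroup.subset[OF sg] unfolding std_of_carrier radical_std_def P_def by blast
qed

lemma max_submodule_eq: "max_submodule W c \<tau> = radical_std"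
  unfolding max_submodule_def
proof (rule the_equality)
  show "maximal_submodule_std W c \<tau> radical_std"
    unfolding maximal_submodule_std_def using submodule_radical_std radical_std_proper proper_submodule_radical_std by blast
  fix Q assume "maximal_submodule_std W c \<tau> Q"
  then show "Q = radical_std"
    unfolding maximal_submodule_std_def using submodule_radical_std radical_std_proper proper_submodule_radical_std by blast
qed

section \<open>Unitarity as positivity in each degree\<close>

lemma form_cong_radical:
  assumes "fsupp u" "fsupp u'" "fsupp v" "fsupp v'" "radical (u - u')" "radical (v - v')"
  shows "form u v = form u' v'"
proof -
  have "form u v = form u' v" using form_rules(3)[of v u u'] form_radical[of v "u - u'"] assms by simp
  moreover have "form v u' = form v' u'" using form_rules(3)[of u' v v'] form_radical[of u' "v - v'"] assms by simp
  ultimately show ?thesis using form_herm[of u' v] form_herm[of u' v'] assms by simp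
qed

lemma form_letter_op_adjoint:
  assumes v: "fsupp v" and u: "fsupp u"
  shows "form (letter_op (Vec y) u) v = form u (letter_op (Cov (T_map y)) v)"
proof -
  have T: "T_map y (axis i 1) = cnj (y $ i)" for i
    by (simp add: T_map_def herm_def axis_def if_distrib[of "\<lambda>a. a * _"] sum.delta cong: if_cong)
  have s2: "form u (\<Sum>i\<in>A. scl (a i) (raise i v)) = (\<Sum>i\<in>A. cnj (a i) * form u (raise i v))" if "finite A" for A a
    using that by (induction A)
       (use u v form_herm[of u 0] form_rules(5) in \<open>auto simp: form_rules2 fsupp_rules fsupp_sum\<close>)
  have "form (letter_op (Vec y) u) v = (\<Sum>i\<in>UNIV. y $ i * form u (raise i v))"
    by (simp add: form_rules v form_lower)
  also have "\<dots> = form u (letter_op (Cov (T_map y)) v)"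
    using s2[of UNIV "\<lambda>i. T_map y (axis i 1)"] by (simp add: T)
  finally show ?thesis .
qed

text \<open>
  The properties of \<open>form\<close> on tensors carry over to any form on \<open>M_c(\<tau>)\<close> with the same values.
\<close>

lemma contravariant_form_if_values:
  assumes \<beta>: "\<And>u v. fsupp u \<Longrightarrow> fsupp v \<Longrightarrow> \<beta> (std_of u) (std_of v) = form u v"
  shows "contravariant_form W c \<tau> \<beta>0 \<beta>"
  unfolding contravariant_form_def Let_def hermitian_form_def
proof (intro conjI allI ballI)
  fix m m' assume "m \<in> carrier M" "m' \<in> carrier M"
  then obtain u v where uv: "fsupp u" "m = std_of u" "fsupp v" "m' = std_of v" by (auto simp: std_of_carrier)
  show "\<beta> m' m = cnj (\<beta> m m')" unfolding uv \<beta>[OF uv(1,3)] \<beta>[OF uv(3,1)] by (rule form_herm[OF uv(1,3)])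
  show "\<beta> (std_act W c \<tau> (cl (const a)) m) m' = a * \<beta> m m'" for a
    unfolding uv by (simp add: std_of_const \<beta> uv fsupp_rules form_rules)
  show "\<beta> (std_act W c \<tau> (cl (gen (Grp g))) m) (std_act W c \<tau> (cl (gen (Grp g))) m') = \<beta> m m'" if "g \<in> W" for g
    unfolding uv using that by (simp add: std_of_gen letters_mem \<beta> uv fsupp_ops form_rho)
  show "\<beta> (std_act W c \<tau> (cl (gen (Vec y))) m) m' = \<beta> m (std_act W c \<tau> (cl (gen (Cov (T_map y)))) m')" for y
    unfolding uv std_of_gen[OF letters_mem(2) uv(1)] std_of_gen[OF letters_mem(3)[OF dual_closed(4)] uv(3)]
    using letters_preserve(1)[OF letters_mem(2) uv(1)] letters_preserve(1)[OF letters_mem(3)[OF dual_closed(4)] uv(3)]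
    by (simp only: \<beta> uv form_letter_op_adjoint)
  fix m'' assume "m'' \<in> carrier M"
  then obtain u' where u': "fsupp u'" "m'' = std_of u'" by (auto simp: std_of_carrier)
  show "\<beta> (m \<otimes>\<^bsub>M\<^esub> m') m'' = \<beta> m m'' + \<beta> m' m''"
    unfolding uv u' by (simp add: std_of_mult \<beta> uv u' fsupp_rules form_rules)
next
  show "\<beta> (tens W c \<tau> \<one>\<^bsub>H\<^esub> v) (tens W c \<tau> \<one>\<^bsub>H\<^esub> v') = \<beta>0 v v'" for v v'
    by (simp add: std_of_emb \<beta> fsupp_rules form_emb)
qed

lemma radical_std_coset: "fsupp u \<Longrightarrow> radical_std #>\<^bsub>M\<^esub> std_of u = radical_std #>\<^bsub>M\<^esub> std_of v \<Longrightarrow> fsupp v \<Longrightarrow> radical (u - v)"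
proof -
  assume u: "fsupp u" and v: "fsupp v" and e: "radical_std #>\<^bsub>M\<^esub> std_of u = radical_std #>\<^bsub>M\<^esub> std_of v"
  have "std_of u \<in> radical_std #>\<^bsub>M\<^esub> std_of u" by (rule group.rcos_self[OF group_M std_of_mem[OF u] subgroup_radical_std])
  then have "std_of u \<in> radical_std #>\<^bsub>M\<^esub> std_of v" unfolding e .
  then obtain r where r: "fsupp r" "radical r" "std_of u = std_of r \<otimes>\<^bsub>M\<^esub> std_of v" by (auto simp: r_coset_def radical_std_def)
  then have "std_of u = std_of (r + v)" by (simp add: std_of_mult v)
  then have "radical (u - (r + v))" by (intro std_of_eq_radical u v fsupp_rules r)
  from radical_rules(2)[OF this r(2)] show ?thesis by simp
qed

text \<open>
  Both forms are obtained by choosing preimages in the tensors of finite support. Positive definiteness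
  of the second one is \<open>form_null_radical\<close>: null vectors of a semidefinite form are in the radical.
\<close>

lemma unitary_if_psd:
  assumes p: "\<And>k. psd k"
  shows "unitary_irr W c \<tau>"
proof -
  define ru where "ru m = (SOME u. fsupp u \<and> std_of u = m)" for m
  have ru: "fsupp (ru (std_of u)) \<and> std_of (ru (std_of u)) = std_of u" if "fsupp u" for u
    unfolding ru_def by (rule someI[of _ u]) (simp add: that)
  define \<beta> where "\<beta> m m' = form (ru m) (ru m')" for m m'
  have \<beta>: "\<beta> (std_of u) (std_of v) = form u v" if "fsupp u" "fsupp v" for u v
    unfolding \<beta>_def using ru[OF that(1)] ru[OF that(2)] that
    by (intro form_cong_radical std_of_eq_radical) auto
  define rm where "rm A = (SOME u. fsupp u \<and> radical_std #>\<^bsub>M\<^esub> std_of u = A)" for A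
  have rm: "fsupp (rm (radical_std #>\<^bsub>M\<^esub> std_of u)) \<and> radical_std #>\<^bsub>M\<^esub> std_of (rm (radical_std #>\<^bsub>M\<^esub> std_of u)) = radical_std #>\<^bsub>M\<^esub> std_of u" if "fsupp u" for u
    unfolding rm_def by (rule someI[of _ u]) (simp add: that)
  define \<gamma> where "\<gamma> A A' = form (rm A) (rm A')" for A A'
  have \<gamma>: "\<gamma> (radical_std #>\<^bsub>M\<^esub> std_of u) (radical_std #>\<^bsub>M\<^esub> std_of v) = form u v" if "fsupp u" "fsupp v" for u v
    unfolding \<gamma>_def using rm[OF that(1)] rm[OF that(2)] that
    by (intro form_cong_radical radical_std_coset) auto
  have "\<forall>m\<in>carrier M. \<forall>m'\<in>carrier M. \<gamma> (radical_std #>\<^bsub>M\<^esub> m) (radical_std #>\<^bsub>M\<^esub> m') = \<beta> m m'"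
    by (auto simp: std_of_carrier \<beta> \<gamma>)
  moreover have "positive_definite (irr_module W c \<tau>) \<gamma>"
    unfolding positive_definite_def
  proof (intro ballI impI)
    fix A assume A: "A \<in> carrier (irr_module W c \<tau>)" "A \<noteq> \<one>\<^bsub>irr_module W c \<tau>\<^esub>"
    then have "A \<in> rcosets\<^bsub>M\<^esub> radical_std" "A \<noteq> radical_std"
      by (auto simp: irr_module_def max_submodule_eq FactGroup_def)
    then obtain u where u: "fsupp u" "A = radical_std #>\<^bsub>M\<^esub> std_of u" "A \<noteq> radical_std"
      by (auto simp: RCOSETS_def std_of_carrier)
    have "\<not> radical u"
    proof
      assume "radical u"
      then have "std_of u \<in> radical_std" using u by (simp add: std_of_radical_std)
      then have "A = radical_std" unfolding u(2) by (rule group.coset_join2[OF group_M std_of_mem[OF u(1)] subgroup_radical_std])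
      then show False using u by simp
    qed
    then have "Re (form u u) > 0" using form_null_radical[OF p u(1)] by fastforce
    moreover have "form u u \<in> \<real>" using form_herm[OF u(1) u(1)] by (metis Reals_cnj_iff)
    ultimately show "\<gamma> A A \<in> \<real> \<and> 0 < Re (\<gamma> A A)" unfolding u(2) \<gamma>[OF u(1) u(1)] by simp
  qed
  ultimately show ?thesis
    unfolding unitary_irr_def Let_def max_submodule_eq
    using inner contravariant_form_if_values[OF \<beta>] by blast
qed

text \<open>
  The difference of the two forms vanishes on \<open>1 \<otimes> \<tau>\<close>. By adjunction the letters of the left
  argument are moved to the right as lowering operators, until a tensor of degree 0 is left; then the
  letters of the right argument are moved to the left, where they kill it.
\<close>

lemma contravariant_unique:
  assumes \<beta>: "contravariant_form W c \<tau> \<beta>0 \<beta>" and u: "fsupp u" and v: "fsupp v"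
  shows "\<beta> (std_of u) (std_of v) = form u v"
proof -
  note b = \<beta>[unfolded contravariant_form_def Let_def hermitian_form_def]
  define D where "D u v = \<beta> (std_of u) (std_of v) - form u v" for u v
  have h0: "\<beta> (std_of v) (std_of u) = cnj (\<beta> (std_of u) (std_of v))" if "fsupp u" "fsupp v" for u v
    using b that std_of_mem by blast
  have herm: "D v u = cnj (D u v)" if "fsupp u" "fsupp v" for u v
    unfolding D_def using h0[OF that] form_herm[OF that] by simp
  have add0: "\<beta> (std_of (u + u')) (std_of v) = \<beta> (std_of u) (std_of v) + \<beta> (std_of u') (std_of v)" if "fsupp u" "fsupp u'" "fsupp v" for u u' v
    using b that std_of_mem unfolding std_of_mult[symmetric, OF that(1,2)] by blast
  have add: "D (u + u') v = D u v + D u' v" if "fsupp u" "fsupp u'" "fsupp v" for u u' v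
    unfolding D_def add0[OF that] form_rules(1)[OF that(3)] by simp
  have z: "D 0 v = 0" if "fsupp v" for v
    using add[OF fsupp_rules(1) fsupp_rules(1) that] by simp
  have sum: "D (\<Sum>i\<in>A. f i) v = (\<Sum>i\<in>A. D (f i) v)" if "\<And>i. fsupp (f i)" "fsupp v" for f v and A :: "'n set"
    using that by (induction A rule: infinite_finite_induct) (auto simp: z add fsupp_sum)
  have e: "D (emb v) (emb v') = 0" for v v'
    unfolding D_def form_emb using b unfolding std_of_emb by auto
  have y: "D (lower i u) v = D u (raise i v)" if "fsupp u" "fsupp v" for i u v
  proof -
    have 1: "letter_op (Vec (axis i 1)) u = lower i u"
      by (simp add: axis_def if_distrib[of "\<lambda>a. scl a _"] sum.delta cong: if_cong)
    have "T_map (axis i 1) (axis j 1) = kd i j" for j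
      by (simp add: T_map_def herm_def axis_def if_distrib[of cnj] if_distrib[of "\<lambda>a. _ * a"] sum.delta cong: if_cong)
    then have 2: "letter_op (Cov (T_map (axis i 1))) v = raise i v"
      by (simp add: if_distrib[of "\<lambda>a. scl a _"] sum.delta cong: if_cong)
    have "\<beta> (std_act W c \<tau> (cl (gen (Vec (axis i 1)))) (std_of u)) (std_of v)
        = \<beta> (std_of u) (std_act W c \<tau> (cl (gen (Cov (T_map (axis i 1))))) (std_of v))"
      using b that std_of_mem by blast
    then have "\<beta> (std_of (lower i u)) (std_of v) = \<beta> (std_of u) (std_of (raise i v))"
      unfolding std_of_gen[OF letters_mem(2) that(1)] std_of_gen[OF letters_mem(3)[OF dual_closed(4)] that(2)] 1 2 .
    then show ?thesis unfolding D_def form_lower[OF that(2)] by simp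
  qed
  have dec: "D u v = D (emb (u [])) v + (\<Sum>i\<in>UNIV. D (raise i (cut i u)) v)" if "fsupp u" "fsupp v" for u v
  proof -
    have "D (emb (u []) + (\<Sum>j\<in>UNIV. raise j (cut j u))) v = D (emb (u [])) v + (\<Sum>i\<in>UNIV. D (raise i (cut i u)) v)"
      by (simp add: add sum fsupp_rules fsupp_sum that)
    then show ?thesis unfolding letter_decomp[of u, symmetric] .
  qed
  have x: "D (raise i u) v = cnj (D (lower i v) u)" if "fsupp u" "fsupp v" for i u v
    using herm[of v "raise i u"] y[of v u i] that by (simp add: fsupp_rules)
  have De: "D u (emb w) = 0" if "fsupp u" for u w
  proof -
    have "D (raise i (cut i u)) (emb w) = 0" for i
      unfolding x[OF fsupp_rules(8)[OF that] fsupp_rules(5)] lower_emb by (simp add: z fsupp_rules that)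
    then show ?thesis unfolding dec[OF that fsupp_rules(5)] by (simp add: e)
  qed
  have "D u v = 0" if "fsupp u" "fsupp v" "supp_le n u" for n u v
    using that
  proof (induction n arbitrary: u v)
    case 0
    have "D (emb (u [])) v = 0" using herm[of v "emb (u [])"] De[of v "u []"] 0 by (simp add: fsupp_rules)
    then show ?case unfolding supp_le_0[OF 0(3), symmetric] .
  next
    case (Suc n)
    have "D (emb (u [])) v = 0" using herm[of v "emb (u [])"] De[of v "u []"] Suc.prems by (simp add: fsupp_rules)
    moreover have "D (raise i (cut i u)) v = 0" for i
    proof -
      have "D (cut i u) (lower i v) = 0"
        by (intro Suc.IH supp_le_cut fsupp_rules fsupp_ops Suc.prems)
      then have "D (lower i v) (cut i u) = 0"
        using herm[of "cut i u" "lower i v"] Suc.prems by (simp add: fsupp_rules fsupp_ops)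
      then show ?thesis using x[of "cut i u" v i] Suc.prems by (simp add: fsupp_rules)
    qed
    ultimately show ?case using dec[OF Suc.prems(1,2)] by simp
  qed
  then have "D u v = 0" using u v by (auto simp: fsupp_def)
  then show ?thesis by (simp add: D_def)
qed

lemma nonneg_if_unitary:
  assumes \<beta>: "contravariant_form W c \<tau> \<beta>0 \<beta>"
    and \<gamma>: "\<forall>m\<in>carrier M. \<forall>m'\<in>carrier M. \<gamma> (max_submodule W c \<tau> #>\<^bsub>M\<^esub> m) (max_submodule W c \<tau> #>\<^bsub>M\<^esub> m') = \<beta> m m'"
    and pd: "positive_definite (irr_module W c \<tau>) \<gamma>" and u: "fsupp u"
  shows "0 \<le> Re (form u u)"
proof -
  let ?A = "radical_std #>\<^bsub>M\<^esub> std_of u"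
  have e: "form u u = \<gamma> ?A ?A"
    using \<gamma> std_of_mem[OF u] contravariant_unique[OF \<beta> u u] unfolding max_submodule_eq by auto
  show ?thesis
  proof (cases "?A = radical_std")
    case True
    have "radical_std #>\<^bsub>M\<^esub> std_of 0 = radical_std" 
      by (rule group.coset_join2[OF group_M std_of_mem[OF fsupp_rules(1)] subgroup_radical_std]) (simp add: std_of_radical_std fsupp_rules radical_rules)
    then have "\<gamma> ?A ?A = \<beta> (std_of 0) (std_of 0)"
      using True \<gamma> std_of_mem[OF fsupp_rules(1)] unfolding max_submodule_eq by metis
    also have "\<dots> = 0" using contravariant_unique[OF \<beta> fsupp_rules(1) fsupp_rules(1)] by (simp add: form_rules(5) fsupp_rules)
    finally show ?thesis using e by simp
  next
    case False
    have "?A \<in> carrier (irr_module W c \<tau>)" "?A \<noteq> \<one>\<^bsub>irr_module W c \<tau>\<^esub>"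
      using False std_of_mem[OF u] by (auto simp: irr_module_def max_submodule_eq FactGroup_def RCOSETS_def)
    then show ?thesis unfolding e using pd unfolding positive_definite_def by force
  qed
qed

text \<open>
  The form of the degree \<open>k\<close> part of \<open>u\<close> with itself is the degree \<open>k\<close> form of \<open>u\<close>.
\<close>

lemma psd_if_unitary:
  assumes "contravariant_form W c \<tau> \<beta>0 \<beta>"
    and "\<forall>m\<in>carrier M. \<forall>m'\<in>carrier M. \<gamma> (max_submodule W c \<tau> #>\<^bsub>M\<^esub> m) (max_submodule W c \<tau> #>\<^bsub>M\<^esub> m') = \<beta> m m'"
    and "positive_definite (irr_module W c \<tau>) \<gamma>"
  shows "psd k"
  unfolding psd_def
proof (intro allI impI)
  fix u :: "('n, 'k) tens" assume "fsupp u"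
  define v where "v = (\<lambda>w. if length w = k then u w else 0)"
  have s: "supp_le k v" by (auto simp: supp_le_def v_def)
  have z: "dform i v v = 0" if "i \<noteq> k" for i
  proof -
    have "dform i v v = dform i v 0" using that by (intro dform_cong2) (auto simp: v_def pointwise)
    then show ?thesis by simp
  qed
  have "form v v = (\<Sum>i\<le>k. if i = k then dform k v v else 0)"
    unfolding form_eq[OF s] by (rule sum.cong) (auto simp: z)
  then have "form v v = dform k v v" by simp
  moreover have "dform k v v = dform k v u" by (rule dform_cong2) (simp add: v_def)
  moreover have "dform k v u = dform k u u" by (rule dform_cong1) (simp add: v_def)
  moreover have "0 \<le> Re (form v v)"
    by (rule nonneg_if_unitary[OF assms]) (use s in \<open>auto simp: fsupp_def\<close>)
  ultimately show "0 \<le> Re (dform k u u)" by simp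
qed

end

section \<open>Reflections and the dihedral group\<close>

text \<open>
  The pair \<open>(n \<bullet> _, n)\<close> is a root pair, and any other one differs from it by reciprocal factors, so the
  product of the pairings is the same for the chosen pair.
\<close>

lemma root_pair_of_reflection:
  fixes s :: "real ^ 'n ^ ('n::finite)" and n :: "'n \<Rightarrow> real"
  assumes s: "\<And>i j. s $ i $ j = (if i = j then 1 else 0) - n i * n j" and n2: "(\<Sum>i\<in>UNIV. n i * n i) = 2"
    and x: "x \<in> dual_space"
  shows "fst (root_pair s) y * x (snd (root_pair s)) = x y - x (act_h s y)"
proof -
  define nv :: "complex ^ 'n" where "nv = (\<chi> i. of_real (n i))"
  define al where "al y = (\<Sum>i\<in>UNIV. of_real (n i) * y $ i)" for y :: "complex ^ 'n"
  have s_act: "act_h s y = y - al y *s nv" for y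
  proof -
    have "act_h s y $ i = (y - al y *s nv) $ i" for i
    proof -
      have "act_h s y $ i = (\<Sum>j\<in>UNIV. (if i = j then y $ j else 0) - of_real (n i) * (of_real (n j) * y $ j))"
        unfolding act_h_nth by (rule sum.cong) (auto simp: s algebra_simps)
      then show ?thesis
        by (simp add: sum_subtractf al_def nv_def sum_distrib_left mult.commute)
    qed
    then show ?thesis by (simp add: vec_eq_iff)
  qed
  have al_nv: "al nv = 2"
  proof -
    have "al nv = of_real (\<Sum>i\<in>UNIV. n i * n i)" by (simp add: al_def nv_def)
    then show ?thesis by (simp add: n2)
  qed
  have al_dual: "al \<in> dual_space"
    by (rule dualI) (simp_all add: al_def algebra_simps sum.distrib sum_distrib_left)
  have "(s ** s) $ i $ j = mat 1 $ i $ j" for i j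
  proof -
    have "(s ** s) $ i $ j = (\<Sum>k\<in>UNIV. ((if i = k then if k = j then 1 else 0 else 0) - (if i = k then n k * n j else 0))
        - ((if k = j then n i * n k else 0) - n i * n j * (n k * n k)))"
      unfolding matrix_matrix_mult_def by (simp add: s algebra_simps) (rule sum.cong, auto simp: algebra_simps)
    also have "\<dots> = mat 1 $ i $ j"
      by (simp add: sum_subtractf n2 flip: sum_distrib_left) (simp add: mat_def)
    finally show ?thesis .
  qed
  then have "s ** s = mat 1" by (simp add: vec_eq_iff)
  then have inv: "matrix_inv s = s" by (intro matrix_inv_eqI)
  have x_s: "act_dual s x y - x y = - x nv * al y" if "x \<in> dual_space" for x y
  proof -
    have "x (y - al y *s nv) = x y - al y * x nv"
      using dual_add[OF that, of "y - al y *s nv" "al y *s nv"] dual_scl[OF that, of "al y" nv] by simp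
    then show ?thesis by (simp add: act_dual_def inv s_act)
  qed
  have im1: "{(\<lambda>y. act_dual s x y - x y) | x. x \<in> dual_space} = {(\<lambda>y. k * al y) | k. True}"
  proof safe
    fix x :: "complex ^ 'n \<Rightarrow> complex" assume "x \<in> dual_space"
    then show "\<exists>k. (\<lambda>y. act_dual s x y - x y) = (\<lambda>y. k * al y) \<and> True"
      by (intro exI[of _ "- x nv"]) (simp add: x_s)
  next
    fix k
    let ?x = "\<lambda>y. (- k / 2) * al y"
    have d: "?x \<in> dual_space" by (rule dual_closed(2)[OF al_dual])
    have "(\<lambda>y. act_dual s ?x y - ?x y) = (\<lambda>y. k * al y)"
      using x_s[OF d] by (simp add: al_nv)
    then show "\<exists>x. (\<lambda>y. k * al y) = (\<lambda>y. act_dual s x y - x y) \<and> x \<in> dual_space"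
      using d by metis
  qed
  have im2: "{act_h s y - y | y. True} = {k *s nv | k. True}"
  proof safe
    fix y show "\<exists>k. act_h s y - y = k *s nv \<and> True"
      by (intro exI[of _ "- al y"]) (simp add: s_act)
  next
    fix k
    have "al ((- k / 2) *s nv) = - k"
      using dual_scl[OF al_dual, of "- k / 2" nv] by (simp add: al_nv)
    then show "\<exists>y. k *s nv = act_h s y - y \<and> True"
      by (intro exI[of _ "(- k / 2) *s nv"]) (simp add: s_act)
  qed
  have ex: "is_root_pair s (fst (al, nv)) (snd (al, nv))"
    unfolding is_root_pair_def using al_dual im1 im2 al_nv by simp
  have "is_root_pair s (fst (root_pair s)) (snd (root_pair s))"
    unfolding root_pair_def by (rule someI[of "\<lambda>p. is_root_pair s (fst p) (snd p)", OF ex])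
  then obtain a av where av: "a = fst (root_pair s)" "av = snd (root_pair s)" "is_root_pair s a av" by blast
  then have e: "{(\<lambda>y. k * al y) | k. True} = {(\<lambda>y. k * a y) | k. True}" "{k *s nv | k. True} = {k *s av | k. True}"
    and a2: "a av = 2"
    unfolding is_root_pair_def im1 im2 by auto
  have "(\<lambda>y. 1 * a y) \<in> {(\<lambda>y. k * al y) | k. True}" "1 *s av \<in> {k *s nv | k. True}"
    unfolding e by blast+
  then obtain k l where "(\<lambda>y. 1 * a y) = (\<lambda>y. k * al y)" "1 *s av = l *s nv" by blast
  then have kl: "a = (\<lambda>y. k * al y)" "av = l *s nv" by simp_all
  then have "k * l = 1" using a2 dual_scl[OF al_dual, of l nv] al_nv by simp
  moreover have "a y * x av = (k * l) * (al y * x nv)"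
    by (simp add: kl dual_scl[OF x])
  ultimately have "a y * x av = al y * x nv" by simp
  moreover have "x y - x (act_h s y) = al y * x nv"
  proof -
    have "x y - x (act_h s y) = - (act_dual s x y - x y)" by (simp add: act_dual_def inv)
    then show ?thesis unfolding x_s[OF x] by simp
  qed
  ultimately show ?thesis by (simp add: av)
qed

text \<open>
  The image of \<open>s - 1 = - n n\<^sup>T\<close> is the line through \<open>n\<close>.
\<close>

lemma rank_reflection:
  fixes s :: "real ^ 'n ^ ('n::finite)" and n :: "'n \<Rightarrow> real"
  assumes s: "\<And>i j. s $ i $ j = (if i = j then 1 else 0) - n i * n j" and n2: "(\<Sum>i\<in>UNIV. n i * n i) = 2"
  shows "rank (s - mat 1) = 1"
proof -
  define nv :: "real ^ 'n" where "nv = (\<chi> i. n i)"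
  have m: "(s - mat 1) *v x = (- (nv \<bullet> x)) *\<^sub>R nv" for x
    by (auto simp: vec_eq_iff matrix_vector_mult_def s mat_def nv_def inner_vec_def sum_distrib_left sum_negf
        mult_ac intro!: sum.cong simp flip: sum_negf)
  have nn: "nv \<bullet> nv = 2" using n2 by (simp add: nv_def inner_vec_def)
  have "range (\<lambda>x. (s - mat 1) *v x) = span {nv}"
    unfolding span_singleton m
  proof safe
    fix x show "(- (nv \<bullet> x)) *\<^sub>R nv \<in> range (\<lambda>k. k *\<^sub>R nv)" by (rule rangeI)
  next
    fix k show "k *\<^sub>R nv \<in> range (\<lambda>x. (- (nv \<bullet> x)) *\<^sub>R nv)"
      by (rule image_eqI[of _ _ "(- k / 2) *\<^sub>R nv"]) (simp_all add: nn)
  qed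
  moreover have "nv \<noteq> 0" using nn by auto
  ultimately show ?thesis unfolding rank_dim_range by simp
qed

lemma rotation_nth [simp]:
  "rotation t $ 1 $ 1 = cos t" "rotation t $ 1 $ 2 = - sin t" "rotation t $ 2 $ 1 = sin t" "rotation t $ 2 $ 2 = cos t"
  by (simp_all add: rotation_def)

lemma axis_reflection_nth [simp]:
  "axis_reflection $ 1 $ 1 = 1" "axis_reflection $ 1 $ 2 = 0" "axis_reflection $ 2 $ 1 = 0" "axis_reflection $ 2 $ 2 = -1"
  by (simp_all add: axis_reflection_def)

lemmas matrix2_simps = vec_eq_iff forall_2 matrix_matrix_mult_def sum_2 mat_def transpose_def

lemma rotation_add: "rotation a ** rotation b = rotation (a + b)"
  by (simp add: matrix2_simps cos_add sin_add algebra_simps)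

lemma rotation_0: "rotation 0 = mat 1"
  by (simp add: matrix2_simps)

lemma rotation_reflect: "axis_reflection ** rotation a = rotation (- a) ** axis_reflection"
  by (simp add: matrix2_simps)

lemma axis_reflection_invol: "axis_reflection ** axis_reflection = mat 1"
  by (simp add: matrix2_simps)

lemma transpose_rotation: "transpose (rotation a) = rotation (- a)"
  by (simp add: matrix2_simps)

lemma transpose_axis_reflection: "transpose axis_reflection = axis_reflection"
  by (simp add: matrix2_simps)

locale dihedral_group =
  fixes m :: nat
  assumes m3: "3 \<le> m"
begin

definition ang :: "int \<Rightarrow> real" where "ang k = 2 * pi * of_int k / real m"
definition rot :: "int \<Rightarrow> real ^ 2 ^ 2" where "rot k = rotation (ang k)"
definition rf :: "int \<Rightarrow> real ^ 2 ^ 2" where "rf k = rot k ** axis_reflection"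

lemma ang_add: "ang (j + k) = ang j + ang k" and ang_minus: "ang (- k) = - ang k" and ang_0: "ang 0 = 0"
  by (simp_all add: ang_def distrib_left add_divide_distrib)

lemma ang_mod: "ang k = ang (k mod int m) + 2 * pi * of_int (k div int m)"
proof -
  have "real_of_int k = of_int (k mod int m) + real m * of_int (k div int m)"
    by (metis mult_div_mod_eq add.commute of_int_add of_int_mult of_int_of_nat_eq)
  then show ?thesis using m3 by (simp add: ang_def field_simps)
qed

lemma rot_add: "rot j ** rot k = rot (j + k)"
  by (simp add: rot_def rotation_add ang_add)

lemma rot_0: "rot 0 = mat 1"
  by (simp add: rot_def ang_0 rotation_0)

lemma rot_mod: "rot k = rot (k mod int m)"
proof -
  have "rot k = rotation (ang (k mod int m) + 2 * pi * of_int (k div int m))"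
    unfolding rot_def by (subst ang_mod) simp
  also have "\<dots> = rot (k mod int m)"
    by (simp add: rot_def matrix2_simps cos_add sin_add cos_int_2pin sin_int_2pin)
  finally show ?thesis .
qed

lemma range_mod: 
  assumes "\<And>k. f k = f (k mod int m)"
  shows "range f = (\<lambda>k. f (int k)) ` {..<m}"
proof -
  have "f k \<in> (\<lambda>k. f (int k)) ` {..<m}" for k
    using m3 assms[of k] by (intro image_eqI[of _ _ "nat (k mod int m)"]) (auto simp: nat_less_iff)
  then show ?thesis by auto
qed

lemma rf_mod: "rf k = rf (k mod int m)"
  unfolding rf_def using rot_mod[of k] by simp

lemma dihedral_eq: "dihedral m = range rot \<union> range rf"
  unfolding range_mod[of rot, OF rot_mod] range_mod[of rf, OF rf_mod] dihedral_def
  by (simp add: rot_def rf_def ang_def)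

lemma rot_mem: "rot k \<in> dihedral m" and rf_mem: "rf k \<in> dihedral m"
  by (auto simp: dihedral_eq)

lemma rf_0: "rf 0 = axis_reflection"
  by (simp add: rf_def rot_0)

lemma mult_rules:
  "rot j ** rf k = rf (j + k)" "rf j ** rot k = rf (j - k)" "rf j ** rf k = rot (j - k)"
proof -
  have fr: "axis_reflection ** rot k = rot (- k) ** axis_reflection" for k
    by (simp add: rot_def rotation_reflect ang_minus)
  show "rot j ** rf k = rf (j + k)" by (simp add: rf_def matrix_mul_assoc rot_add)
  show a: "rf j ** rot k = rf (j - k)" for j k
    unfolding rf_def matrix_mul_assoc[symmetric] fr unfolding matrix_mul_assoc rot_add by simp
  have "rf j ** rf k = (rf j ** rot k) ** axis_reflection" by (simp add: rf_def matrix_mul_assoc)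
  also have "\<dots> = rot (j - k)"
    unfolding a by (simp add: rf_def matrix_mul_assoc[symmetric] axis_reflection_invol)
  finally show "rf j ** rf k = rot (j - k)" .
qed

lemma transpose_rules: "transpose (rot k) = rot (- k)" "transpose (rf k) = rf k"
proof -
  show 1: "transpose (rot k) = rot (- k)" for k by (simp add: rot_def transpose_rotation ang_minus)
  have "transpose (rf k) = axis_reflection ** rot (- k)"
    by (simp add: rf_def matrix_transpose_mul 1 transpose_axis_reflection)
  also have "\<dots> = rf k" unfolding rf_0[symmetric] mult_rules by simp
  finally show "transpose (rf k) = rf k" .
qed

text \<open>
  The vector of length \<open>\<surd>2\<close> normal to the mirror of \<open>rf k\<close>, which encloses half the angle of \<open>rot k\<close>
  with the first axis.
\<close>

definition nvec :: "int \<Rightarrow> 2 \<Rightarrow> real"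
  where "nvec k i = (if i = 1 then sqrt 2 * sin (ang k / 2) else - sqrt 2 * cos (ang k / 2))"

lemma rf_nth: "rf k $ 1 $ 1 = cos (ang k)" "rf k $ 1 $ 2 = sin (ang k)" "rf k $ 2 $ 1 = sin (ang k)" "rf k $ 2 $ 2 = - cos (ang k)"
  by (simp_all add: rf_def rot_def matrix_matrix_mult_def sum_2)

lemma rf_nvec: "rf k $ i $ j = (if i = j then 1 else 0) - nvec k i * nvec k j"
proof -
  have 1: "cos (ang k) = 1 - 2 * (sin (ang k / 2) * sin (ang k / 2))"
    using cos_double_sin[of "ang k / 2"] by (simp add: power2_eq_square)
  have 2: "cos (ang k) = 2 * (cos (ang k / 2) * cos (ang k / 2)) - 1"
    using cos_double_cos[of "ang k / 2"] by (simp add: power2_eq_square)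
  have 3: "sin (ang k) = 2 * (sin (ang k / 2) * cos (ang k / 2))"
    using sin_double[of "ang k / 2"] by simp
  have 4: "sqrt 2 * (sqrt 2 * a) = 2 * a" for a
    by (simp flip: mult.assoc)
  consider "i = 1" "j = 1" | "i = 1" "j = 2" | "i = 2" "j = 1" | "i = 2" "j = 2"
    using exhaust_2 by blast
  then show ?thesis
  proof cases
    assume ij: "i = 1" "j = 1"
    show ?thesis by (simp add: ij rf_nth nvec_def 4 mult_ac) (use 1 in \<open>simp add: mult_ac\<close>)
  next
    assume ij: "i = 1" "j = 2"
    show ?thesis by (simp add: ij rf_nth nvec_def 4 mult_ac) (use 3 in \<open>simp add: mult_ac\<close>)
  next
    assume ij: "i = 2" "j = 1"
    show ?thesis by (simp add: ij rf_nth nvec_def 4 mult_ac) (use 3 in \<open>simp add: mult_ac\<close>)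
  next
    assume ij: "i = 2" "j = 2"
    show ?thesis by (simp add: ij rf_nth nvec_def 4 mult_ac) (use 2 in \<open>simp add: mult_ac\<close>)
  qed
qed

lemma nvec_norm: "(\<Sum>i\<in>UNIV. nvec k i * nvec k i) = 2"
proof -
  have 4: "sqrt 2 * (sqrt 2 * a) = 2 * a" for a
    by (simp flip: mult.assoc)
  have "(\<Sum>i\<in>UNIV. nvec k i * nvec k i)
      = 2 * (sin (ang k / 2) * sin (ang k / 2)) + 2 * (cos (ang k / 2) * cos (ang k / 2))"
    by (simp add: sum_2 nvec_def 4 mult_ac)
  then show ?thesis
    using sin_cos_squared_add[of "ang k / 2"] unfolding power2_eq_square by linarith
qed

text \<open>
  A rotation is either trivial, and then the rank is 0, or has no nonzero fixed vector, and then it is 2.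
\<close>

lemma rank_rot: "rank (rot k - mat 1) \<noteq> 1"
proof (cases "cos (ang k) = 1")
  case True
  then have "sin (ang k) = 0" by (simp add: cos_one_sin_zero)
  then have "rot k - mat 1 = 0" using True by (simp add: matrix2_simps rot_def)
  then show ?thesis by simp
next
  case False
  have "det (rot k - mat 1) = (cos (ang k) - 1)\<^sup>2 + (sin (ang k))\<^sup>2"
    by (simp add: det_2 mat_def rot_def power2_eq_square)
  also have "\<dots> > 0" using False by (simp add: sum_power2_gt_zero_iff)
  finally have "invertible (rot k - mat 1)" by (simp add: invertible_det_nz)
  then have "rank (rot k - mat 1) = CARD(2)"
    unfolding full_rank_injective by (rule inj_matrix_vector_mult)
  then show ?thesis by simp
qed

lemma reflections_eq: "reflections (dihedral m) = range rf"
  using rank_reflection[OF rf_nvec nvec_norm] rank_rot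
  by (auto simp: reflections_def dihedral_eq)

lemma finite_dihedral: "finite (dihedral m)"
  by (simp add: dihedral_def)

lemma refl_rep_dihedral:
  assumes "is_rep (dihedral m) \<tau>"
  shows "refl_rep (dihedral m) (reflections (dihedral m)) \<tau>"
proof
  show "finite (dihedral m)" by (rule finite_dihedral)
  show "mat 1 \<in> dihedral m" using rot_mem[of 0] by (simp add: rot_0)
  fix g h assume "g \<in> dihedral m" "h \<in> dihedral m"
  then show "g ** h \<in> dihedral m"
    by (auto simp: dihedral_eq mult_rules rot_add)
next
  fix g assume "g \<in> dihedral m"
  then show "transpose g \<in> dihedral m" by (auto simp: dihedral_eq transpose_rules)
next
  fix g assume "g \<in> dihedral m"
  then show "transpose g ** g = mat 1" by (auto simp: dihedral_eq transpose_rules mult_rules rot_add rot_0)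
next
  show "reflections (dihedral m) \<subseteq> dihedral m" by (auto simp: reflections_def)
next
  fix s assume "s \<in> reflections (dihedral m)"
  then obtain k where "s = rf k" by (auto simp: reflections_eq)
  then show "\<exists>n. \<forall>i j. s $ i $ j = (if i = j then 1 else 0) - n i * n j" using rf_nvec by blast
next
  fix g s assume "g \<in> dihedral m" "s \<in> reflections (dihedral m)"
  then show "g ** s ** transpose g \<in> reflections (dihedral m)"
    unfolding reflections_eq by (auto simp: dihedral_eq transpose_rules mult_rules rot_add)
next
  show "is_rep (dihedral m) \<tau>" by (rule assms)
qed

lemma cherednik_form_dihedral:
  assumes "is_rep (dihedral m) \<tau>" "invariant_inner_product (dihedral m) \<tau> \<beta>0"
  shows "cherednik_form (dihedral m) \<tau> \<beta>0"
proof (intro cherednik_form.intro refl_form.intro cherednik_form_axioms.intro refl_form_axioms.intro)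
  show "refl_rep (dihedral m) (reflections (dihedral m)) \<tau>" by (rule refl_rep_dihedral[OF assms(1)])
  show "invariant_inner_product (dihedral m) \<tau> \<beta>0" by (rule assms)
  fix s y and x :: "complex ^ 2 \<Rightarrow> complex" assume "s \<in> reflections (dihedral m)" and x: "x \<in> dual_space"
  then obtain k where k: "s = rf k" by (auto simp: reflections_eq)
  show "fst (root_pair s) y * x (snd (root_pair s)) = x y - x (act_h s y)"
    unfolding k by (rule root_pair_of_reflection[OF rf_nvec nvec_norm x])
qed

text \<open>
  A geometric sum of powers of an \<open>m\<close>-th root of unity other than 1.
\<close>

lemma cis_sum_eq_0:
  assumes "0 < \<bar>j\<bar>" "\<bar>j\<bar> < int m"
  shows "(\<Sum>k<m. cis (ang (j * int k))) = 0"
proof -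
  have pos: "(\<Sum>k<m. cis (ang (j * int k))) = 0" if j: "0 < j" "j < int m" for j
  proof -
    let ?x = "cis (ang j)"
    have p: "?x ^ k = cis (ang (j * int k))" for k
      by (simp only: Complex.DeMoivre) (simp add: ang_def mult_ac)
    have "ang (j * int m) = 2 * pi * of_int j" using m3 by (simp add: ang_def)
    then have "?x ^ m = 1" unfolding p by (simp add: cis_multiple_2pi)
    moreover have "?x \<noteq> 1"
    proof
      assume "?x = 1"
      have inj: "inj_on (\<lambda>k. cis (2 * pi * real k / real m)) {..<m}"
        using Complex.bij_betw_roots_unity[of m] m3 by (simp add: bij_betw_def)
      have "nat j = 0"
        by (rule inj_onD[OF inj]) (use j m3 \<open>?x = 1\<close> in \<open>auto simp: ang_def\<close>)
      then show False using j by simp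
    qed
    ultimately have "(\<Sum>k<m. ?x ^ k) = 0" by (simp add: geometric_sum)
    then show ?thesis unfolding p .
  qed
  show ?thesis
  proof (cases "0 < j")
    case True then show ?thesis using pos assms by simp
  next
    case False
    have "(\<Sum>k<m. cis (ang ((- j) * int k))) = 0" using pos[of "- j"] False assms by simp
    moreover have "cis (ang (j * int k)) = cnj (cis (ang ((- j) * int k)))" for k
      by (simp add: ang_minus cis_cnj)
    ultimately show ?thesis by (metis (no_types, lifting) cnj_sum complex_cnj_zero sum.cong)
  qed
qed

lemma rot_inj: "inj_on (\<lambda>k. rot (int k)) {..<m}"
proof (rule inj_onI)
  fix j k assume jk: "j \<in> {..<m}" "k \<in> {..<m}" "rot (int j) = rot (int k)"
  have "cis (ang (int j)) = cis (ang (int k))"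
    using arg_cong[OF jk(3), of "\<lambda>g. g $ 1 $ 1"] arg_cong[OF jk(3), of "\<lambda>g. g $ 2 $ 1"]
    by (simp add: rot_def complex_eq_iff)
  moreover have inj: "inj_on (\<lambda>k. cis (2 * pi * real k / real m)) {..<m}"
    using Complex.bij_betw_roots_unity[of m] m3 by (simp add: bij_betw_def)
  ultimately show "j = k" using jk by (intro inj_onD[OF inj]) (auto simp: ang_def)
qed

lemma sum_reflections: "(\<Sum>s\<in>reflections (dihedral m). f s) = (\<Sum>k<m. f (rf (int k)))"
proof -
  have inj: "inj_on (\<lambda>k. rf (int k)) {..<m}"
  proof (rule inj_onI)
    fix j k assume jk: "j \<in> {..<m}" "k \<in> {..<m}" "rf (int j) = rf (int k)"
    have "rf (int j) ** rf 0 = rf (int k) ** rf 0" using jk by simp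
    then have "rot (int j) = rot (int k)" by (simp add: mult_rules)
    then show "j = k" using rot_inj jk by (auto dest: inj_onD)
  qed
  show ?thesis unfolding reflections_eq range_mod[of rf, OF rf_mod]
    by (simp add: sum.reindex[OF inj])
qed

text \<open>
  Translations and the inversion permute the residues modulo \<open>m\<close>.
\<close>

lemma sum_rot_mod: 
  assumes f: "\<And>k. f k = f (k mod int m)" and e: "e = 1 \<or> e = -1"
  shows "(\<Sum>k<m. f (e * int k + j)) = (\<Sum>k<m. f (int k))"
proof (rule sum.reindex_bij_witness[where i = "\<lambda>k. nat (e * (int k - j) mod int m)" and j = "\<lambda>k. nat ((e * int k + j) mod int m)"])
  have mp: "0 < int m" using m3 by simp
  fix k assume k: "k \<in> {..<m}"
  have ee: "e * e = 1" using e by auto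
  have "e * ((e * int k + j) mod int m - j) mod int m = e * ((e * int k + j) - j) mod int m"
    by (metis mod_diff_left_eq mod_mult_right_eq)
  also have "e * ((e * int k + j) - j) = int k" using ee by (simp add: mult.assoc[symmetric])
  finally show "nat (e * (int (nat ((e * int k + j) mod int m)) - j) mod int m) = k" using mp k by simp
  have "(e * (e * (int k - j) mod int m) + j) mod int m = (e * (e * (int k - j)) + j) mod int m"
    by (metis mod_add_left_eq mod_mult_right_eq)
  also have "e * (e * (int k - j)) + j = int k" using ee by (simp add: mult.assoc[symmetric])
  finally show "nat ((e * int (nat (e * (int k - j) mod int m)) + j) mod int m) = k" using mp k by simp
  show "nat ((e * int k + j) mod int m) \<in> {..<m}" "nat (e * (int k - j) mod int m) \<in> {..<m}"
    using mp by (simp_all add: nat_less_iff)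
  show "f (int (nat ((e * int k + j) mod int m))) = f (e * int k + j)"
    using mp f[of "e * int k + j"] by simp
qed

end

section \<open>The sum of the reflections in a dihedral group\<close>

locale dihedral_form = dihedral_group m + cherednik_irr "dihedral m" c \<tau> \<beta>0 "complex_of_real r"
  for m :: nat and c :: real and \<tau> :: "(2, 'k::finite) grp_rep"
    and \<beta>0 :: "complex ^ 'k \<Rightarrow> complex ^ 'k \<Rightarrow> complex" and r :: real
begin

text \<open>
  The sum \<open>P\<close> of all rotations. With \<open>\<sigma>\<close> the reflection \<open>rf 0\<close>, the sum of the reflections is
  \<open>Z = P \<sigma> = \<sigma> P\<close>, and \<open>P\<^sup>2 = m P\<close>; hence \<open>Z\<^sup>3 = m\<^sup>2 Z\<close>.
\<close>

definition rot_sum :: "(2, 'k) tens \<Rightarrow> (2, 'k) tens"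
  where "rot_sum u = (\<Sum>k<m. rho (rot (int k)) u)"

lemma linop_rot_sum: "linop rot_sum"
  unfolding rot_sum_def[abs_def] by (intro linop_sumop linop_rho)

lemma rho_rf: "rho (rf k) u = rho (rot k) (rho (rf 0) u)"
  using rho_mult[OF rot_mem rf_mem, of k 0 u] by (simp add: mult_rules)

lemma refl_sum_rot_sum: "refl_sum u = rot_sum (rho (rf 0) u)"
  unfolding refl_sum_def rot_sum_def sum_reflections by (simp only: rho_rf[symmetric])

lemma rot_sum_mod: "e = 1 \<or> e = -1 \<Longrightarrow> (\<Sum>k<m. rho (rot (e * int k + j)) u) = rot_sum u"
  unfolding rot_sum_def by (rule sum_rot_mod) (simp_all add: rot_mod[symmetric])

lemma rot_sum_rot: "rot_sum (rho (rot j) u) = rot_sum u"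
proof -
  have "rot_sum (rho (rot j) u) = (\<Sum>k<m. rho (rot (1 * int k + j)) u)"
    unfolding rot_sum_def by (simp only: rho_mult[OF rot_mem rot_mem, symmetric] rot_add mult_1)
  then show ?thesis by (simp only: rot_sum_mod simp_thms)
qed

lemma rot_sum_rot_sum: "rot_sum (rot_sum u) = scl (of_nat m) (rot_sum u)"
proof -
  have "rot_sum (rot_sum u) = (\<Sum>k<m. rot_sum (rho (rot (int k)) u))"
    unfolding rot_sum_def[of u] by (rule linop_sum[OF linop_rot_sum])
  also have "\<dots> = scl (of_nat m) (rot_sum u)"
  proof -
    have "(\<Sum>k<n. rot_sum u) = scl (of_nat n) (rot_sum u)" for n :: nat
      by (induction n) (simp_all add: tm.scale_left_distrib add.commute del: sum_constant)
    then show ?thesis unfolding rot_sum_rot .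
  qed
  finally show ?thesis .
qed

lemma rf_rot_sum: "rho (rf 0) (rot_sum u) = rot_sum (rho (rf 0) u)"
proof -
  have 1: "rho (rf 0) (rho (rot j) u) = rho (rot (- j)) (rho (rf 0) u)" for j
    by (simp only: rho_mult[OF rf_mem rot_mem, symmetric] rho_mult[OF rot_mem rf_mem, symmetric] mult_rules diff_0 add_0_right)
  have "rho (rf 0) (rot_sum u) = (\<Sum>k<m. rho (rot (-1 * int k + 0)) (rho (rf 0) u))"
    unfolding rot_sum_def by (simp only: rho_rules 1 mult_minus1 add_0_right)
  then show ?thesis by (simp only: rot_sum_mod simp_thms)
qed

lemma rf_rf: "rho (rf 0) (rho (rf 0) u) = u"
  using rho_mult[OF rf_mem rf_mem, of 0 0 u] by (simp add: mult_rules rot_0 rho_one)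

lemma refl_sum_cubed: "refl_sum (refl_sum (refl_sum u)) = scl (of_nat m * of_nat m) (refl_sum u)"
  by (simp only: refl_sum_rot_sum rf_rot_sum[symmetric] rf_rf rot_sum_rot_sum linop_rules[OF linop_rot_sum] linop_rules[OF linop_rho] tm.scale_scale)

lemma dform_eigen_orthogonal:
  assumes "refl_sum u = scl (of_real a) u" "refl_sum v = scl (of_real b) v" "a \<noteq> b"
  shows "dform k u v = 0"
proof -
  have "of_real a * dform k u v = dform k (refl_sum u) v" unfolding assms(1) by (simp only: dform_rules)
  also have "\<dots> = dform k u (refl_sum v)" by (rule dform_refl_sum)
  also have "\<dots> = of_real b * dform k u v" unfolding assms(2) by (simp add: dform_rules)
  finally show ?thesis using assms(3) by simp
qed

lemma psd_0: "psd 0"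
  unfolding psd_def by (simp add: inner_nonneg)

text \<open>
  Since \<open>Z\<^sup>3 = m\<^sup>2 Z\<close>, a tensor is the sum of eigenvectors for \<open>m\<close>, \<open>- m\<close> and 0, and these are
  orthogonal because \<open>Z\<close> is self-adjoint. The first alternative of the last assumption says that the
  nonzero eigenvalues do not occur in this degree.
\<close>

lemma psd_Suc:
  assumes p: "psd k" and e0: "0 \<le> real (Suc k) - c * r"
    and e: "(\<forall>u w. length w = Suc k \<longrightarrow> refl_sum u w = 0) \<or>
      0 \<le> real (Suc k) + c * (real m - r) \<and> 0 \<le> real (Suc k) + c * (- real m - r)"
  shows "psd (Suc k)"
  unfolding psd_def
proof (intro allI impI)
  fix u :: "(2, 'k) tens" assume u: "fsupp u"
  define a :: complex where "a = of_nat m"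
  have a0: "a \<noteq> 0" using m3 by (simp add: a_def)
  \<comment> \<open>the projections to the eigenvalues \<open>\<plusminus> m\<close> are \<open>(Z\<^sup>2 \<plusminus> m Z) / (2 m\<^sup>2)\<close>\<close>
  define d :: complex where "d = inverse (2 * a * a)"
  have da: "d * (a * a) + d * (a * a) = 1" using a0 by (simp add: d_def field_simps)
  define v where "v = refl_sum (refl_sum u)"
  define z where "z = refl_sum u"
  have zz: "refl_sum z = v" "refl_sum v = scl (a * a) z" by (simp_all add: v_def z_def refl_sum_cubed a_def)
  define p where "p = scl d v + scl (d * a) z"
  define q where "q = scl d v - scl (d * a) z"
  define n where "n = u - scl (d + d) v"
  have fz: "fsupp (refl_sum w)" if "fsupp w" for w unfolding refl_sum_def by (intro fsupp_sum fsupp_ops that)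
  have f: "fsupp p" "fsupp q" "fsupp n"
    unfolding p_def q_def n_def v_def z_def by (intro fsupp_rules fz u)+
  note lz = linop_rules[OF linop_refl_sum]
  have zp: "refl_sum p = scl (of_real (real m)) p"
    unfolding p_def by (simp add: lz zz tm.scale_right_distrib mult_ac add.commute flip: a_def)
  have zq: "refl_sum q = scl (of_real (- real m)) q"
    unfolding q_def by (simp add: lz zz tm.scale_right_diff_distrib mult_ac flip: a_def)
  have zo: "refl_sum n = scl (of_real 0) n"
  proof -
    have "refl_sum n = z - scl ((d + d) * (a * a)) z" unfolding n_def by (simp add: lz zz z_def)
    also have "(d + d) * (a * a) = 1" using da by (simp only: distrib_right)
    finally show ?thesis by simp
  qed
  have sum: "u = p + q + n"
  proof -
    have "p + q + n = u + (scl d v + scl d v - scl (d + d) v)"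
      unfolding p_def q_def n_def by (simp add: algebra_simps)
    then show ?thesis unfolding tm.scale_left_distrib diff_self add_0_right by (rule sym)
  qed
  have m0: "real m \<noteq> - real m" "real m \<noteq> 0" "- real m \<noteq> 0" using m3 by simp_all
  note ort = dform_eigen_orthogonal[OF zp zq] dform_eigen_orthogonal[OF zq zp] dform_eigen_orthogonal[OF zp zo]
    dform_eigen_orthogonal[OF zo zp] dform_eigen_orthogonal[OF zq zo] dform_eigen_orthogonal[OF zo zq]
  have split: "dform (Suc k) u u = dform (Suc k) p p + dform (Suc k) q q + dform (Suc k) n n"
    unfolding sum dform_add1 dform_add2 using m0 by (simp only: ort not_sym add_0_left add_0_right not_False_eq_True)
  have no: "0 \<le> Re (dform (Suc k) n n)"
    by (rule psd_eigen[OF sZ p f(3) zo HOL.refl]) (use e0 in simp)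
  have "0 \<le> Re (dform (Suc k) p p) \<and> 0 \<le> Re (dform (Suc k) q q)"
    using e
  proof
    assume h: "\<forall>u w. length w = Suc k \<longrightarrow> refl_sum u w = 0"
    have "dform (Suc k) p p = dform (Suc k) p 0" "dform (Suc k) q q = dform (Suc k) q 0"
      by (rule dform_cong2; use h in \<open>simp add: p_def q_def v_def z_def pointwise\<close>)+
    then show ?thesis by simp
  next
    assume h: "0 \<le> real (Suc k) + c * (real m - r) \<and> 0 \<le> real (Suc k) + c * (- real m - r)"
    show ?thesis using psd_eigen[OF sZ p f(1) zp HOL.refl] psd_eigen[OF sZ p f(2) zq HOL.refl] h by blast
  qed
  then show "0 \<le> Re (dform (Suc k) u u)" unfolding split using no by simp
qed

text \<open>
  Up to the factor \<open>m\<close>, the projection to an eigenspace of the rotations.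
\<close>

definition twisted_sum :: "int \<Rightarrow> (2, 'k) tens \<Rightarrow> (2, 'k) tens"
  where "twisted_sum j u = (\<Sum>k<m. scl (cis (ang (j * int k))) (rho (rot (int k)) u))"

lemma twisted_sum_0: "twisted_sum 0 u = rot_sum u"
  by (simp add: twisted_sum_def rot_sum_def ang_0)

text \<open>
  The entries of a rotation are combinations of \<open>cis (ang k)\<close> and its inverse, so passing a letter
  shifts the twist by one in either direction.
\<close>

lemma cut_twisted_sum:
  "cut i (twisted_sum j u) = (\<Sum>l\<in>UNIV. scl (if i = l then 1/2 else if i = 1 then \<i>/2 else -\<i>/2) (twisted_sum (j + 1) (cut l u))
     + scl (if i = l then 1/2 else if i = 1 then -\<i>/2 else \<i>/2) (twisted_sum (j - 1) (cut l u)))"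
proof -
  let ?a = "\<lambda>l. (if i = l then 1/2 else if i = 1 then \<i>/2 else -\<i>/2 :: complex)"
  let ?b = "\<lambda>l. (if i = l then 1/2 else if i = 1 then -\<i>/2 else \<i>/2 :: complex)"
  have en: "en (rot k) i l = ?a l * cis (ang k) + ?b l * cis (- ang k)" for k l
  proof -
    consider "i = 1" "l = 1" | "i = 1" "l = 2" | "i = 2" "l = 1" | "i = 2" "l = 2"
      using exhaust_2 by blast
    then show ?thesis by cases (simp_all add: rot_def complex_eq_iff)
  qed
  have c: "cis (ang (j * k)) * en (rot k) i l = ?a l * cis (ang ((j + 1) * k)) + ?b l * cis (ang ((j - 1) * k))" for k l
  proof -
    have h: "cis (ang (j * k)) * cis (ang k) = cis (ang ((j + 1) * k))"
      "cis (ang (j * k)) * cis (- ang k) = cis (ang ((j - 1) * k))"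
      using ang_add[of "j * k" k] ang_add[of "j * k" "- k"] ang_minus[of k]
      by (simp_all add: cis_mult distrib_right left_diff_distrib)
    show ?thesis unfolding en by (simp only: distrib_left mult.left_commute[of "cis _"] h)
  qed
  have "cut i (twisted_sum j u) = (\<Sum>k<m. \<Sum>l\<in>UNIV. scl (cis (ang (j * int k)) * en (rot (int k)) i l) (rho (rot (int k)) (cut l u)))"
    by (simp add: twisted_sum_def cut_rho tm.scale_sum_right)
  also have "\<dots> = (\<Sum>l\<in>UNIV. \<Sum>k<m. scl (cis (ang (j * int k)) * en (rot (int k)) i l) (rho (rot (int k)) (cut l u)))"
    by (rule sum.swap)
  finally show ?thesis
    unfolding c by (simp only: twisted_sum_def tm.scale_left_distrib sum.distrib tm.scale_sum_right tm.scale_scale)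
qed

text \<open>
  Passing the letters of \<open>w\<close> one by one, the twist moves from \<open>j\<close> to some \<open>j'\<close> at distance at most the
  length of \<open>w\<close> and of the same parity. For the trivial representation the parity matters: there the
  sum is zero for \<open>j' = \<plusminus> 1\<close> but not for \<open>j' = 0\<close>.
\<close>

lemma twisted_sum_vanish:
  assumes "\<And>j' v. \<bar>j' - j\<bar> \<le> int (length w) \<Longrightarrow> even (j' - j - int (length w)) \<Longrightarrow>
      (\<Sum>k<m. cis (ang (j' * int k)) *s (\<tau> (rot (int k)) *v v)) = 0"
  shows "twisted_sum j u w = 0"
  using assms
proof (induction w arbitrary: j u)
  case Nil
  show ?case using Nil[of j "u []"] by (simp add: twisted_sum_def sum_fun_apply pointwise)
next
  case (Cons i w)
  have "twisted_sum (j + 1) (cut l u) w = 0" "twisted_sum (j - 1) (cut l u) w = 0" for l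
    by (rule Cons.IH; rule Cons.prems; simp; presburger?)+
  moreover have "twisted_sum j u (i # w) = cut i (twisted_sum j u) w" by (simp add: pointwise)
  ultimately show ?case unfolding cut_twisted_sum by (simp add: sum_fun_apply pointwise)
qed

lemma refl_sum_twisted_sum: "refl_sum u = twisted_sum 0 (rho (rf 0) u)"
  by (simp only: refl_sum_rot_sum twisted_sum_0)

end

section \<open>Bounds on the parameter\<close>

text \<open>
  The cancellations in the two commutation rules of \<open>z\<close> below.
\<close>

lemma group_identities:
  fixes u a b x :: "'a::ab_group_add"
  shows "(u - a) + x - x + (u - b) = (u + u) - (a + b)"
    and "(u - a) + x + x - (u - b) = b - a + (x + x)"
  by (simp_all add: algebra_simps)

context dihedral_form
begin

lemma bracket_entries:
  "bracket 1 1 u = u - scl (of_real c) (\<Sum>k<m. scl (1 - of_real (cos (ang (int k)))) (rho (rf (int k)) u))"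
  "bracket 2 2 u = u - scl (of_real c) (\<Sum>k<m. scl (1 + of_real (cos (ang (int k)))) (rho (rf (int k)) u))"
  "bracket 1 2 u = scl (of_real c) (\<Sum>k<m. scl (of_real (sin (ang (int k)))) (rho (rf (int k)) u))"
  "bracket 2 1 u = scl (of_real c) (\<Sum>k<m. scl (of_real (sin (ang (int k)))) (rho (rf (int k)) u))"
  by (simp_all add: bracket_def sum_reflections rf_nth sum_negf)

text \<open>
  The factors in \<open>psd_Suc\<close> are \<open>k\<close>, \<open>k - c e m\<close> and \<open>k - 2 c e m\<close>. The last one can be negative
  for \<open>k = 1\<close> only, and in degree 1 there is no vector invariant under rotations.
\<close>

lemma psd_character:
  assumes rt: "\<And>k v. \<tau> (rot k) *v v = v" and e: "e = 1 \<or> e = -1" "r = e * real m"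
    and c: "c * e * real m \<le> 1"
  shows "psd n"
proof (induction n)
  case 0 show ?case by (rule psd_0)
next
  case (Suc n)
  have cr: "c * r \<le> 1" using c e(2) by (simp add: mult.assoc)
  show ?case
  proof (rule psd_Suc[OF Suc])
    show "0 \<le> real (Suc n) - c * r" using cr by simp
    show "(\<forall>u w. length w = Suc n \<longrightarrow> refl_sum u w = 0) \<or>
      0 \<le> real (Suc n) + c * (real m - r) \<and> 0 \<le> real (Suc n) + c * (- real m - r)"
    proof (cases n)
      case 0
      have "refl_sum u w = 0" if "length w = 1" for u w
        unfolding refl_sum_twisted_sum
      proof (rule twisted_sum_vanish)
        fix j' v assume "\<bar>j' - 0\<bar> \<le> int (length w)" "even (j' - 0 - int (length w))"
        then have "\<bar>j'\<bar> = 1" using that by presburger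
        then have "(\<Sum>k<m. cis (ang (j' * int k))) = 0" using m3 by (intro cis_sum_eq_0) auto
        then show "(\<Sum>k<m. cis (ang (j' * int k)) *s (\<tau> (rot (int k)) *v v)) = 0"
          unfolding rt by (simp flip: vec.scale_sum_left)
      qed
      then show ?thesis using 0 by simp
    next
      case (Suc i)
      have "c * (real m - r) = 0 \<or> c * (real m - r) = - 2 * (c * r)"
        "c * (- real m - r) = 0 \<or> c * (- real m - r) = - 2 * (c * r)"
        using e by (auto simp: algebra_simps)
      then show ?thesis using Suc cr by auto
    qed
  qed
qed

text \<open>
  For \<open>y = y_1\<close> and \<open>x = x_1\<close> the sum of \<open>x(y) - x(s y)\<close> over the reflections is \<open>m\<close>, so
  \<open>y x v = (1 - c e m) v\<close>.
\<close>

lemma character_bound: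
  assumes rt: "\<And>k v. \<tau> (rot k) *v v = v" and rfl: "\<And>k v. \<tau> (rf k) *v v = of_real e *s v"
    and p: "psd 1"
  shows "c * e * real m \<le> 1"
proof -
  obtain v :: "complex ^ 'k" where v: "v \<noteq> 0"
  proof
    show "(\<chi> i. 1) \<noteq> (0 :: complex ^ 'k)" by (simp add: vec_eq_iff)
  qed
  have "(\<Sum>k<m. cis (ang (1 * int k))) = 0" using m3 by (intro cis_sum_eq_0) auto
  then have "(\<Sum>k<m. cis (ang (int k))) = 0" by (simp only: mult_1)
  moreover have "(\<Sum>k<m. cos (ang (int k))) = Re (\<Sum>k<m. cis (ang (int k)))" by simp
  ultimately have "(\<Sum>k<m. cos (ang (int k))) = 0" by (simp only: zero_complex.sel)
  then have cs: "(\<Sum>k<m. 1 - complex_of_real (cos (ang (int k)))) = of_nat m"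
    by (simp only: sum_subtractf of_real_sum[symmetric] of_real_0) simp
  have re: "rho (rf k) (emb v) = scl (of_real e) (emb v)" for k
    by (simp only: rho_emb rfl emb_scl)
  have "bracket 1 1 (emb v) = emb v - scl (of_real c) (scl (of_nat m) (scl (of_real e) (emb v)))"
    unfolding bracket_entries(1) re tm.scale_sum_left[symmetric] cs ..
  then have "bracket 1 1 (emb v) = emb v - scl (of_real (c * e * real m)) (emb v)"
    by (simp only: tm.scale_scale of_real_mult of_real_of_nat_eq mult_ac)
  then have C: "lower 1 (raise 1 (emb v)) = emb v - scl (of_real (c * e * real m)) (emb v)"
    unfolding lower_raise lower_emb by (simp only: linop_0[OF linop_raise] add_0_left)
  have "dform 1 (raise 1 (emb v)) (raise 1 (emb v)) = dform 0 (lower 1 (raise 1 (emb v))) (emb v)"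
    unfolding One_nat_def by (rule dform_raise)
  also have "\<dots> = \<beta>0 v v - of_real (c * e * real m) * \<beta>0 v v"
    unfolding C dform_diff1 dform_scl1 by (simp only: dform.simps emb_simps)
  also have "\<dots> = of_real (1 - c * e * real m) * \<beta>0 v v"
    by (simp add: left_diff_distrib)
  finally have eq: "dform 1 (raise 1 (emb v)) (raise 1 (emb v)) = of_real (1 - c * e * real m) * \<beta>0 v v" .
  have "fsupp (raise 1 (emb v) :: (2, 'k) tens)" by (intro fsupp_rules)
  then have "0 \<le> Re (dform 1 (raise 1 (emb v)) (raise 1 (emb v)))"
    by (rule p[unfolded psd_def, rule_format])
  then have "0 \<le> Re (of_real (1 - c * e * real m) * \<beta>0 v v)" unfolding eq .
  moreover have "Re (of_real a * z) = a * Re z" for a z by simp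
  ultimately have "0 \<le> (1 - c * e * real m) * Re (\<beta>0 v v)" by (simp only:)
  then have "0 \<le> 1 - c * e * real m"
    using inner_pos[OF v] zero_le_mult_iff not_less by metis
  then show ?thesis by linarith
qed

end

text \<open>
  If the rotations act on a vector by \<open>cis (j * ang k)\<close>, call \<open>j\<close> an exponent of \<open>\<tau>\<close>. The vector \<open>ep\<close>
  has exponent \<open>l\<close>, and \<open>base\<close> says that no exponent has absolute value below \<open>l\<close>.
\<close>

locale dihedral_tau = dihedral_form m c \<tau> \<beta>0 0
  for m :: nat and c :: real and \<tau> :: "(2, 2) grp_rep"
    and \<beta>0 :: "complex ^ 2 \<Rightarrow> complex ^ 2 \<Rightarrow> complex" +
  fixes l :: nat and ep :: "complex ^ 2"
  assumes l1: "1 \<le> l" and lm: "2 * l < m"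
    and ep: "ep \<noteq> 0" "\<And>k. \<tau> (rot k) *v ep = cis (ang (int l * k)) *s ep"
    and base: "\<And>j v. \<bar>j\<bar> < int l \<Longrightarrow> (\<Sum>k<m. cis (ang (j * int k)) *s (\<tau> (rot (int k)) *v v)) = 0"
begin

text \<open>
  The sum of the reflections acts by 0 on \<open>\<tau>\<close>, so the factors in \<open>psd_Suc\<close> are \<open>k\<close> and \<open>k \<plusminus> c m\<close>. In
  degrees below \<open>l\<close> the twist cannot reach the exponents \<open>\<plusminus> l\<close>.
\<close>

lemma psd_tau:
  assumes c: "\<bar>c\<bar> * real m \<le> real l"
  shows "psd n"
proof (induction n)
  case 0 show ?case by (rule psd_0)
next
  case (Suc n)
  show ?case
  proof (rule psd_Suc[OF Suc])
    show "0 \<le> real (Suc n) - c * 0" by simp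
    show "(\<forall>u w. length w = Suc n \<longrightarrow> refl_sum u w = 0) \<or>
      0 \<le> real (Suc n) + c * (real m - 0) \<and> 0 \<le> real (Suc n) + c * (- real m - 0)"
    proof (cases "Suc n < l")
      case True
      have "refl_sum u w = 0" if "length w = Suc n" for u w
        unfolding refl_sum_twisted_sum
      proof (rule twisted_sum_vanish)
        fix j' v assume "\<bar>j' - 0\<bar> \<le> int (length w)"
        then have "\<bar>j'\<bar> < int l" using True that by linarith
        then show "(\<Sum>k<m. cis (ang (j' * int k)) *s (\<tau> (rot (int k)) *v v)) = 0"
          by (rule base)
      qed
      then show ?thesis by blast
    next
      case False
      then have "real l \<le> real (Suc n)" by (simp only: of_nat_le_iff not_less)
      moreover have "c * real m \<le> \<bar>c\<bar> * real m" by (rule mult_right_mono) simp_all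
      moreover have "- c * real m \<le> \<bar>c\<bar> * real m" by (rule mult_right_mono) simp_all
      ultimately have "- (c * real m) \<le> real (Suc n)" "c * real m \<le> real (Suc n)"
        using c by linarith+
      then show ?thesis unfolding diff_0_right mult_minus_right by linarith
    qed
  qed
qed

text \<open>
  Multiplication by \<open>z = x_1 + i x_2\<close>, on which rotations act by a scalar, its adjoint \<open>ya\<close>, and the
  mirror image \<open>yb\<close> of the adjoint.
\<close>

definition xz :: "(2, 2) tens \<Rightarrow> (2, 2) tens" where "xz u = raise 1 u + scl \<i> (raise 2 u)"
definition ya :: "(2, 2) tens \<Rightarrow> (2, 2) tens" where "ya u = lower 1 u - scl \<i> (lower 2 u)"
definition yb :: "(2, 2) tens \<Rightarrow> (2, 2) tens" where "yb u = lower 1 u + scl \<i> (lower 2 u)"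

lemma linop_xz: "linop xz" and linop_ya: "linop ya"
  unfolding xz_def[abs_def] ya_def[abs_def]
  by (intro linop_addop linop_diffop linop_sclop linop_raise linop_lower)+

text \<open>
  The tensors \<open>z\<^sup>j \<otimes> ep\<close>.
\<close>

primrec zpow :: "nat \<Rightarrow> (2, 2) tens" where
  "zpow 0 = emb ep"
| "zpow (Suc j) = xz (zpow j)"

definition zpow_refl :: "nat \<Rightarrow> (2, 2) tens" where "zpow_refl j = rho (rf 0) (zpow j)"

lemma i_scl: "\<i> * (\<i> * a) = - a" for a :: complex
  by (simp flip: mult.assoc)

lemma rho_xz: "rho (rot k) (xz u) = scl (cis (- ang k)) (xz (rho (rot k) u))"
proof -
  define p q where "p = raise 1 (rho (rot k) u)" "q = raise 2 (rho (rot k) u)"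
  let ?c = "complex_of_real (cos (ang k))" and ?s = "complex_of_real (sin (ang k))"
  have "rho (rot k) (xz u) = (scl ?c p + scl ?s q) + scl \<i> (scl (- ?s) p + scl ?c q)"
    by (simp add: xz_def rho_rules rho_raise sum_2 rot_def p_q_def)
  also have "\<dots> = scl (?c - \<i> * ?s) p + scl (?s + \<i> * ?c) q"
    by (simp only: tm.scale_right_distrib tm.scale_left_distrib tm.scale_left_diff_distrib tm.scale_scale
         mult_minus_right tm.scale_minus_left) simp
  also have "?s + \<i> * ?c = (?c - \<i> * ?s) * \<i>" by (simp add: algebra_simps i_scl)
  also have "?c - \<i> * ?s = cis (- ang k)" by (simp add: complex_eq_iff)
  finally show ?thesis by (simp add: xz_def p_q_def tm.scale_right_distrib)
qed

lemma rho_zpow: "rho (rot k) (zpow j) = scl (cis (ang ((int l - int j) * k))) (zpow j)"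
proof (induction j)
  case 0
  show ?case by (simp add: rho_emb ep emb_scl)
next
  case (Suc j)
  have "(int l - int j) * k + - k = (int l - int (Suc j)) * k" by (simp add: algebra_simps)
  then have "cis (- ang k) * cis (ang ((int l - int j) * k)) = cis (ang ((int l - int (Suc j)) * k))"
    using ang_add[of "(int l - int j) * k" "- k"] by (simp add: cis_mult ang_minus)
  then show ?case by (simp add: rho_xz Suc linop_rules[OF linop_xz])
qed

lemma rho_zpow_refl: "rho (rot k) (zpow_refl j) = scl (cis (ang ((int j - int l) * k))) (zpow_refl j)"
proof -
  have "rho (rot k) (zpow_refl j) = rho (rf 0) (rho (rot (- k)) (zpow j))"
    unfolding zpow_refl_def rho_mult[OF rot_mem rf_mem, symmetric] rho_mult[OF rf_mem rot_mem, symmetric] mult_rules by simp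
  moreover have "(int l - int j) * - k = (int j - int l) * k" by (simp add: algebra_simps)
  ultimately show ?thesis unfolding rho_zpow by (simp add: rho_rules zpow_refl_def)
qed

lemma rf_zpow_refl: "rho (rf 0) (zpow_refl j) = zpow j"
  by (simp add: zpow_refl_def rf_rf)

lemma ya_xz: "ya (xz u) = xz (ya u) + (scl 2 u - scl (2 * of_real c) (refl_sum u))"
proof -
  let ?C = "\<lambda>k. complex_of_real (cos (ang (int k)))" and ?R = "\<lambda>k. rho (rf (int k)) u"
  have "ya (xz u) = xz (ya u) + (bracket 1 1 u + scl \<i> (bracket 1 2 u) - scl \<i> (bracket 2 1 u) + bracket 2 2 u)"
    by (simp add: ya_def xz_def lower_rules lower_raise linop_rules[OF linop_raise] tm.scale_right_distrib
        tm.scale_right_diff_distrib algebra_simps)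
  also have "bracket 1 1 u + scl \<i> (bracket 1 2 u) - scl \<i> (bracket 2 1 u) + bracket 2 2 u
     = (u + u) - (scl (of_real c) (\<Sum>k<m. scl (1 - ?C k) (?R k)) + scl (of_real c) (\<Sum>k<m. scl (1 + ?C k) (?R k)))"
    unfolding bracket_entries by (rule group_identities)
  also have "\<dots> = scl (1 + 1) u - scl (of_real c) (\<Sum>k<m. scl ((1 - ?C k) + (1 + ?C k)) (?R k))"
    by (simp only: tm.scale_left_distrib tm.scale_one tm.scale_right_distrib sum.distrib)
  also have "(\<Sum>k<m. scl ((1 - ?C k) + (1 + ?C k)) (?R k)) = scl 2 (refl_sum u)"
    by (simp add: refl_sum_def sum_reflections tm.scale_sum_right)
  finally show ?thesis by (simp add: mult.commute)
qed

lemma yb_xz: "yb (xz u) = xz (yb u) + scl (2 * of_real c) (\<Sum>k<m. scl (cis (ang (int k))) (rho (rf (int k)) u))"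
proof -
  let ?C = "\<lambda>k. complex_of_real (cos (ang (int k)))" and ?S = "\<lambda>k. complex_of_real (sin (ang (int k)))"
    and ?R = "\<lambda>k. rho (rf (int k)) u"
  let ?A = "\<Sum>k<m. scl (1 - ?C k) (?R k)" and ?B = "\<Sum>k<m. scl (1 + ?C k) (?R k)" and ?s = "\<Sum>k<m. scl (?S k) (?R k)"
  have "yb (xz u) = xz (yb u) + (bracket 1 1 u + scl \<i> (bracket 1 2 u) + scl \<i> (bracket 2 1 u) - bracket 2 2 u)"
    by (simp add: yb_def xz_def lower_rules lower_raise linop_rules[OF linop_raise] tm.scale_right_distrib
        tm.scale_right_diff_distrib algebra_simps)
  also have "bracket 1 1 u + scl \<i> (bracket 1 2 u) + scl \<i> (bracket 2 1 u) - bracket 2 2 u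
     = scl (of_real c) ?B - scl (of_real c) ?A + (scl \<i> (scl (of_real c) ?s) + scl \<i> (scl (of_real c) ?s))"
    unfolding bracket_entries by (rule group_identities)
  also have "\<dots> = scl (of_real c) (?B - ?A + (scl \<i> ?s + scl \<i> ?s))"
    by (simp only: tm.scale_right_distrib tm.scale_right_diff_distrib tm.scale_left_commute[of \<i> "complex_of_real c"])
  also have "?B - ?A + (scl \<i> ?s + scl \<i> ?s)
      = (\<Sum>k<m. scl ((1 + ?C k) - (1 - ?C k) + (\<i> * ?S k + \<i> * ?S k)) (?R k))"
    by (simp only: tm.scale_left_distrib tm.scale_left_diff_distrib tm.scale_sum_right tm.scale_scale sum.distrib sum_subtractf)
  also have "\<dots> = scl 2 (\<Sum>k<m. scl (cis (ang (int k))) (?R k))"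
  proof -
    have "(1 + ?C k) - (1 - ?C k) + (\<i> * ?S k + \<i> * ?S k) = 2 * cis (ang (int k))" for k
      by (simp add: complex_eq_iff)
    then show ?thesis by (simp only: tm.scale_sum_right tm.scale_scale)
  qed
  finally show ?thesis by (simp add: mult.commute)
qed

text \<open>
  A reflection maps \<open>z\<^sup>j \<otimes> ep\<close> to a multiple of its mirror image, and the factor is a character of the
  rotation part.
\<close>

lemma weighted_refl_sum_zpow:
  assumes "j < l"
  shows "(\<Sum>k<m. scl (cis (ang (i * int k))) (rho (rf (int k)) (zpow j)))
     = scl (\<Sum>k<m. cis (ang ((i + int j - int l) * int k))) (zpow_refl j)"
proof -
  have 1: "rho (rf k) (zpow j) = scl (cis (ang ((int j - int l) * k))) (zpow_refl j)" for k
    unfolding rho_rf[of k] using rho_zpow_refl[of k j] by (simp add: zpow_refl_def)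
  have "ang (i * k) + ang ((int j - int l) * k) = ang ((i + int j - int l) * k)" for k
    unfolding ang_add[symmetric] by (simp add: algebra_simps)
  then show ?thesis
    unfolding 1 by (simp add: tm.scale_sum_left cis_mult)
qed

lemma refl_sum_zpow: "j < l \<Longrightarrow> refl_sum (zpow j) = 0"
proof -
  assume j: "j < l"
  have "refl_sum (zpow j) = (\<Sum>k<m. scl (cis (ang (0 * int k))) (rho (rf (int k)) (zpow j)))"
    by (simp add: refl_sum_def sum_reflections ang_0)
  also have "\<dots> = 0"
    unfolding weighted_refl_sum_zpow[OF j] using j lm by (subst cis_sum_eq_0) auto
  finally show ?thesis .
qed

text \<open>
  Below degree \<open>l\<close> the sum of the reflections kills \<open>z\<^sup>j \<otimes> ep\<close>, so \<open>ya\<close> acts like twice the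
  derivative along \<open>z\<close>.
\<close>

lemma ya_zpow: "j \<le> l \<Longrightarrow> ya (zpow j) = scl (2 * of_nat j) (zpow (j - 1))"
proof (induction j)
  case 0 show ?case by (simp add: ya_def lower_emb)
next
  case (Suc j)
  have x: "xz (scl (2 * of_nat j) (zpow (j - 1))) = scl (2 * of_nat j) (zpow j)"
    by (cases j) (simp_all add: linop_rules[OF linop_xz])
  have "ya (zpow (Suc j)) = scl (2 * of_nat j) (zpow j) + scl 2 (zpow j)"
    using Suc by (simp add: ya_xz refl_sum_zpow x[unfolded One_nat_def])
  also have "\<dots> = scl (2 * of_nat (Suc j)) (zpow j)"
    by (simp only: tm.scale_left_distrib[symmetric]) (simp add: algebra_simps)
  finally show ?case by simp
qed

lemma yb_zpow_below: "j < l \<Longrightarrow> yb (zpow j) = 0"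
proof (induction j)
  case 0 show ?case by (simp add: yb_def lower_emb)
next
  case (Suc j)
  have "(\<Sum>k<m. cis (ang ((1 + int j - int l) * int k))) = 0"
    using Suc.prems lm by (intro cis_sum_eq_0) auto
  then have "(\<Sum>k<m. scl (cis (ang (1 * int k))) (rho (rf (int k)) (zpow j))) = 0"
    using Suc.prems by (subst weighted_refl_sum_zpow) auto
  then show ?case using Suc by (simp add: yb_xz linop_rules[OF linop_xz])
qed

text \<open>
  In degree \<open>l\<close> the reflections contribute for the first time: for \<open>j = l - 1\<close> the character in
  \<open>weighted_refl_sum_zpow\<close> cancels the weight.
\<close>

lemma yb_zpow_top: "yb (zpow l) = scl (2 * of_real c * of_nat m) (zpow_refl (l - 1))"
proof -
  obtain j where j: "l = Suc j" using l1 by (cases l) auto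
  have "(\<Sum>k<m. scl (cis (ang (1 * int k))) (rho (rf (int k)) (zpow j))) = scl (of_nat m) (zpow_refl j)"
    using j by (subst weighted_refl_sum_zpow) (auto simp: ang_0)
  then show ?thesis using yb_zpow_below[of j] unfolding j by (simp add: yb_xz linop_rules[OF linop_xz])
qed

lemma dform_xz: "dform (Suc n) u (xz v) = dform n (ya u) v"
  unfolding xz_def ya_def dform_add2 dform_scl2 dform_raise dform_diff1 dform_scl1 by simp

lemma dform_zpow_pos: "j < l \<Longrightarrow> 0 < Re (dform j (zpow j) (zpow j))"
proof (induction j)
  case 0 show ?case using inner_pos[OF ep(1)] by simp
next
  case (Suc j)
  have "dform (Suc j) (zpow (Suc j)) (zpow (Suc j)) = of_real (2 * real (Suc j)) * dform j (zpow j) (zpow j)"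
    unfolding zpow.simps(2)[of j] dform_xz unfolding zpow.simps(2)[symmetric]
    using ya_zpow[of "Suc j"] Suc.prems by (simp add: dform_scl1)
  then show ?case using Suc by simp
qed

lemma ya_rf: "ya (rho (rf 0) u) = rho (rf 0) (yb u)"
  unfolding ya_def yb_def
  by (simp add: rho_rules rho_lower[OF rf_mem] sum_2 rf_nth ang_0)

text \<open>
  For \<open>e = \<plusminus> 1\<close> take \<open>v = z\<^sup>l \<otimes> ep + e \<sigma> (z\<^sup>l \<otimes> ep)\<close>. As \<open>\<sigma> v = e v\<close>, both halves contribute the same
  to \<open>(v, v)\<close>, and \<open>ya v = 2 (l + e c m) z\<^bsup>l - 1\<^esup> \<otimes> ep\<close>. So \<open>(v, v)\<close> is \<open>4 (l + e c m)\<close> times the norm of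
  \<open>z\<^bsup>l - 1\<^esup> \<otimes> ep\<close>, which is positive.
\<close>

lemma tau_bound:
  assumes p: "psd l" and e: "e = 1 \<or> e = (-1 :: real)"
  shows "0 \<le> real l + e * c * real m"
proof -
  obtain j where j: "l = Suc j" using l1 by (cases l) auto
  define v where "v = zpow l + scl (of_real e) (zpow_refl l)"
  have ee: "complex_of_real e * of_real e = 1" using e by auto
  have rv: "rho (rf 0) v = scl (of_real e) v"
    unfolding v_def by (simp add: rho_rules rf_zpow_refl tm.scale_right_distrib ee add.commute flip: zpow_refl_def)
  have "dform l v (zpow_refl l) = dform l (scl (of_real e * of_real e) v) (zpow_refl l)" by (simp add: ee)
  also have "\<dots> = of_real e * dform l (rho (rf 0) v) (rho (rf 0) (zpow l))"
    unfolding rv zpow_refl_def by (simp add: dform_scl1)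
  also have "\<dots> = of_real e * dform l v (zpow l)" unfolding dform_inv[OF rf_mem] ..
  finally have "dform l v v = dform l v (zpow l) + of_real e * of_real e * dform l v (zpow l)"
    by (subst (2) v_def) (simp add: dform_add2 dform_scl2 mult.assoc)
  then have 1: "dform l v v = 2 * dform l v (zpow l)" unfolding ee by simp
  let ?K = "2 * of_nat l + of_real e * (2 * of_real c * of_nat m) :: complex"
  have "ya v = scl ?K (zpow j)"
    unfolding v_def zpow_refl_def using ya_zpow[of l] yb_zpow_top j
    by (simp add: linop_rules[OF linop_ya] ya_rf rho_rules rf_zpow_refl tm.scale_left_distrib)
  moreover have "dform l v (zpow l) = dform j (ya v) (zpow j)" unfolding j zpow.simps dform_xz ..
  ultimately have "dform l v v = (2 * ?K) * dform j (zpow j) (zpow j)"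
    unfolding 1 by (simp only: dform_scl1 mult.assoc)
  also have "2 * ?K = of_real (4 * (real l + e * c * real m))"
    by (simp add: algebra_simps)
  finally have eq: "dform l v v = of_real (4 * (real l + e * c * real m)) * dform j (zpow j) (zpow j)" .
  have "fsupp (zpow n)" for n by (induction n) (simp_all add: xz_def fsupp_rules)
  then have "fsupp v" unfolding v_def zpow_refl_def by (intro fsupp_rules fsupp_ops)
  then have "0 \<le> Re (dform l v v)" by (rule p[unfolded psd_def, rule_format])
  then have "0 \<le> Re (of_real (4 * (real l + e * c * real m)) * dform j (zpow j) (zpow j))" unfolding eq .
  moreover have "Re (of_real a * z) = a * Re z" for a z by simp
  ultimately have "0 \<le> (4 * (real l + e * c * real m)) * Re (dform j (zpow j) (zpow j))" by (simp only:)
  moreover have "0 < Re (dform j (zpow j) (zpow j))" using dform_zpow_pos[of j] j by simp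
  ultimately have "0 \<le> 4 * (real l + e * c * real m)"
    using zero_le_mult_iff not_less by metis
  moreover have "0 \<le> a" if "0 \<le> 4 * a" for a :: real using that by linarith
  ultimately show ?thesis by blast
qed

end

section \<open>The unitary parameters\<close>

text \<open>
  Averaging the standard inner product over \<open>W\<close>.
\<close>

lemma (in refl_rep) invariant_inner_product_exists: "\<exists>\<beta>0. invariant_inner_product W \<tau> \<beta>0"
proof -
  define b where "b u v = (\<Sum>g\<in>W. herm (\<tau> g *v u) (\<tau> g *v v))" for u v
  have h: "herm (x + y) z = herm x z + herm y z" "herm (a *s x) z = a * herm x z" "herm z x = cnj (herm x z)"
    for x y z :: "complex ^ 'k" and a
    by (simp_all add: herm_def algebra_simps sum.distrib sum_distrib_left)
  have hn: "herm x x = of_real (\<Sum>i\<in>UNIV. (cmod (x $ i))\<^sup>2)" for x :: "complex ^ 'k"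
    by (simp only: herm_def complex_norm_square of_real_sum)
  have b_real: "b u u = of_real (\<Sum>g\<in>W. \<Sum>i\<in>UNIV. (cmod ((\<tau> g *v u) $ i))\<^sup>2)" for u
    unfolding b_def hn of_real_sum ..
  have pos: "0 < Re (b u u)" if u: "u \<noteq> 0" for u
  proof -
    have t1: "\<tau> (mat 1) *v u = u" using rep by (simp add: is_rep_def)
    obtain i where i: "u $ i \<noteq> 0" using u by (auto simp: vec_eq_iff)
    have "0 < (\<Sum>g\<in>W. \<Sum>i\<in>UNIV. (cmod ((\<tau> g *v u) $ i))\<^sup>2)"
    proof (rule sum_pos2[OF fin_W one_W])
      show "0 < (\<Sum>i\<in>UNIV. (cmod ((\<tau> (mat 1) *v u) $ i))\<^sup>2)"
        unfolding t1 by (rule sum_pos2[of _ i]) (use i in auto)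
    qed (auto intro: sum_nonneg)
    then show ?thesis unfolding b_real by simp
  qed
  have inv: "b (\<tau> h *v u) (\<tau> h *v v) = b u v" if hW: "h \<in> W" for h u v
  proof -
    have "b (\<tau> h *v u) (\<tau> h *v v) = (\<Sum>g\<in>W. herm (\<tau> (g ** h) *v u) (\<tau> (g ** h) *v v))"
      unfolding b_def using rep hW by (intro sum.cong) (auto simp: is_rep_def matrix_vector_mul_assoc)
    also have "\<dots> = b u v" unfolding b_def
    proof (rule sum.reindex_bij_witness[where i = "\<lambda>g. g ** transpose h" and j = "\<lambda>g. g ** h"])
      fix g assume "g \<in> W"
      then show "g ** h \<in> W" "g ** transpose h \<in> W" using hW mult_W transpose_W by auto
      show "g ** h ** transpose h = g" "g ** transpose h ** h = g"
        using orth_W[OF hW] orth_W'[OF hW] by (simp_all flip: matrix_mul_assoc)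
    qed simp
    finally show ?thesis .
  qed
  have "hermitian_form vec_group (*s) b"
    unfolding hermitian_form_def vec_group_def
    by (auto simp: b_def matrix_vector_right_distrib vector_scalar_commute h(1,2) sum.distrib sum_distrib_left
         intro!: sum.cong h(3))
  moreover have "positive_definite vec_group b"
    unfolding positive_definite_def vec_group_def using pos b_real by auto
  ultimately show ?thesis using inv unfolding invariant_inner_product_def by blast
qed

lemma irreducible_one_dimensional:
  fixes \<tau> :: "(2, 1) grp_rep"
  assumes "is_rep W \<tau>"
  shows "irreducible_rep W \<tau>"
  unfolding irreducible_rep_def
proof (intro conjI assms allI impI)
  fix U :: "(complex ^ 1) set" assume U: "vec.subspace U \<and> (\<forall>w\<in>W. \<forall>v\<in>U. \<tau> w *v v \<in> U)"
  show "U = {0} \<or> U = UNIV"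
  proof (cases "U \<subseteq> {0}")
    case True then show ?thesis using U vec.subspace_0 by blast
  next
    case False
    then obtain v where v: "v \<in> U" "v \<noteq> 0" by blast
    then have v1: "v $ 1 \<noteq> 0" by (simp add: vec_eq_iff)
    have "x \<in> U" for x
    proof -
      have "x = (x $ 1 / v $ 1) *s v" using v1 by (simp add: vec_eq_iff)
      then show ?thesis using U v(1) vec.subspace_scale by metis
    qed
    then show ?thesis by blast
  qed
qed

context dihedral_group
begin

lemma dihedral_formI:
  assumes irr: "irreducible_rep (dihedral m) \<tau>" and inner: "invariant_inner_product (dihedral m) \<tau> \<beta>0"
    and z: "\<And>v. (\<Sum>k<m. \<tau> (rf (int k)) *v v) = complex_of_real r *s v"
  shows "dihedral_form m \<tau> \<beta>0 r"
proof -
  have rep: "is_rep (dihedral m) \<tau>" using irr by (simp add: irreducible_rep_def)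
  interpret cherednik_form "dihedral m" 0 \<tau> \<beta>0
    by (rule cherednik_form_dihedral[OF rep inner])
  show ?thesis
    by unfold_locales (use irr z in \<open>simp_all add: scalar_Z_def sum_reflections\<close>)
qed

lemma unitary_irrE:
  assumes "unitary_irr (dihedral m) c \<tau>"
  obtains \<beta>0 \<beta> \<gamma> where "invariant_inner_product (dihedral m) \<tau> \<beta>0" "contravariant_form (dihedral m) c \<tau> \<beta>0 \<beta>"
    "\<forall>x\<in>carrier (std_module (dihedral m) c \<tau>). \<forall>x'\<in>carrier (std_module (dihedral m) c \<tau>).
       \<gamma> (max_submodule (dihedral m) c \<tau> #>\<^bsub>std_module (dihedral m) c \<tau>\<^esub> x)
         (max_submodule (dihedral m) c \<tau> #>\<^bsub>std_module (dihedral m) c \<tau>\<^esub> x') = \<beta> x x'"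
    "positive_definite (irr_module (dihedral m) c \<tau>) \<gamma>"
  using assms unfolding unitary_irr_def Let_def by blast

lemma inner_exists: "is_rep (dihedral m) \<tau> \<Longrightarrow> \<exists>\<beta>0. invariant_inner_product (dihedral m) \<tau> \<beta>0"
  using refl_rep.invariant_inner_product_exists[OF refl_rep_dihedral] .

lemma unitary_character:
  fixes \<tau> :: "(2, 1) grp_rep"
  assumes rep: "is_rep (dihedral m) \<tau>"
    and rt: "\<And>k v. \<tau> (rot k) *v v = v" and rfl: "\<And>k v. \<tau> (rf k) *v v = complex_of_real e *s v"
    and e: "e = 1 \<or> e = -1"
  shows "unitary_irr (dihedral m) c \<tau> \<longleftrightarrow> c * e * real m \<le> 1"
proof -
  have irr: "irreducible_rep (dihedral m) \<tau>" by (rule irreducible_one_dimensional[OF rep])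
  have z: "(\<Sum>k<m. \<tau> (rf (int k)) *v v) = complex_of_real (e * real m) *s v" for v
  proof -
    have "(\<Sum>k<m. complex_of_real e *s v) = (\<Sum>k<m. complex_of_real e) *s v"
      by (rule vec.scale_sum_left[symmetric])
    then show ?thesis unfolding rfl by (simp add: mult.commute del: sum_constant) simp
  qed
  show ?thesis
  proof
    assume "unitary_irr (dihedral m) c \<tau>"
    then obtain \<beta>0 \<beta> \<gamma> where u: "invariant_inner_product (dihedral m) \<tau> \<beta>0" "contravariant_form (dihedral m) c \<tau> \<beta>0 \<beta>"
      "\<forall>x\<in>carrier (std_module (dihedral m) c \<tau>). \<forall>x'\<in>carrier (std_module (dihedral m) c \<tau>).
         \<gamma> (max_submodule (dihedral m) c \<tau> #>\<^bsub>std_module (dihedral m) c \<tau>\<^esub> x)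
           (max_submodule (dihedral m) c \<tau> #>\<^bsub>std_module (dihedral m) c \<tau>\<^esub> x') = \<beta> x x'"
      "positive_definite (irr_module (dihedral m) c \<tau>) \<gamma>" by (rule unitary_irrE)
    interpret dihedral_form m c \<tau> \<beta>0 "e * real m" by (rule dihedral_formI[OF irr u(1) z])
    show "c * e * real m \<le> 1"
      by (rule character_bound[OF rt rfl psd_if_unitary[OF u(2-4)]])
  next
    assume c: "c * e * real m \<le> 1"
    obtain \<beta>0 where b: "invariant_inner_product (dihedral m) \<tau> \<beta>0" using inner_exists[OF rep] by blast
    interpret dihedral_form m c \<tau> \<beta>0 "e * real m" by (rule dihedral_formI[OF irr b z])
    show "unitary_irr (dihedral m) c \<tau>"
      by (rule unitary_if_psd) (rule psd_character[OF rt e HOL.refl c])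
  qed
qed

text \<open>
  The eigenvector \<open>ep\<close> and its mirror image \<open>em\<close> span a subrepresentation, hence all of \<open>\<tau>\<close>; this
  determines the exponents that occur.
\<close>

lemma unitary_tau:
  assumes tau: "is_tau m l \<tau>" and l1: "1 \<le> l" and lm: "2 * l < m"
  shows "unitary_irr (dihedral m) c \<tau> \<longleftrightarrow> \<bar>c\<bar> * real m \<le> real l"
proof -
  have irr: "irreducible_rep (dihedral m) \<tau>" using tau by (simp add: is_tau_def)
  then have rep: "is_rep (dihedral m) \<tau>" by (simp add: irreducible_rep_def)
  have mul: "\<tau> (g ** h) *v v = \<tau> g *v (\<tau> h *v v)" if "g \<in> dihedral m" "h \<in> dihedral m" for g h v
    using rep that by (simp add: is_rep_def matrix_vector_mul_assoc)
  have one: "\<tau> (mat 1) *v v = v" for v using rep by (simp add: is_rep_def)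
  have a1: "2 * pi / real m = ang 1" by (simp add: ang_def)
  have "cis (ang 1) ^ l \<in> {z. \<exists>v. v \<noteq> 0 \<and> \<tau> (rotation (ang 1)) *v v = z *s v}"
    using tau unfolding is_tau_def a1 by blast
  then obtain ep where ep: "ep \<noteq> 0" "\<tau> (rot 1) *v ep = cis (ang (int l)) *s ep"
    by (auto simp: rot_def Complex.DeMoivre ang_def mult_ac)
  have epn: "\<tau> (rot (int n)) *v ep = cis (ang (int l * int n)) *s ep" for n
  proof (induction n)
    case 0 show ?case by (simp add: rot_0 one ang_0)
  next
    case (Suc n)
    have "\<tau> (rot (int (Suc n))) *v ep = \<tau> (rot 1) *v (\<tau> (rot (int n)) *v ep)"
      by (simp add: mul[OF rot_mem rot_mem, symmetric] rot_add)
    also have "\<dots> = (cis (ang (int l * int n)) * cis (ang (int l))) *s ep"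
      unfolding Suc by (simp add: vector_scalar_commute ep mult.commute)
    also have "cis (ang (int l * int n)) * cis (ang (int l)) = cis (ang (int l * int (Suc n)))"
      by (simp add: cis_mult ang_add[symmetric] algebra_simps)
    finally show ?case .
  qed
  have epk: "\<tau> (rot k) *v ep = cis (ang (int l * k)) *s ep" for k
  proof (cases k rule: int_cases2)
    case (nonneg n) then show ?thesis using epn by simp
  next
    case (nonpos n)
    have "ep = \<tau> (rot k) *v (\<tau> (rot (int n)) *v ep)"
      by (simp add: mul[OF rot_mem rot_mem, symmetric] rot_add nonpos rot_0 one)
    also have "\<dots> = cis (ang (int l * int n)) *s (\<tau> (rot k) *v ep)"
      unfolding epn by (simp add: vector_scalar_commute)
    finally have "cis (ang (int l * k)) *s ep = (cis (ang (int l * k)) * cis (ang (int l * int n))) *s (\<tau> (rot k) *v ep)"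
      by (metis vector_smult_assoc)
    also have "cis (ang (int l * k)) * cis (ang (int l * int n)) = 1"
      by (simp add: cis_mult ang_add[symmetric] nonpos ang_0)
    finally show ?thesis by simp
  qed
  define em where "em = \<tau> (rf 0) *v ep"
  have emk: "\<tau> (rot k) *v em = cis (ang (- int l * k)) *s em" for k
  proof -
    have "\<tau> (rot k) *v em = \<tau> (rf 0) *v (\<tau> (rot (- k)) *v ep)"
      unfolding em_def by (simp add: mul[symmetric] rot_mem rf_mem mult_rules)
    then show ?thesis unfolding epk by (simp add: vector_scalar_commute em_def)
  qed
  have rf_em: "\<tau> (rf 0) *v em = ep"
    unfolding em_def by (simp add: mul[symmetric] rf_mem mult_rules rot_0 one)
  have rfk: "\<tau> (rf k) *v v = \<tau> (rot k) *v (\<tau> (rf 0) *v v)" for k v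
    by (simp add: mul[symmetric] rot_mem rf_mem mult_rules)
  define U where "U = {a *s ep + b *s em | a b. True}"
  have rotU: "\<tau> (rot k) *v v \<in> U" if v: "v \<in> U" for k v
  proof -
    obtain a b where "v = a *s ep + b *s em" using v unfolding U_def by blast
    then have "\<tau> (rot k) *v v = (a * cis (ang (int l * k))) *s ep + (b * cis (ang (- int l * k))) *s em"
      by (simp add: matrix_vector_right_distrib vector_scalar_commute epk emk)
    then show ?thesis unfolding U_def by blast
  qed
  have rfU: "\<tau> (rf 0) *v v \<in> U" if v: "v \<in> U" for v
  proof -
    obtain a b where "v = a *s ep + b *s em" using v unfolding U_def by blast
    then have "\<tau> (rf 0) *v v = b *s ep + a *s em"
      by (simp add: matrix_vector_right_distrib vector_scalar_commute rf_em em_def[symmetric] add.commute)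
    then show ?thesis unfolding U_def by blast
  qed
  have "vec.subspace U"
    unfolding vec.subspace_def
  proof (intro conjI ballI allI)
    show "0 \<in> U" unfolding U_def by (auto intro!: exI[of _ 0])
    fix x assume "x \<in> U"
    then obtain a b where x: "x = a *s ep + b *s em" unfolding U_def by blast
    show "k *s x \<in> U" for k
    proof -
      have "k *s x = (k * a) *s ep + (k * b) *s em" by (simp add: x vec.scale_right_distrib)
      then show ?thesis unfolding U_def by blast
    qed
    fix y assume "y \<in> U"
    then obtain a' b' where y: "y = a' *s ep + b' *s em" unfolding U_def by blast
    have "x + y = (a + a') *s ep + (b + b') *s em" by (simp add: x y vec.scale_left_distrib)
    then show "x + y \<in> U" unfolding U_def by blast
  qed
  moreover have "\<forall>g\<in>dihedral m. \<forall>v\<in>U. \<tau> g *v v \<in> U"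
  proof (intro ballI)
    fix g v assume "g \<in> dihedral m" and v: "v \<in> U"
    then consider k where "g = rot k" | k where "g = rf k" by (auto simp: dihedral_eq)
    then show "\<tau> g *v v \<in> U"
    proof cases
      case 1 then show ?thesis using rotU[OF v] by simp
    next
      case (2 k)
      show ?thesis unfolding 2 rfk[of k] by (rule rotU[OF rfU[OF v]])
    qed
  qed
  moreover have "U \<noteq> {0}"
  proof -
    have "ep = 1 *s ep + 0 *s em" by simp
    then have "ep \<in> U" unfolding U_def by blast
    then show ?thesis using ep(1) by blast
  qed
  ultimately have U: "U = UNIV" using irr unfolding irreducible_rep_def by blast
  have base: "(\<Sum>k<m. cis (ang (j * int k)) *s (\<tau> (rot (int k)) *v v)) = 0" if j: "\<bar>j\<bar> < int l" for j v
  proof -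
    have "v \<in> U" unfolding U by (rule UNIV_I)
    then obtain a b where v: "v = a *s ep + b *s em" unfolding U_def by blast
    have s: "(\<Sum>k<m. cis (ang ((j + i) * int k))) = 0" if "i = int l \<or> i = - int l" for i
      using j that l1 lm by (intro cis_sum_eq_0) auto
    have c: "cis (ang (j * k)) * (a * cis (ang (i * k))) = a * cis (ang ((j + i) * k))" for a i k
      using ang_add[of "j * k" "i * k"] by (simp add: cis_mult distrib_right mult.left_commute[of _ a])
    have "cis (ang (j * k)) *s (\<tau> (rot k) *v v)
       = (a * cis (ang ((j + int l) * k))) *s ep + (b * cis (ang ((j + - int l) * k))) *s em" for k
      unfolding v by (simp only: matrix_vector_right_distrib vector_scalar_commute epk emk vector_smult_assoc
          vec.scale_right_distrib c)
    then have "(\<Sum>k<m. cis (ang (j * int k)) *s (\<tau> (rot (int k)) *v v))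
      = (a * (\<Sum>k<m. cis (ang ((j + int l) * int k)))) *s ep + (b * (\<Sum>k<m. cis (ang ((j + - int l) * int k)))) *s em"
      by (simp only: sum.distrib vec.scale_sum_left sum_distrib_left)
    then show ?thesis by (simp only: s simp_thms mult_zero_right vec.scale_zero_left add_0)
  qed
  have z: "(\<Sum>k<m. \<tau> (rf (int k)) *v v) = complex_of_real 0 *s v" for v
    using base[of 0 "\<tau> (rf 0) *v v"] l1 by (simp add: rfk[symmetric] ang_0)
  have loc: "dihedral_tau m \<tau> \<beta>0 l ep" if "invariant_inner_product (dihedral m) \<tau> \<beta>0" for \<beta>0
    by (intro dihedral_tau.intro dihedral_formI[OF irr that z] dihedral_tau_axioms.intro l1 lm ep(1) epk base)
  show ?thesis
  proof
    assume "unitary_irr (dihedral m) c \<tau>"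
    then obtain \<beta>0 \<beta> \<gamma> where u: "invariant_inner_product (dihedral m) \<tau> \<beta>0" "contravariant_form (dihedral m) c \<tau> \<beta>0 \<beta>"
      "\<forall>x\<in>carrier (std_module (dihedral m) c \<tau>). \<forall>x'\<in>carrier (std_module (dihedral m) c \<tau>).
         \<gamma> (max_submodule (dihedral m) c \<tau> #>\<^bsub>std_module (dihedral m) c \<tau>\<^esub> x)
           (max_submodule (dihedral m) c \<tau> #>\<^bsub>std_module (dihedral m) c \<tau>\<^esub> x') = \<beta> x x'"
      "positive_definite (irr_module (dihedral m) c \<tau>) \<gamma>" by (rule unitary_irrE)
    interpret dihedral_tau m c \<tau> \<beta>0 l ep by (rule loc[OF u(1)])
    have "0 \<le> real l + e * c * real m" if "e = 1 \<or> e = -1" for e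
      by (rule tau_bound[OF psd_if_unitary[OF u(2-4)] that])
    from this[of 1] this[of "-1"] show "\<bar>c\<bar> * real m \<le> real l" by (cases "0 \<le> c") auto
  next
    assume c: "\<bar>c\<bar> * real m \<le> real l"
    obtain \<beta>0 where b: "invariant_inner_product (dihedral m) \<tau> \<beta>0" using inner_exists[OF rep] by blast
    interpret dihedral_tau m c \<tau> \<beta>0 l ep by (rule loc[OF b])
    show "unitary_irr (dihedral m) c \<tau>"
      by (rule unitary_if_psd) (rule psd_tau[OF c])
  qed
qed

end

theorem proposition4p3:
  fixes d :: nat
  assumes "d \<ge> 1"
  shows "unitary_set (dihedral (2 * d + 1)) triv_rep = {..1 / real (2 * d + 1)} \<and>
         unitary_set (dihedral (2 * d + 1)) sign_rep = {- 1 / real (2 * d + 1)..} \<and>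
         (\<forall>l \<tau>. 1 \<le> l \<and> l \<le> d \<and> is_tau (2 * d + 1) l \<tau> \<longrightarrow>
            unitary_set (dihedral (2 * d + 1)) \<tau>
              = {- (real l / real (2 * d + 1))..real l / real (2 * d + 1)})"
proof -
  define m where "m = 2 * d + 1"
  interpret dihedral_group m using assms by unfold_locales (simp add: m_def)
  have m0: "0 < real m" using m3 by simp
  have det_rot: "det (rot k) = 1" for k
    using sin_cos_squared_add2[of "ang k"] by (simp add: det_2 rot_def power2_eq_square)
  have det_rf: "det (rf k) = -1" for k
  proof -
    have "det (rf k) = - ((sin (ang k))\<^sup>2 + (cos (ang k))\<^sup>2)"
      by (simp add: det_2 rf_nth power2_eq_square)
    then show ?thesis by (simp only: sin_cos_squared_add)
  qed
  have mat_vec: "mat a *v v = a *s v" for a and v :: "complex ^ 1"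
    by (simp add: matrix_vector_mult_def mat_def vec_eq_iff)
  have "is_rep (dihedral m) triv_rep" by (simp add: is_rep_def triv_rep_def)
  then have "unitary_irr (dihedral m) c triv_rep \<longleftrightarrow> c * 1 * real m \<le> 1" for c
    by (rule unitary_character) (simp_all add: triv_rep_def)
  then have 1: "unitary_set (dihedral m) triv_rep = {..1 / real m}"
    unfolding unitary_set_def atMost_def pos_le_divide_eq[OF m0] by (simp only: mult_1_right)
  have mat_mat: "mat a ** mat b = (mat (a * b) :: complex ^ 1 ^ 1)" for a b
    by (simp add: vec_eq_iff matrix_matrix_mult_def mat_def)
  have "is_rep (dihedral m) sign_rep"
    unfolding is_rep_def sign_rep_def by (simp only: det_I det_mul of_real_mult of_real_1 mat_mat) simp
  then have s: "unitary_irr (dihedral m) c sign_rep \<longleftrightarrow> c * (-1) * real m \<le> 1" for c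
    by (rule unitary_character) (simp_all add: sign_rep_def det_rot det_rf mat_vec)
  have "c * (-1) * real m \<le> 1 \<longleftrightarrow> - 1 / real m \<le> c" for c
    unfolding pos_divide_le_eq[OF m0] by linarith
  then have 2: "unitary_set (dihedral m) sign_rep = {- 1 / real m..}"
    unfolding unitary_set_def atLeast_def s by (simp only:)
  have 3: "unitary_set (dihedral m) \<tau> = {- (real l / real m)..real l / real m}"
    if "1 \<le> l \<and> l \<le> d \<and> is_tau m l \<tau>" for l \<tau>
  proof -
    have "unitary_irr (dihedral m) c \<tau> \<longleftrightarrow> \<bar>c\<bar> * real m \<le> real l" for c
      using that by (intro unitary_tau) (auto simp: m_def)
    then have h: "unitary_irr (dihedral m) c \<tau> \<longleftrightarrow> - (real l / real m) \<le> c \<and> c \<le> real l / real m" for c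
      unfolding pos_le_divide_eq[OF m0, symmetric] by (simp add: abs_le_iff) linarith
    show ?thesis by (rule Set.set_eqI) (simp only: unitary_set_def mem_Collect_eq atLeastAtMost_iff h)
  qed
  show ?thesis using 1 2 3 unfolding m_def by blast
qed

end
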